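(* Let $X$ be a finite dimensional Banach space with Haar measure $\lambda$ and let $Y$ be a separable Banach space with the Radon-Nikodým property. Let the space $\mathrm{Hom}(X,Y)$ of linear operators $X\to Y$ be equipped with some norm $|||\cdot|||$, which is the norm used in the definition of $|Df(a)|$ below. If $f:X\to\mathcal{Q}_Q(Y)$ is Lipschitz then $$\mathrm{lip}_a f\le|Df(a)|\le\sqrt{Q}\,(\mathrm{lip}_a f)$$ for $\lambda$-almost every $a\in X$.
   Context: $Q\ge1$ is an integer. $\mathcal{Q}_Q(Y)$ is the quotient of $Y^Q$ by the permutation action of the symmetric group $S_Q$; the class of $(y_1,\dots,y_Q)$ is $[\![y_1,\dots,y_Q]\!]$; the metric is $\mathcal{G}([\![y_1,\dots,y_Q]\!],[\![y_1',\dots,y_Q']\!])=\min_{\sigma\in S_Q}\big(\sum_{i=1}^Q\|y_i-y'_{\sigma(i)}\|^2\big)^{1/2}$. $B(a,r)$ denotes the ball of center $a$ and radius $r$ in $X$. $\mathrm{lip}_a f:=\limsup_{r\to0}\ \sup_{x\in B(a,r),\,x\ne a}\frac{\mathcal{G}(f(x),f(a))}{\|x-a\|}$. $f$ is approximately differentiable at $a$ if there are affine maps $A_1,\dots,A_Q:X\to Y$ such that for every $\varepsilon>0$ the set $E_\varepsilon=\{x:\mathcal{G}(f(x),[\![A_1(x),\dots,A_Q(x)]\!])>\varepsilon\|x-a\|\}$ satisfies $\lambda(E_\varepsilon\cap B(a,r))/\lambda(B(a,r))\to0$ as $r\to0$; the unordered tuple of the $A_i$ is then unique. With $L_i=A_i-A_i(0)$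 (the linear parts), put $Df(a)=[\![L_1,\dots,L_Q]\!]$, an unordered $Q$-tuple of elements of $\mathrm{Hom}(X,Y)$, and $|Df(a)|=\big(\sum_{i=1}^Q|||L_i|||^2\big)^{1/2}$. A Lipschitz $f$ is approximately differentiable $\lambda$-almost everywhere.
   Formalization: The norm on Hom(X,Y) is taken to be the operator norm instead of "some norm"; for an arbitrary norm the claim fails (Q=1, f(x)=[[Lx]] linear and nonzero, norm equal to twice the operator norm violates the upper bound). *)

theory Defs
  imports "HOL-Probability.Probability" "HOL-Library.Multiset"
begin

text \<open>
  The unordered \<open>Q\<close>-tuples of elements of \<open>Y\<close>, that is, \<open>Y\<^sup>Q\<close> modulo the symmetric group,
  are the multisets of size \<open>Q\<close>. The distance of two of them is the minimum over the pairs of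
  enumerations; fixing one enumeration of each and letting a permutation of the indices run
  gives the same finite set of values. It is only meaningful for multisets of equal size.
\<close>

definition qdist :: "'y::real_normed_vector multiset \<Rightarrow> 'y multiset \<Rightarrow> real" where
  "qdist S T = Min {sqrt (\<Sum>i<size S. (norm (ys ! i - zs ! i))\<^sup>2) | ys zs. mset ys = S \<and> mset zs = T}"

definition qlipschitz :: "('x::real_normed_vector \<Rightarrow> 'y::real_normed_vector multiset) \<Rightarrow> bool" where
  "qlipschitz f \<longleftrightarrow> (\<exists>C\<ge>0. \<forall>x x'. qdist (f x) (f x') \<le> C * norm (x - x'))"

text \<open>
  Values are in \<open>[0, \<infinity>]\<close>, so that the supremum over the empty set (which occurs only if the
  domain is the null space) is \<open>0\<close>.
\<close>

definition qlip :: "('x::real_normed_vector \<Rightarrow> 'y::real_normed_vector multiset) \<Rightarrow> 'x \<Rightarrow> ennreal" where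
  "qlip f a = Limsup (at_right (0::real))
     (\<lambda>r. SUP x\<in>cball a r - {a}. ennreal (qdist (f x) (f a) / norm (x - a)))"

text \<open>
  Regularity is not required: on a finite dimensional space it follows from the finiteness
  on compact sets.
\<close>

definition haar_measure :: "'x::real_normed_vector measure \<Rightarrow> bool" where
  "haar_measure \<mu> \<longleftrightarrow>
     sets \<mu> = sets borel \<and>
     emeasure \<mu> UNIV \<noteq> 0 \<and>
     (\<forall>K. compact K \<longrightarrow> emeasure \<mu> K < \<infinity>) \<and>
     (\<forall>a. \<forall>A\<in>sets borel. emeasure \<mu> ((+) a ` A) = emeasure \<mu> A)"

definition vector_measure :: "'w measure \<Rightarrow> ('w set \<Rightarrow> 'y::real_normed_vector) \<Rightarrow> bool" where
  "vector_measure M \<nu> \<longleftrightarrow>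
     (\<forall>A::nat \<Rightarrow> 'w set. range A \<subseteq> sets M \<and> disjoint_family A \<longrightarrow>
        (\<lambda>i. \<nu> (A i)) sums \<nu> (\<Union>i. A i))"

definition finite_variation :: "'w measure \<Rightarrow> ('w set \<Rightarrow> 'y::real_normed_vector) \<Rightarrow> bool" where
  "finite_variation M \<nu> \<longleftrightarrow>
     (\<exists>C. \<forall>P. finite P \<and> P \<subseteq> sets M \<and> disjoint P \<longrightarrow> (\<Sum>A\<in>P. norm (\<nu> A)) \<le> C)"

text \<open>
  The underlying sets of the finite measure spaces are sets of real numbers (with arbitrary
  \<open>\<sigma>\<close>-algebras), because a definition cannot quantify over types. This includes the
  Lebesgue unit interval, for which the property already implies the one for all finite
  measure spaces.
\<close>

definition radon_nikodym_property :: "'y::{banach, second_countable_topology} itself \<Rightarrow> bool" where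
  "radon_nikodym_property _ \<longleftrightarrow>
     (\<forall>(M::real measure) (\<nu>::real set \<Rightarrow> 'y).
        finite_measure M \<and> vector_measure M \<nu> \<and> finite_variation M \<nu> \<and>
        (\<forall>A\<in>null_sets M. \<nu> A = 0) \<longrightarrow>
        (\<exists>g. integrable M g \<and> (\<forall>A\<in>sets M. \<nu> A = (LINT x:A|M. g x))))"

definition affine_map :: "('x::real_vector \<Rightarrow> 'y::real_vector) \<Rightarrow> bool" where
  "affine_map A \<longleftrightarrow> linear (\<lambda>x. A x - A 0)"

text \<open>
  For continuous \<open>f\<close> the exceptional set is open, hence measurable; for other \<open>f\<close> the notion
  below is not intended.
\<close>

definition approx_tangent ::
  "'x::real_normed_vector measure \<Rightarrow> nat \<Rightarrow> ('x \<Rightarrow> 'y::real_normed_vector multiset) \<Rightarrow> 'x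
    \<Rightarrow> ('x \<Rightarrow> 'y) multiset \<Rightarrow> bool" where
  "approx_tangent \<mu> Q f a As \<longleftrightarrow>
     size As = Q \<and> (\<forall>A\<in>#As. affine_map A) \<and>
     (\<forall>\<epsilon>>0. ((\<lambda>r. measure \<mu> ({x. qdist (f x) {#A x. A \<in># As#} > \<epsilon> * norm (x - a)} \<inter> cball a r)
                     / measure \<mu> (cball a r)) \<longlongrightarrow> 0) (at_right 0))"

definition approx_differentiable ::
  "'x::real_normed_vector measure \<Rightarrow> nat \<Rightarrow> ('x \<Rightarrow> 'y::real_normed_vector multiset) \<Rightarrow> 'x \<Rightarrow> bool" where
  "approx_differentiable \<mu> Q f a \<longleftrightarrow> (\<exists>As. approx_tangent \<mu> Q f a As)"

text \<open>The choice is immaterial, since there is at most one such unordered tuple of affine maps.\<close>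

definition approx_deriv ::
  "'x::real_normed_vector measure \<Rightarrow> nat \<Rightarrow> ('x \<Rightarrow> 'y::real_normed_vector multiset) \<Rightarrow> 'x
    \<Rightarrow> ('x \<Rightarrow> 'y) multiset" where
  "approx_deriv \<mu> Q f a =
     image_mset (\<lambda>A x. A x - A 0) (SOME As. approx_tangent \<mu> Q f a As)"

text \<open>
  The norm on the space of linear operators is the operator norm. No other norm will do
  for comparing this quantity with \<^const>\<open>qlip\<close>: for \<open>Q = 1\<close> and a linear map both inequalities
  together say that the norm of the map is its operator norm.
\<close>

definition deriv_norm :: "('x::real_normed_vector \<Rightarrow> 'y::real_normed_vector) multiset \<Rightarrow> real" where
  "deriv_norm D = sqrt (\<Sum>L\<in>#D. (onorm L)\<^sup>2)"

end

theory Submission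
  imports Defs
begin

text \<open>
  Lipschitz curves in \<open>Y\<close> are differentiable almost everywhere: the Radon-Nikodym property gives
  a density of the vector measure that extends the increments of the curve, and the curve is
  differentiable at the density points of the sets on which this density is almost constant.
  By Fubini, Lipschitz maps \<open>X \<rightarrow> Y\<close> have almost everywhere a derivative along each line.
  These are joined to a total derivative without test functions, by means of distance functions:
  if \<open>infdist _ E\<close> is differentiable at \<open>a \<in> E\<close>, then its derivative vanishes, so that the points
  near \<open>a\<close> are relatively close to points of \<open>E\<close>.

  The same device treats the multivalued map \<open>f\<close>. Countably many sets cover \<open>X\<close>, on each of which
  the \<open>Q\<close> values of \<open>f\<close> form clusters of coinciding points; the values are then cluster means,
  which extend to Lipschitz maps on all of \<open>X\<close>. Hence \<open>f\<close> has almost everywhere a tangent in the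
  strong sense of uniform approximation near the point.

  Conversely, every approximate tangent of a Lipschitz map is a tangent in the strong sense, and
  then \<open>qlip f a\<close> is the supremum of \<open>(\<Sum>\<^sub>i |L\<^sub>i v|\<^sup>2)\<^sup>1\<^sup>/\<^sup>2\<close> over unit vectors \<open>v\<close>, since near \<open>a\<close> only
  branches with the same value at \<open>a\<close> can be matched. This lies between \<open>max\<^sub>i |L\<^sub>i|\<close> and \<open>|Df(a)|\<close>.
\<close>

section \<open>Finite dimensional normed spaces\<close>

text \<open>A distance function is 1-Lipschitz for every set, so the argument with
  \<open>infdist\<close> applies to arbitrary, possibly nonmeasurable sets, and the separability of
  \<open>Y\<close> reduces it to countably many of them. On \<open>X\<close> this leaves mainly two
  measure-theoretic facts: a Borel set that meets all lines of one direction in null sets is null,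
  and balls have the doubling property. Vitali coverings are confined to the real line.

  The price is that real-valued Lipschitz functions must be differentiable almost everywhere as
  well. This is derived from curves in \<open>Y\<close> by placing the real line inside
  \<open>Y\<close>, whence the separate case of the null space \<open>Y\<close> at the end.

  Both inequalities are proved for every approximate tangent, hence for the one selected by
  \<open>SOME\<close> in \<open>approx_deriv\<close>.\<close>

locale finite_basis =
  fixes B :: "'x::banach set"
  assumes finite_B: "finite B" and independent_B: "independent B" and span_B: "span B = UNIV"
begin

lemma sum_representation: "(\<Sum>b\<in>B. representation B x b *\<^sub>R b) = x"
  by (rule real_vector.sum_representation_eq[OF independent_B]) (auto simp: span_B finite_B)

text \<open>Tychonoff's theorem in the function space \<open>'x \<Rightarrow> real\<close>.
  Coefficients outside \<open>B\<close> are pinned to 0, so that the box is compact in the product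
  over the whole type.\<close>

lemma compact_coefficients:
  "compact {c::'x \<Rightarrow> real. \<forall>b. c b \<in> (if b \<in> B then {-M..M} else {0})}"
proof -
  have "compactin (product_topology (\<lambda>i. euclidean) UNIV)
      (PiE (UNIV::'x set) (\<lambda>b. if b \<in> B then {-M..M::real} else {0}))"
    by (subst compactin_PiE) auto
  moreover have "PiE (UNIV::'x set) (\<lambda>b. if b \<in> B then {-M..M::real} else {0})
      = {c. \<forall>b. c b \<in> (if b \<in> B then {-M..M} else {0})}"
    unfolding PiE_UNIV_domain Pi_def by blast
  ultimately show ?thesis
    by (simp add: euclidean_product_topology)
qed

lemma continuous_combination: "continuous_on S (\<lambda>c::'x \<Rightarrow> real. \<Sum>b\<in>B. c b *\<^sub>R b)"
  by (intro continuous_intros continuous_on_product_then_coordinatewise continuous_on_id)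

text \<open>Equivalence with the l1 norm of the coefficients: on the compact l1 unit sphere the
  given norm attains its minimum, which is positive by independence; homogeneity does the
  rest.\<close>

lemma norm_combination_ge:
  obtains m where "m > 0" "\<And>c. m * (\<Sum>b\<in>B. \<bar>c b\<bar>) \<le> norm (\<Sum>b\<in>B. c b *\<^sub>R b)"
proof (cases "B = {}")
  case True
  then show ?thesis using that[of 1] by simp
next
  case False
  define K where "K = {c::'x \<Rightarrow> real. \<forall>b. c b \<in> (if b \<in> B then {-1..1} else {0})}
     \<inter> {c. (\<Sum>b\<in>B. \<bar>c b\<bar>) = 1}"
  have cont: "continuous_on UNIV (\<lambda>c::'x \<Rightarrow> real. \<Sum>b\<in>B. \<bar>c b\<bar>)"
    by (intro continuous_intros continuous_on_product_then_coordinatewise continuous_on_id)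
  have "compact K"
    unfolding K_def
    by (intro compact_Int_closed compact_coefficients closed_Collect_eq cont continuous_intros)
  moreover have "K \<noteq> {}"
  proof -
    obtain b0 where "b0 \<in> B" using False by blast
    then have "(\<lambda>b. if b = b0 then 1 else 0) \<in> K"
      using finite_B by (auto simp: K_def if_distrib[of abs] cong: if_cong)
    then show ?thesis by blast
  qed
  ultimately have "\<exists>c0\<in>K. \<forall>c\<in>K. norm (\<Sum>b\<in>B. c0 b *\<^sub>R b) \<le> norm (\<Sum>b\<in>B. c b *\<^sub>R b)"
    by (rule continuous_attains_inf[OF _ _ continuous_on_norm[OF continuous_combination]])
  then obtain c0 where c0: "c0 \<in> K"
    and min: "\<And>c. c \<in> K \<Longrightarrow> norm (\<Sum>b\<in>B. c0 b *\<^sub>R b) \<le> norm (\<Sum>b\<in>B. c b *\<^sub>R b)"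
    by blast
  define m where "m = norm (\<Sum>b\<in>B. c0 b *\<^sub>R b)"
  have "m \<noteq> 0"
  proof
    assume "m = 0"
    then have "(\<Sum>b\<in>B. c0 b *\<^sub>R b) = 0" by (simp add: m_def)
    then have "\<forall>b\<in>B. c0 b = 0"
      using independent_B finite_B by (auto simp: independent_explicit_finite_subsets)
    then show False using c0 by (simp add: K_def)
  qed
  then have "m > 0" by (simp add: m_def)
  moreover have "m * (\<Sum>b\<in>B. \<bar>c b\<bar>) \<le> norm (\<Sum>b\<in>B. c b *\<^sub>R b)" for c
  proof (cases "(\<Sum>b\<in>B. \<bar>c b\<bar>) = 0")
    case False
    define s where "s = (\<Sum>b\<in>B. \<bar>c b\<bar>)"
    have "s > 0" using False by (simp add: s_def sum_nonneg less_le)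
    have le: "\<bar>c b\<bar> \<le> s" if "b \<in> B" for b
      unfolding s_def using finite_B that by (intro member_le_sum) auto
    have "(\<lambda>b. if b \<in> B then c b / s else 0) \<in> K"
      unfolding K_def using \<open>s > 0\<close> le
      by (auto simp: abs_le_iff divide_le_eq le_divide_eq minus_le_iff s_def[symmetric]
          simp flip: sum_divide_distrib)
    from min[OF this] have "m \<le> norm (\<Sum>b\<in>B. (c b / s) *\<^sub>R b)"
      by (simp add: m_def)
    also have "(\<Sum>b\<in>B. (c b / s) *\<^sub>R b) = (1 / s) *\<^sub>R (\<Sum>b\<in>B. c b *\<^sub>R b)"
      by (simp add: scaleR_sum_right divide_inverse mult.commute)
    finally show ?thesis
      using \<open>s > 0\<close> by (simp add: field_simps s_def[symmetric])
  qed simp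
  ultimately show ?thesis using that by blast
qed

lemma sum_representation_le:
  obtains K where "K > 0" "\<And>x. (\<Sum>b\<in>B. \<bar>representation B x b\<bar>) \<le> K * norm x"
proof -
  obtain m where m: "m > 0" "\<And>c. m * (\<Sum>b\<in>B. \<bar>c b\<bar>) \<le> norm (\<Sum>b\<in>B. c b *\<^sub>R b)"
    using norm_combination_ge by blast
  have "(\<Sum>b\<in>B. \<bar>representation B x b\<bar>) \<le> (1 / m) * norm x" for x
    using m(2)[of "representation B x"] m(1) by (simp add: sum_representation field_simps)
  with m(1) show ?thesis using that[of "1 / m"] by simp
qed

text \<open>The coefficients of the points of a ball are bounded, so the ball is a closed subset of
  the continuous image of a coefficient box.\<close>

lemma compact_cball [simp]: "compact (cball (a::'x) r)"
proof -
  obtain K where K: "K > 0" "\<And>x. (\<Sum>b\<in>B. \<bar>representation B x b\<bar>) \<le> K * norm x"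
    using sum_representation_le by blast
  define M where "M = K * (norm a + \<bar>r\<bar>)"
  let ?S = "(\<lambda>c::'x \<Rightarrow> real. \<Sum>b\<in>B. c b *\<^sub>R b) ` {c. \<forall>b. c b \<in> (if b \<in> B then {-M..M} else {0})}"
  have "compact ?S"
    by (intro compact_continuous_image continuous_combination compact_coefficients)
  moreover have "cball a r \<subseteq> ?S"
  proof
    fix x assume "x \<in> cball a r"
    then have "norm x \<le> norm a + \<bar>r\<bar>"
      using norm_triangle_ineq2[of x a] by (simp add: dist_norm norm_minus_commute)
    then have "K * norm x \<le> M" using K(1) by (simp add: M_def)
    then have "\<bar>representation B x b\<bar> \<le> M" if "b \<in> B" for b
      using member_le_sum[of b B "\<lambda>b. \<bar>representation B x b\<bar>"] finite_B that K(2)[of x] by auto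
    then have "(\<lambda>b. if b \<in> B then representation B x b else 0)
        \<in> {c. \<forall>b. c b \<in> (if b \<in> B then {-M..M} else {0})}"
      by (auto simp: abs_le_iff minus_le_iff)
    moreover have "x = (\<Sum>b\<in>B. (if b \<in> B then representation B x b else 0) *\<^sub>R b)"
      using sum_representation[of x] by simp
    ultimately show "x \<in> ?S"
      by (intro image_eqI[where x="\<lambda>b. if b \<in> B then representation B x b else 0"])
  qed
  ultimately have "compact (?S \<inter> cball a r)" by (intro compact_Int_closed) auto
  moreover have "?S \<inter> cball a r = cball a r" using \<open>cball a r \<subseteq> ?S\<close> by blast
  ultimately show ?thesis by simp
qed

lemma finite_net:
  assumes "\<epsilon> > 0"
  obtains P where "finite P" "cball (a::'x) r \<subseteq> (\<Union>p\<in>P. ball p \<epsilon>)"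
proof -
  have "\<exists>P. finite P \<and> P \<subseteq> cball a r \<and> cball a r \<subseteq> (\<Union>p\<in>P. ball p \<epsilon>)"
    using seq_compact_imp_totally_bounded[OF compact_imp_seq_compact[OF compact_cball[of a r]]] assms
    by simp
  then show ?thesis using that by blast
qed

lemma countable_dense:
  obtains D :: "'x set" where "countable D" "\<And>x \<epsilon>. \<epsilon> > 0 \<Longrightarrow> \<exists>d\<in>D. dist d x < \<epsilon>"
proof -
  have "\<exists>P. finite P \<and> cball (0::'x) (real n) \<subseteq> (\<Union>p\<in>P. ball p (1 / real (Suc k)))" for n k
    using finite_net[of "1 / real (Suc k)" 0 "real n"] by (metis of_nat_0_less_iff zero_less_Suc zero_less_divide_1_iff)
  then obtain P where P: "\<And>n k. finite (P n k)"
    "\<And>n k. cball (0::'x) (real n) \<subseteq> (\<Union>p\<in>P n k. ball p (1 / real (Suc k)))"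
    by metis
  have "\<exists>d\<in>\<Union>n k. P n k. dist d x < \<epsilon>" if "\<epsilon> > 0" for x :: 'x and \<epsilon> :: real
  proof -
    obtain k where k: "1 / real (Suc k) < \<epsilon>" using \<open>\<epsilon> > 0\<close> nat_approx_posE by blast
    obtain n where "norm x \<le> real n" using real_arch_simple by blast
    then have "x \<in> cball 0 (real n)" by simp
    then have "x \<in> (\<Union>p\<in>P n k. ball p (1 / real (Suc k)))" using P(2)[of n k] by (rule subsetD[rotated])
    then obtain p where "p \<in> P n k" "dist p x < 1 / real (Suc k)" by auto
    then show ?thesis using k by (intro bexI[of _ p]) auto
  qed
  moreover have "countable (\<Union>n k. P n k)" by (intro countable_UN countableI_type) (auto simp: countable_finite P)
  ultimately show ?thesis by (intro that)
qed

lemma bounded_linear_of_linear: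
  fixes L :: "'x \<Rightarrow> 'z::real_normed_vector"
  assumes "linear L"
  shows "bounded_linear L"
proof -
  obtain K where K: "K > 0" "\<And>x. (\<Sum>b\<in>B. \<bar>representation B x b\<bar>) \<le> K * norm x"
    using sum_representation_le by blast
  define N where "N = (\<Sum>b\<in>B. norm (L b))"
  have "norm (L x) \<le> norm x * (K * N)" for x
  proof -
    have "L x = (\<Sum>b\<in>B. representation B x b *\<^sub>R L b)"
      by (subst sum_representation[of x, symmetric])
         (simp add: linear_sum[OF assms] linear_scale[OF assms])
    also have "norm \<dots> \<le> (\<Sum>b\<in>B. \<bar>representation B x b\<bar> * norm (L b))"
      by (rule order_trans[OF norm_sum]) simp
    also have "\<dots> \<le> (\<Sum>b\<in>B. \<bar>representation B x b\<bar> * N)"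
      unfolding N_def using finite_B
      by (intro sum_mono mult_left_mono member_le_sum) auto
    also have "\<dots> = (\<Sum>b\<in>B. \<bar>representation B x b\<bar>) * N" by (simp add: sum_distrib_right)
    also have "\<dots> \<le> (K * norm x) * N"
      using K(2)[of x] by (intro mult_right_mono) (simp_all add: N_def sum_nonneg)
    finally show ?thesis by (simp add: mult_ac)
  qed
  with assms show ?thesis
    by (intro bounded_linear_intro[where K="K * N"]) (auto simp: linear_add linear_scale)
qed

end

section \<open>Lipschitz curves\<close>

text \<open>A closed \<open>K\<close> inside \<open>E\<close> leaves a remainder \<open>W\<close> of
  measure below \<open>c * e / 2\<close>. Small intervals around a point outside \<open>E\<close>
  avoid \<open>K\<close>, so those with a large share of \<open>E\<close> have the same share of
  \<open>W\<close>. A disjoint Vitali family of them has total length at most \<open>2 / c\<close>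
  times the measure of \<open>W\<close>, the 2 being the ratio of length to radius.\<close>

lemma negligible_non_density_points:
  fixes E :: "real set"
  assumes E: "E \<in> sets lebesgue" and "c > 0"
  shows "negligible {t. t \<notin> E \<and> (\<forall>d>0. \<exists>r. 0 < r \<and> r < d \<and> c * r < measure lebesgue (E \<inter> cball t r))}"
    (is "negligible ?Z")
  unfolding negligible_outer_le
proof (intro allI impI)
  fix e :: real assume "e > 0"
  then have "c * e / 2 > 0" using \<open>c > 0\<close> by simp
  then obtain K where K: "closed K" "K \<subseteq> E" "E - K \<in> lmeasurable" "emeasure lebesgue (E - K) < ennreal (c * e / 2)"
    using sets_lebesgue_inner_closed[OF E] by metis
  define W where "W = E - K"
  have W: "W \<in> lmeasurable" using K by (simp add: W_def)
  have mW: "measure lebesgue W < c * e / 2"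
    using K(4) W \<open>c * e / 2 > 0\<close> by (simp add: W_def emeasure_eq_measure2 ennreal_less_iff)
  define I where "I = {i::real \<times> real. 0 < snd i \<and> c * snd i < measure lebesgue (W \<inter> cball (fst i) (snd i))}"
  have cover: "\<exists>i. i \<in> I \<and> t \<in> cball (fst i) (snd i) \<and> snd i < d" if "t \<in> ?Z" "0 < d" for t d
  proof -
    have "t \<in> - K" "open (- K)" using that K by auto
    then obtain d' where "d' > 0" "ball t d' \<subseteq> - K" by (meson open_contains_ball)
    moreover have "\<forall>d>0. \<exists>r. 0 < r \<and> r < d \<and> c * r < measure lebesgue (E \<inter> cball t r)"
      using \<open>t \<in> ?Z\<close> by blast
    with \<open>d > 0\<close> \<open>d' > 0\<close> obtain r where r: "0 < r" "r < min d d'" "c * r < measure lebesgue (E \<inter> cball t r)"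
      by (metis min_less_iff_conj)
    moreover from r have "cball t r \<subseteq> ball t d'" by auto
    ultimately have "E \<inter> cball t r = W \<inter> cball t r" unfolding W_def by blast
    with r show ?thesis by (intro exI[of _ "(t, r)"]) (auto simp: I_def)
  qed
  obtain C where C: "countable C" "C \<subseteq> I"
     "pairwise (\<lambda>i j. disjnt (cball (fst i) (snd i)) (cball (fst j) (snd j))) C"
     "negligible (?Z - (\<Union>i\<in>C. cball (fst i) (snd i)))"
    by (rule Vitali_covering_theorem_cballs[of I snd ?Z fst, OF _ cover]) (auto simp: I_def)
  have bound: "measure lebesgue (\<Union>i\<in>F. cball (fst i) (snd i)) \<le> e" if "F \<subseteq> C" "finite F" for F
  proof -
    have "measure lebesgue (\<Union>i\<in>F. cball (fst i) (snd i)) \<le> (\<Sum>i\<in>F. measure lebesgue (cball (fst i) (snd i)))"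
      using \<open>finite F\<close> by (intro measure_UNION_le) auto
    also have "\<dots> \<le> (\<Sum>i\<in>F. 2 / c * measure lebesgue (W \<inter> cball (fst i) (snd i)))"
      using that C(2) \<open>c > 0\<close>
      by (intro sum_mono) (force simp: I_def cball_eq_atLeastAtMost field_simps)
    also have "\<dots> = 2 / c * (\<Sum>i\<in>F. measure lebesgue (W \<inter> cball (fst i) (snd i)))"
      by (simp add: sum_distrib_left)
    also have "(\<Sum>i\<in>F. measure lebesgue (W \<inter> cball (fst i) (snd i)))
        = measure lebesgue (\<Union>i\<in>F. W \<inter> cball (fst i) (snd i))"
    proof (rule measure_UNION'[symmetric])
      show "pairwise (\<lambda>i j. disjnt (W \<inter> cball (fst i) (snd i)) (W \<inter> cball (fst j) (snd j))) F"
        using pairwise_subset[OF C(3) \<open>F \<subseteq> C\<close>] by (rule pairwise_mono) (auto simp: disjnt_def)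
    qed (use \<open>finite F\<close> W in \<open>auto intro: fmeasurable_Int_fmeasurable\<close>)
    also have "\<dots> \<le> measure lebesgue W"
      using W \<open>finite F\<close>
      by (intro measure_mono_fmeasurable sets.finite_UN sets.Int) (auto intro: fmeasurableD)
    finally have "measure lebesgue (\<Union>i\<in>F. cball (fst i) (snd i)) \<le> 2 / c * measure lebesgue W"
      using \<open>c > 0\<close> by (simp add: mult_left_mono divide_right_mono)
    also have "\<dots> \<le> 2 / c * (c * e / 2)"
      using mW \<open>c > 0\<close> by (intro mult_left_mono) auto
    finally show ?thesis using \<open>c > 0\<close> by simp
  qed
  have mea: "(\<Union>i\<in>C. cball (fst i) (snd i)) \<in> lmeasurable"
    and le: "measure lebesgue (\<Union>i\<in>C. cball (fst i) (snd i)) \<le> e"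
    using fmeasurable_UN_bound[OF C(1), of "\<lambda>i. cball (fst i) (snd i)" lebesgue e]
      measure_UN_bound[OF C(1), of "\<lambda>i. cball (fst i) (snd i)" lebesgue e] bound \<open>e > 0\<close>
    by auto
  let ?N = "?Z - (\<Union>i\<in>C. cball (fst i) (snd i))" and ?U = "\<Union>i\<in>C. cball (fst i) (snd i)"
  have N: "?N \<in> null_sets lebesgue" using C(4) by (simp add: negligible_iff_null_sets)
  show "\<exists>T. ?Z \<subseteq> T \<and> T \<in> lmeasurable \<and> measure lebesgue T \<le> e"
  proof (intro exI conjI)
    show "?Z \<subseteq> ?U \<union> ?N" by blast
    show "?U \<union> ?N \<in> lmeasurable"
      using mea N by (intro fmeasurable.Un) (auto simp: negligible_imp_measurable C(4))
    show "measure lebesgue (?U \<union> ?N) \<le> e"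
      using measure_Un_null_set[OF fmeasurableD[OF mea] N] le by simp
  qed
qed

lemma AE_density_points:
  fixes E :: "real set"
  assumes E: "E \<in> sets borel" and "c > 0"
  shows "AE t in lborel. t \<in> E \<longrightarrow> (\<exists>d>0. \<forall>r. 0 < r \<and> r < d \<longrightarrow> measure lborel (cball t r - E) \<le> c * r)"
proof -
  have "AE t in lebesgue. t \<in> E \<longrightarrow> (\<exists>d>0. \<forall>r. 0 < r \<and> r < d \<longrightarrow> measure lborel (cball t r - E) \<le> c * r)"
  proof (rule AE_I')
    show "{t. t \<notin> - E \<and> (\<forall>d>0. \<exists>r. 0 < r \<and> r < d \<and> c * r < measure lebesgue (- E \<inter> cball t r))}
       \<in> null_sets lebesgue"
      using negligible_non_density_points[of "- E" c] assms
      by (simp add: negligible_iff_null_sets)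
    have "- E \<inter> cball t r = cball t r - E" for t r by blast
    then show "{t \<in> space lebesgue. \<not> (t \<in> E \<longrightarrow> (\<exists>d>0. \<forall>r. 0 < r \<and> r < d \<longrightarrow> measure lborel (cball t r - E) \<le> c * r))}
      \<subseteq> {t. t \<notin> - E \<and> (\<forall>d>0. \<exists>r. 0 < r \<and> r < d \<and> c * r < measure lebesgue (- E \<inter> cball t r))}"
      using E by (auto simp: not_le)
  qed
  then show ?thesis by (simp add: AE_completion_iff)
qed

section \<open>The increments of a Lipschitz curve as a vector measure with a density\<close>

text \<open>Dominated convergence for the counting measure. It lets limits of vector measures pass
  through countable disjoint unions.\<close>

lemma tendsto_suminf_dominated:
  fixes a :: "nat \<Rightarrow> nat \<Rightarrow> 'y::{banach, second_countable_topology}"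
  assumes lim: "\<And>k. (\<lambda>n. a n k) \<longlonglongrightarrow> b k"
    and bound: "\<And>n k. norm (a n k) \<le> w k" and w: "summable w"
  shows "b sums suminf b" "(\<lambda>n. suminf (a n)) \<longlonglongrightarrow> suminf b"
proof -
  have w0: "0 \<le> w k" for k using bound[of 0 k] norm_ge_zero order_trans by blast
  have int: "integrable (count_space UNIV) w"
    using w w0 by (simp add: integrable_count_space_nat_iff)
  have 1: "integrable (count_space UNIV) b" "\<And>n. integrable (count_space UNIV) (a n)"
    and 2: "(\<lambda>n. integral\<^sup>L (count_space UNIV) (a n)) \<longlonglongrightarrow> integral\<^sup>L (count_space UNIV) b"
    using int lim bound
    by (auto intro!: integrable_dominated_convergence[of b "count_space UNIV" a w]
        integrable_dominated_convergence2[of b "count_space UNIV" a w]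
        integral_dominated_convergence[of b "count_space UNIV" a w])
  show "b sums suminf b"
    using sums_integral_count_space_nat[OF 1(1)] by (simp add: sums_iff)
  show "(\<lambda>n. suminf (a n)) \<longlonglongrightarrow> suminf b"
    using 2 1 by (simp add: integral_count_space_nat)
qed

lemma norm_set_integral_le:
  fixes \<phi> :: "'w \<Rightarrow> 'y::{banach, second_countable_topology}"
  assumes "finite_measure M" "\<phi> \<in> borel_measurable M" "\<And>t. norm (\<phi> t) \<le> L" "A \<in> sets M"
  shows "set_integrable M A \<phi>" "norm (LINT t:A|M. \<phi> t) \<le> L * measure M A"
proof -
  interpret finite_measure M by fact
  have "integrable M \<phi>"
    using assms by (intro integrable_const_bound[where B=L]) auto
  then show 1: "set_integrable M A \<phi>"
    using assms(4) by (simp add: set_integrable_def integrable_mult_indicator)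
  have "norm (LINT t:A|M. \<phi> t) \<le> (\<integral>t. norm (indicator A t *\<^sub>R \<phi> t) \<partial>M)"
    unfolding set_lebesgue_integral_def by (rule integral_norm_bound)
  also have "\<dots> \<le> (\<integral>t. L * indicator A t \<partial>M)"
  proof (rule integral_mono)
    show "integrable M (\<lambda>t. norm (indicator A t *\<^sub>R \<phi> t))"
      using 1 unfolding set_integrable_def by (rule integrable_norm)
    show "integrable M (\<lambda>t. L * indicator A t)"
      using assms(4) by (intro integrable_mult_right) (simp add: less_top[symmetric])
  qed (use assms(3) in \<open>auto simp: indicator_def\<close>)
  also have "\<dots> = L * measure M A"
    using assms(4) by simp
  finally show "norm (LINT t:A|M. \<phi> t) \<le> L * measure M A" .
qed

text \<open>The integral telescopes to the difference of the averages of \<gamma> over two intervals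
  of length \<open>h\<close>, one beginning at \<open>d\<close> and one at \<open>c\<close>; each
  average is within \<open>L * h\<close> of the value at the endpoint.\<close>

lemma integral_difference_quotient_bound:
  fixes \<gamma> :: "real \<Rightarrow> 'y::{banach, second_countable_topology}"
  assumes lip: "L-lipschitz_on UNIV \<gamma>" and "c \<le> d" "0 < h"
  shows "norm ((LINT t:{c..d}|lborel. (1 / h) *\<^sub>R (\<gamma> (t + h) - \<gamma> t)) - (\<gamma> d - \<gamma> c)) \<le> 2 * L * h"
proof -
  have cont: "continuous_on S \<gamma>" for S
    using lipschitz_on_continuous_on[OF lip] continuous_on_subset by blast
  have [measurable]: "\<gamma> \<in> borel_measurable borel"
    by (intro borel_measurable_continuous_onI cont)
  have int: "set_integrable lborel {u..v} \<gamma>" for u v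
    unfolding set_integrable_def by (intro borel_integrable_compact cont) simp
  have int': "set_integrable lborel A \<gamma>" if "A \<subseteq> {u..v}" "A \<in> sets borel" for A u v
    using set_integrable_subset[OF int[of u v]] that by simp
  have avg: "norm ((1 / h) *\<^sub>R (LINT t:A|lborel. \<gamma> t) - \<gamma> s) \<le> L * h"
    if A: "A \<in> sets borel" "A \<subseteq> {s..s+h}" "measure lborel A = h" for A s
  proof -
    have fin: "emeasure lborel A < \<infinity>"
      using emeasure_mono[of A "{s..s+h}" lborel] A \<open>h > 0\<close> by (auto intro: le_less_trans)
    have "(LINT t:A|lborel. (\<gamma> t - \<gamma> s)) = (LINT t:A|lborel. \<gamma> t) - (LINT t:A|lborel. \<gamma> s)"
      using A fin by (intro set_integral_diff int'[of _ s "s+h"]) (auto simp: set_integrable_def)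
    also have "(LINT t:A|lborel. \<gamma> s) = h *\<^sub>R \<gamma> s"
      using A fin by (simp add: set_lebesgue_integral_def)
    finally have eq: "(1 / h) *\<^sub>R (LINT t:A|lborel. \<gamma> t) - \<gamma> s = (1 / h) *\<^sub>R (LINT t:A|lborel. (\<gamma> t - \<gamma> s))"
      using \<open>h > 0\<close> by (simp add: scaleR_diff_right)
    have "norm (LINT t:A|lborel. (\<gamma> t - \<gamma> s)) \<le> (\<integral>t. norm (indicator A t *\<^sub>R (\<gamma> t - \<gamma> s)) \<partial>lborel)"
      unfolding set_lebesgue_integral_def by (rule integral_norm_bound)
    also have "\<dots> \<le> (\<integral>t. (L * h) * indicator A t \<partial>lborel)"
    proof (rule integral_mono)
      show "integrable lborel (\<lambda>t. norm (indicator A t *\<^sub>R (\<gamma> t - \<gamma> s)))"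
      proof (rule integrable_norm)
        have "set_integrable lborel A (\<lambda>t. \<gamma> t - \<gamma> s)"
          using A fin by (intro set_integral_diff int'[of _ s "s+h"]) (auto simp: set_integrable_def)
        then show "integrable lborel (\<lambda>t. indicator A t *\<^sub>R (\<gamma> t - \<gamma> s))" by (simp add: set_integrable_def)
      qed
      show "integrable lborel (\<lambda>t. (L * h) * indicator A t)"
        using A fin by (intro integrable_mult_right) (simp add: less_top[symmetric])
      fix t
      have "norm (\<gamma> t - \<gamma> s) \<le> L * h" if "t \<in> A"
      proof -
        have "norm (\<gamma> t - \<gamma> s) \<le> L * \<bar>t - s\<bar>"
          using lipschitz_onD[OF lip, of t s] by (simp add: dist_norm)
        also have "\<dots> \<le> L * h"
          using that A(2) lipschitz_on_nonneg[OF lip] by (intro mult_left_mono) auto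
        finally show ?thesis .
      qed
      then show "norm (indicator A t *\<^sub>R (\<gamma> t - \<gamma> s)) \<le> (L * h) * indicator A t"
        by (auto simp: indicator_def)
    qed
    also have "\<dots> = (L * h) * h"
      using A fin by simp
    finally show ?thesis
      unfolding eq using \<open>h > 0\<close> by (simp add: field_simps)
  qed
  have "(LINT t:{c..d}|lborel. \<gamma> (t + h)) = (LINT t:{c+h..d+h}|lborel. \<gamma> t)"
    unfolding set_lebesgue_integral_def
    by (subst (2) lborel_integral_real_affine[of 1 _ h])
       (auto simp: indicator_def add.commute intro!: Bochner_Integration.integral_cong)
  moreover have "set_integrable lborel {c..d} (\<lambda>t. \<gamma> (t + h))"
    unfolding set_integrable_def
    by (intro borel_integrable_compact continuous_on_compose2[OF cont[of UNIV]] continuous_intros) auto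
  ultimately have "(LINT t:{c..d}|lborel. (1 / h) *\<^sub>R (\<gamma> (t + h) - \<gamma> t))
      = (1 / h) *\<^sub>R ((LINT t:{c+h..d+h}|lborel. \<gamma> t) - (LINT t:{c..d}|lborel. \<gamma> t))"
    by (simp add: set_integral_diff int)
  \<comment> \<open>With half-open intervals the differences of indicators agree at every point,
    also when \<open>h\<close> exceeds \<open>d - c\<close> and the two intervals overlap.\<close>
  also have "(LINT t:{c+h..d+h}|lborel. \<gamma> t) - (LINT t:{c..d}|lborel. \<gamma> t)
      = (LINT t:{d<..d+h}|lborel. \<gamma> t) - (LINT t:{c..<c+h}|lborel. \<gamma> t)"
  proof -
    have "(LINT t:{c+h..d+h}|lborel. \<gamma> t) - (LINT t:{c..d}|lborel. \<gamma> t)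
       = (\<integral>t. indicator {c+h..d+h} t *\<^sub>R \<gamma> t - indicator {c..d} t *\<^sub>R \<gamma> t \<partial>lborel)"
      using int[of "c+h" "d+h"] int[of c d]
      by (simp add: set_lebesgue_integral_def set_integrable_def)
    also have "\<dots> = (\<integral>t. indicator {d<..d+h} t *\<^sub>R \<gamma> t - indicator {c..<c+h} t *\<^sub>R \<gamma> t \<partial>lborel)"
      using \<open>c \<le> d\<close> \<open>h > 0\<close>
      by (intro Bochner_Integration.integral_cong) (auto simp: indicator_def)
    also have "\<dots> = (LINT t:{d<..d+h}|lborel. \<gamma> t) - (LINT t:{c..<c+h}|lborel. \<gamma> t)"
      using int'[of "{d<..d+h}" d "d+h"] int'[of "{c..<c+h}" c "c+h"]
      by (simp add: set_lebesgue_integral_def set_integrable_def subset_iff)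
    finally show ?thesis .
  qed
  finally have "(LINT t:{c..d}|lborel. (1 / h) *\<^sub>R (\<gamma> (t + h) - \<gamma> t)) - (\<gamma> d - \<gamma> c)
     = ((1 / h) *\<^sub>R (LINT t:{d<..d+h}|lborel. \<gamma> t) - \<gamma> d) - ((1 / h) *\<^sub>R (LINT t:{c..<c+h}|lborel. \<gamma> t) - \<gamma> c)"
    by (simp add: scaleR_diff_right algebra_simps)
  also have "norm \<dots> \<le> L * h + L * h"
    using \<open>h > 0\<close> by (intro order_trans[OF norm_triangle_ineq4] add_mono avg) auto
  finally show ?thesis by simp
qed

lemma set_integral_density_indicator:
  fixes \<phi> :: "real \<Rightarrow> 'y::{banach, second_countable_topology}"
  assumes [measurable]: "\<phi> \<in> borel_measurable borel" "A \<in> sets borel" "I \<in> sets borel"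
  shows "(LINT t:A|density lborel (indicator I). \<phi> t) = (LINT t:A \<inter> I|lborel. \<phi> t)"
proof -
  have "(LINT t:A|density lborel (\<lambda>x. ennreal (indicator I x)). \<phi> t)
      = (\<integral>t. indicator I t *\<^sub>R (indicator A t *\<^sub>R \<phi> t) \<partial>lborel)"
    unfolding set_lebesgue_integral_def by (rule integral_density) auto
  also have "\<dots> = (LINT t:A \<inter> I|lborel. \<phi> t)"
    unfolding set_lebesgue_integral_def
    by (rule Bochner_Integration.integral_cong) (auto simp: indicator_def)
  finally show ?thesis by (simp add: ennreal_indicator)
qed

text \<open>The vector measure is the limit of the integrals of the difference quotients of
  \<gamma>. On intervals these tend to the increments. The bound \<open>L * measure M A\<close>,
  which is uniform in \<open>n\<close>, carries convergence through disjoint unions, hence to all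
  Borel sets by induction over their generation from closed intervals; it also yields countable
  additivity, finite variation and absolute continuity of the limit.\<close>

lemma lipschitz_curve_density:
  fixes \<gamma> :: "real \<Rightarrow> 'y::{banach, second_countable_topology}"
  assumes rnp: "radon_nikodym_property TYPE('y)" and lip: "L-lipschitz_on UNIV \<gamma>" and "a < b"
  obtains g where "g \<in> borel_measurable borel" "set_integrable lborel {a..b} g"
    "\<And>A. A \<in> sets borel \<Longrightarrow> A \<subseteq> {a..b} \<Longrightarrow> norm (LINT t:A|lborel. g t) \<le> L * measure lborel A"
    "\<And>c d. a \<le> c \<Longrightarrow> c \<le> d \<Longrightarrow> d \<le> b \<Longrightarrow> (LINT t:{c..d}|lborel. g t) = \<gamma> d - \<gamma> c"
proof -
  \<comment> \<open>Lebesgue measure on \<open>{a..b}\<close> is kept as a measure on the whole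
    line, so that its measurable sets are exactly the Borel sets, over which the induction
    runs.\<close>
  define M where "M = density lborel (indicator {a..b} :: real \<Rightarrow> ennreal)"
  have sets_M [measurable_cong]: "sets M = sets borel" by (simp add: M_def)
  have space_M: "space M = UNIV" by (simp add: M_def)
  have emeasure_M: "emeasure M A = emeasure lborel (A \<inter> {a..b})" if "A \<in> sets borel" for A
    using that by (simp add: M_def emeasure_density indicator_inter_arith[symmetric] nn_integral_indicator mult.commute)
  have measure_M: "measure M A = measure lborel (A \<inter> {a..b})" if "A \<in> sets borel" for A
    using emeasure_M[OF that] by (simp add: measure_def)
  interpret M: finite_measure M
    by (intro finite_measureI) (use \<open>a < b\<close> in \<open>simp add: space_M emeasure_M\<close>)
  have L0: "L \<ge> 0" using lipschitz_on_nonneg[OF lip] .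
  have cont: "continuous_on S \<gamma>" for S
    using lipschitz_on_continuous_on[OF lip] continuous_on_subset by blast
  \<comment> \<open>The double reciprocal keeps the form \<open>1 / h\<close> of
    \<open>integral_difference_quotient_bound\<close> with
    \<open>h = 1 / real (Suc n)\<close>.\<close>
  define \<phi> where "\<phi> n t = (1 / (1 / real (Suc n))) *\<^sub>R (\<gamma> (t + 1 / real (Suc n)) - \<gamma> t)" for n t
  have \<phi>_meas [measurable]: "\<phi> n \<in> borel_measurable borel" for n
    unfolding \<phi>_def
    by (intro borel_measurable_continuous_onI continuous_intros continuous_on_compose2[OF cont[of UNIV]]) auto
  have \<phi>_bound: "norm (\<phi> n t) \<le> L" for n t
  proof -
    have "norm (\<phi> n t) = real (Suc n) * norm (\<gamma> (t + 1 / real (Suc n)) - \<gamma> t)"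
      by (simp add: \<phi>_def)
    also have "\<dots> \<le> real (Suc n) * (L * (1 / real (Suc n)))"
      using lipschitz_onD[OF lip, of "t + 1 / real (Suc n)" t]
      by (intro mult_left_mono) (auto simp: dist_norm)
    finally show ?thesis by simp
  qed
  define \<nu>' where "\<nu>' n A = (LINT t:A|M. \<phi> n t)" for n A
  have \<nu>'_le: "norm (\<nu>' n A) \<le> L * measure M A" if "A \<in> sets borel" for n A
    unfolding \<nu>'_def using that
    by (intro norm_set_integral_le M.finite_measure_axioms \<phi>_bound) (auto simp: sets_M)
  have int: "set_integrable M A (\<phi> n)" if "A \<in> sets borel" for n A
    using that by (intro norm_set_integral_le[where L=L] M.finite_measure_axioms \<phi>_bound) (auto simp: sets_M)
  have \<nu>'_eq: "\<nu>' n A = (LINT t:A \<inter> {a..b}|lborel. \<phi> n t)" if "A \<in> sets borel" for n A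
    unfolding \<nu>'_def M_def using that by (intro set_integral_density_indicator) auto
  have \<nu>'_interval: "(\<lambda>n. \<nu>' n A) \<longlonglongrightarrow> \<gamma> d - \<gamma> c" if "A \<in> sets borel" "A \<inter> {a..b} = {c..d}" "c \<le> d" for A c d
  proof (rule LIM_zero_cancel, rule Lim_null_comparison)
    show "\<forall>\<^sub>F n in sequentially. norm (\<nu>' n A - (\<gamma> d - \<gamma> c)) \<le> 2 * L * (1 / real (Suc n))"
      unfolding \<nu>'_eq[OF that(1)] that(2) \<phi>_def
      by (intro always_eventually allI integral_difference_quotient_bound lip that(3)) simp
    show "(\<lambda>n. 2 * L * (1 / real (Suc n))) \<longlonglongrightarrow> 0"
      by (intro tendsto_mult_right_zero lim_1_over_n[THEN LIMSEQ_Suc])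
  qed
  have \<nu>'_UN: "\<nu>' n (\<Union>i. A i) = (\<Sum>i. \<nu>' n (A i))" if "disjoint_family A" "\<And>i. A i \<in> sets borel" for A n
    unfolding \<nu>'_def
    by (rule lebesgue_integral_countable_add)
       (use that int in \<open>auto simp: sets_M disjoint_family_on_def\<close>)
  have summable: "summable (\<lambda>i. L * measure M (A i))" if "disjoint_family A" "\<And>i. A i \<in> sets borel" for A
    using M.finite_measure_UNION[of A] that by (auto simp: sets_M sums_iff intro!: summable_mult)
  have conv: "convergent (\<lambda>n. \<nu>' n A)" if "A \<in> sets borel" for A
    using that
  proof (induction rule: borel_set_induct)
    case empty
    then show ?case by (simp add: \<nu>'_def set_lebesgue_integral_def convergent_const)
  next
    case (interval c d)
    show ?case
    proof (cases "max c a \<le> min d b")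
      case True
      then show ?thesis using \<nu>'_interval[of "{c..d}" "max c a" "min d b"] by (auto simp: convergent_def)
    next
      case False
      then have "{c..d} \<inter> {a..b} = {}" by auto
      then show ?thesis by (simp add: \<nu>'_eq set_lebesgue_integral_def convergent_const)
    qed
  next
    case (compl A)
    have "\<nu>' n (- A) = \<nu>' n UNIV - \<nu>' n A" for n
    proof -
      have "\<nu>' n (A \<union> - A) = \<nu>' n A + \<nu>' n (- A)"
        unfolding \<nu>'_def using compl by (intro set_integral_Un int) auto
      then show ?thesis by simp
    qed
    moreover have "convergent (\<lambda>n. \<nu>' n UNIV)"
      using \<nu>'_interval[of UNIV a b] \<open>a < b\<close> by (auto simp: convergent_def)
    ultimately show ?case using compl by (auto intro: convergent_diff)
  next
    case (union A)
    have "(\<lambda>n. \<nu>' n (A k)) \<longlonglongrightarrow> lim (\<lambda>n. \<nu>' n (A k))" for k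
      using union by (simp add: convergent_LIMSEQ_iff)
    from tendsto_suminf_dominated(2)[of "\<lambda>n k. \<nu>' n (A k)", OF this \<nu>'_le summable]
    show ?case using union by (auto simp: \<nu>'_UN convergent_def)
  qed
  define \<nu> where "\<nu> A = lim (\<lambda>n. \<nu>' n A)" for A
  have lim: "(\<lambda>n. \<nu>' n A) \<longlonglongrightarrow> \<nu> A" if "A \<in> sets borel" for A
    using conv[OF that] by (simp add: convergent_LIMSEQ_iff \<nu>_def)
  have \<nu>_le: "norm (\<nu> A) \<le> L * measure M A" if "A \<in> sets borel" for A
    using \<nu>'_le[OF that] by (intro LIMSEQ_le_const2[OF tendsto_norm[OF lim[OF that]]]) auto
  have "vector_measure M \<nu>"
    unfolding vector_measure_def
  proof (intro allI impI)
    fix A :: "nat \<Rightarrow> real set"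
    assume "range A \<subseteq> sets M \<and> disjoint_family A"
    then have A: "disjoint_family A" "\<And>i. A i \<in> sets borel" by (auto simp: sets_M)
    note dom = tendsto_suminf_dominated[of "\<lambda>n k. \<nu>' n (A k)", OF lim[OF A(2)] \<nu>'_le[OF A(2)] summable[OF A]]
    have "(\<lambda>n. \<nu>' n (\<Union>i. A i)) \<longlonglongrightarrow> \<nu> (\<Union>i. A i)" using A by (intro lim) auto
    with dom(2) have "\<nu> (\<Union>i. A i) = (\<Sum>i. \<nu> (A i))"
      by (simp add: \<nu>'_UN[OF A] LIMSEQ_unique)
    with dom(1) show "(\<lambda>i. \<nu> (A i)) sums \<nu> (\<Union>i. A i)" by simp
  qed
  moreover have "finite_variation M \<nu>"
    unfolding finite_variation_def
  proof (intro exI allI impI)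
    fix P assume P: "finite P \<and> P \<subseteq> sets M \<and> disjoint P"
    then have "(\<Sum>A\<in>P. norm (\<nu> A)) \<le> (\<Sum>A\<in>P. L * measure M A)"
      by (intro sum_mono \<nu>_le) (auto simp: sets_M)
    also have "\<dots> = L * measure M (\<Union>P)"
      using P by (subst measure_Union') (auto simp: sum_distrib_left disjoint_def pairwise_def disjnt_def M.fmeasurable_eq_sets)
    also have "\<dots> \<le> L * measure M (space M)"
      using L0 by (intro mult_left_mono M.bounded_measure)
    finally show "(\<Sum>A\<in>P. norm (\<nu> A)) \<le> L * measure M (space M)" .
  qed
  moreover have "\<nu> A = 0" if "A \<in> null_sets M" for A
    using \<nu>_le[of A] that by (auto simp: null_sets_def sets_M measure_def)
  ultimately have "finite_measure M \<and> vector_measure M \<nu> \<and> finite_variation M \<nu> \<and> (\<forall>A\<in>null_sets M. \<nu> A = 0)"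
    using M.finite_measure_axioms by (intro conjI ballI)
  then have "\<exists>g. integrable M g \<and> (\<forall>A\<in>sets M. \<nu> A = (LINT x:A|M. g x))"
    by (rule rnp[unfolded radon_nikodym_property_def, rule_format])
  then obtain g where g: "integrable M g" "\<And>A. A \<in> sets M \<Longrightarrow> \<nu> A = (LINT x:A|M. g x)"
    by blast
  have g_meas [measurable]: "g \<in> borel_measurable borel"
    using borel_measurable_integrable[OF g(1)] by (simp add: M_def)
  have \<nu>_g: "\<nu> A = (LINT t:A \<inter> {a..b}|lborel. g t)" if "A \<in> sets borel" for A
    using g(2)[of A] that set_integral_density_indicator[of g A "{a..b}"] by (simp add: sets_M M_def)
  show ?thesis
  proof (rule that[of g])
    show "g \<in> borel_measurable borel" by (rule g_meas)
    have "integrable (density lborel (\<lambda>x. ennreal (indicator {a..b} x))) g"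
      using g(1) by (simp add: M_def ennreal_indicator)
    then show "set_integrable lborel {a..b} g"
      unfolding set_integrable_def by (subst (asm) integrable_density) auto
    show "norm (LINT t:A|lborel. g t) \<le> L * measure lborel A" if "A \<in> sets borel" "A \<subseteq> {a..b}" for A
      using \<nu>_le[of A] \<nu>_g[of A] measure_M[of A] that by (simp add: Int_absorb2)
    show "(LINT t:{c..d}|lborel. g t) = \<gamma> d - \<gamma> c" if "a \<le> c" "c \<le> d" "d \<le> b" for c d
    proof -
      have "{c..d} \<inter> {a..b} = {c..d}" using that by auto
      with \<nu>'_interval[of "{c..d}" c d] lim[of "{c..d}"] \<nu>_g[of "{c..d}"] that
      show ?thesis by (simp add: LIMSEQ_unique)
    qed
  qed
qed

section \<open>Differentiability of curves almost everywhere\<close>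

text \<open>All that the later sections take from the Radon-Nikodym property. It is isolated because
  it is needed for \<open>real\<close> as well, where it is transferred from
  \<open>Y\<close>.\<close>

definition curves_ae_differentiable :: "'y::real_normed_vector itself \<Rightarrow> bool" where
  "curves_ae_differentiable _ \<longleftrightarrow> (\<forall>(\<gamma>::real \<Rightarrow> 'y) L. L-lipschitz_on UNIV \<gamma> \<longrightarrow>
     (AE t in lborel. \<exists>D. (\<gamma> has_vector_derivative D) (at t)))"

lemma has_vector_derivative_at_alt:
  "(f has_vector_derivative D) (at t) \<longleftrightarrow>
    (\<forall>\<epsilon>>0. \<exists>\<delta>>0. \<forall>s. \<bar>s - t\<bar> < \<delta> \<longrightarrow> norm (f s - f t - (s - t) *\<^sub>R D) \<le> \<epsilon> * \<bar>s - t\<bar>)"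
  by (simp add: has_vector_derivative_def has_derivative_at_alt bounded_linear_scaleR_left)

lemma tendsto_difference_quotient:
  assumes "(f has_vector_derivative D) (at t)"
  shows "((\<lambda>s. (1 / (s - t)) *\<^sub>R (f s - f t)) \<longlongrightarrow> D) (at t)"
proof (rule LIM_zero_cancel, rule tendsto_norm_zero_cancel, rule Lim_transform_eventually)
  show "((\<lambda>s. norm (f s - f t - (s - t) *\<^sub>R D) / norm (s - t)) \<longlongrightarrow> 0) (at t)"
    using assms by (simp add: has_vector_derivative_def has_derivative_iff_norm)
  have "norm (f s - f t - (s - t) *\<^sub>R D) / norm (s - t) = norm ((1 / (s - t)) *\<^sub>R (f s - f t) - D)"
    if "s \<noteq> t" for s
  proof -
    have "(1 / (s - t)) *\<^sub>R (f s - f t) - D = (1 / (s - t)) *\<^sub>R (f s - f t - (s - t) *\<^sub>R D)"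
      using that by (simp add: scaleR_diff_right)
    then show ?thesis by simp
  qed
  then show "\<forall>\<^sub>F s in at t. norm (f s - f t - (s - t) *\<^sub>R D) / norm (s - t)
      = norm ((1 / (s - t)) *\<^sub>R (f s - f t) - D)"
    by (simp add: eventually_at_filter)
qed

text \<open>The derivative at \<open>t\<close> is \<open>g t\<close> whenever \<open>t\<close> is a
  density point of every \<open>E y m\<close> that contains it, with \<open>y\<close> from a
  countable dense set. On a short interval at \<open>t\<close>, the part inside \<open>E y m\<close>
  sees only values of \<open>g\<close> near \<open>y\<close>. The part outside is small, and by
  \<open>g_le\<close> the integral over it is at most \<open>L\<close> times its measure, although
  no pointwise bound on \<open>g\<close> is at hand.\<close>

lemma AE_lipschitz_curve_differentiable:
  fixes \<gamma> :: "real \<Rightarrow> 'y::{banach, second_countable_topology}"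
  assumes rnp: "radon_nikodym_property TYPE('y)" and lip: "L-lipschitz_on UNIV \<gamma>" and "a < b"
  shows "AE t in lborel. t \<in> {a<..<b} \<longrightarrow> (\<exists>D. (\<gamma> has_vector_derivative D) (at t))"
proof -
  obtain g where g_meas [measurable]: "g \<in> borel_measurable borel" and g_int: "set_integrable lborel {a..b} g"
    and g_le: "\<And>A. A \<in> sets borel \<Longrightarrow> A \<subseteq> {a..b} \<Longrightarrow> norm (LINT t:A|lborel. g t) \<le> L * measure lborel A"
    and g_eq: "\<And>c d. a \<le> c \<Longrightarrow> c \<le> d \<Longrightarrow> d \<le> b \<Longrightarrow> (LINT t:{c..d}|lborel. g t) = \<gamma> d - \<gamma> c"
    using lipschitz_curve_density[OF rnp lip \<open>a < b\<close>] by metis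
  have L0: "L \<ge> 0" using lipschitz_on_nonneg[OF lip] .
  obtain D :: "'y set" where D: "countable D" "\<And>X. open X \<Longrightarrow> X \<noteq> {} \<Longrightarrow> \<exists>d\<in>D. d \<in> X"
    using countable_dense_setE by metis
  define E where "E y m = {t. norm (g t - y) < 1 / real (Suc m)}" for y m
  have E_meas [measurable]: "E y m \<in> sets borel" for y m
    unfolding E_def by measurable
  have "AE t in lborel. \<forall>y\<in>D. \<forall>m k. t \<in> E y m \<longrightarrow>
      (\<exists>\<delta>>0. \<forall>r. 0 < r \<and> r < \<delta> \<longrightarrow> measure lborel (cball t r - E y m) \<le> 1 / real (Suc k) * r)"
    using D(1) by (simp only: AE_ball_countable AE_all_countable) (intro ballI allI AE_density_points, auto)
  then show ?thesis
  proof (rule AE_mp, intro AE_I2 impI)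
    fix t assume t: "t \<in> {a<..<b}"
      and dens: "\<forall>y\<in>D. \<forall>m k. t \<in> E y m \<longrightarrow>
      (\<exists>\<delta>>0. \<forall>r. 0 < r \<and> r < \<delta> \<longrightarrow> measure lborel (cball t r - E y m) \<le> 1 / real (Suc k) * r)"
    \<comment> \<open>Since \<open>t\<close> is an endpoint, \<open>{u..v}\<close> lies in
      \<open>cball t (v - u)\<close>. The allowance \<epsilon> is divided into a quarter for
      replacing \<open>g\<close> by \<open>y\<close> on \<open>E y m\<close>, a quarter for
      replacing \<open>y\<close> by \<open>g t\<close>, and a half for the part outside
      \<open>E y m\<close>.\<close>
    have key: "\<exists>\<delta>>0. \<forall>u v. a \<le> u \<and> u < v \<and> v \<le> b \<and> (t = u \<or> t = v) \<and> v - u < \<delta> \<longrightarrow>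
        norm (\<gamma> v - \<gamma> u - (v - u) *\<^sub>R g t) \<le> \<epsilon> * (v - u)" if "\<epsilon> > 0" for \<epsilon>
    proof -
      obtain m where m: "1 / real (Suc m) < \<epsilon> / 4" using \<open>\<epsilon> > 0\<close> nat_approx_posE[of "\<epsilon> / 4"] by auto
      obtain y where y: "y \<in> D" "y \<in> ball (g t) (1 / real (Suc m))"
        using D(2)[of "ball (g t) (1 / real (Suc m))"] by (auto simp del: mem_ball)
      then have yt: "norm (g t - y) < 1 / real (Suc m)" by (simp add: dist_norm)
      then have "t \<in> E y m" by (simp add: E_def)
      \<comment> \<open>Per unit of length, the part outside \<open>E y m\<close> costs
        \<open>L\<close> for the integral of \<open>g\<close> and \<open>norm y\<close> for the
        missing multiple of \<open>y\<close>; the 1 makes \<open>C\<close> positive.\<close>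
      define C where "C = L + norm y + 1"
      have "C > 0" using L0 by (simp add: C_def add_nonneg_pos)
      then obtain k where k: "1 / real (Suc k) < \<epsilon> / (2 * C)"
        using \<open>\<epsilon> > 0\<close> nat_approx_posE[of "\<epsilon> / (2 * C)"] by auto
      have Ck: "C * (1 / real (Suc k)) \<le> \<epsilon> / 2"
        using mult_left_mono[OF less_imp_le[OF k], of C] \<open>C > 0\<close> by simp
      obtain \<delta> where \<delta>: "\<delta> > 0" "\<And>r. 0 < r \<Longrightarrow> r < \<delta> \<Longrightarrow> measure lborel (cball t r - E y m) \<le> 1 / real (Suc k) * r"
        using dens y(1) \<open>t \<in> E y m\<close> by metis
      have "norm (\<gamma> v - \<gamma> u - (v - u) *\<^sub>R g t) \<le> \<epsilon> * (v - u)"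
        if uv: "a \<le> u" "u < v" "v \<le> b" "t = u \<or> t = v" "v - u < \<delta>" for u v
      proof -
        let ?A = "{u..v} \<inter> E y m" and ?B = "{u..v} - E y m"
        have int: "set_integrable lborel S g" if "S \<subseteq> {u..v}" "S \<in> sets borel" for S
        proof (rule set_integrable_subset[OF g_int])
          show "S \<subseteq> {a..b}" using that uv by fastforce
        qed (use that in simp)
        have fin: "emeasure lborel S < \<infinity>" "measure lborel S \<le> v - u" if "S \<subseteq> {u..v}" "S \<in> sets borel" for S
        proof -
          have "emeasure lborel S \<le> ennreal (v - u)"
            using emeasure_mono[of S "{u..v}" lborel] that uv by simp
          then show "emeasure lborel S < \<infinity>" by (auto intro: le_less_trans)
          show "measure lborel S \<le> v - u"
            using measure_mono_fmeasurable[of S "{u..v}" lborel] that uv by (simp add: fmeasurable_def)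
        qed
        have mB: "measure lborel ?B \<le> 1 / real (Suc k) * (v - u)"
        proof -
          have "?B \<subseteq> cball t (v - u) - E y m" using uv by (auto simp: dist_real_def)
          then have "measure lborel ?B \<le> measure lborel (cball t (v - u) - E y m)"
          proof (rule measure_mono_fmeasurable)
            have "cball t (v - u) \<in> fmeasurable lborel"
              using uv by (auto simp: fmeasurable_def cball_eq_atLeastAtMost)
            then show "cball t (v - u) - E y m \<in> fmeasurable lborel"
              by (rule fmeasurableI2) auto
          qed simp
          also have "\<dots> \<le> 1 / real (Suc k) * (v - u)" using uv by (intro \<delta>) auto
          finally show ?thesis .
        qed
        have "\<gamma> v - \<gamma> u = (LINT t:?A \<union> ?B|lborel. g t)"
          using g_eq[of u v] uv by (simp add: Int_Diff_Un)
        also have "\<dots> = (LINT t:?A|lborel. g t) + (LINT t:?B|lborel. g t)"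
          by (intro set_integral_Un int) auto
        also have "(LINT t:?A|lborel. g t) = (LINT t:?A|lborel. (g t - y)) + measure lborel ?A *\<^sub>R y"
        proof -
          have "(LINT t:?A|lborel. (g t - y)) = (LINT t:?A|lborel. g t) - (LINT t:?A|lborel. y)"
            using fin[of ?A] by (intro set_integral_diff int) (auto simp: set_integrable_def)
          then show ?thesis using fin[of ?A] by (simp add: set_lebesgue_integral_def)
        qed
        finally have "\<gamma> v - \<gamma> u - (v - u) *\<^sub>R y
          = (LINT t:?A|lborel. (g t - y)) + (LINT t:?B|lborel. g t) - measure lborel ?B *\<^sub>R y"
        proof -
          assume "\<gamma> v - \<gamma> u = (LINT t:?A|lborel. (g t - y)) + measure lborel ?A *\<^sub>R y + (LINT t:?B|lborel. g t)"
          moreover have "measure lborel ?A + measure lborel ?B = v - u"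
            using measure_Un_AE[of ?A ?B lborel] fin[of ?A] fin[of ?B] uv
            by (simp add: fmeasurable_def Int_Diff_Un)
          then have "(v - u) *\<^sub>R y = measure lborel ?A *\<^sub>R y + measure lborel ?B *\<^sub>R y"
            by (metis scaleR_add_left)
          ultimately show ?thesis by simp
        qed
        also have "norm \<dots> \<le> norm (LINT t:?A|lborel. (g t - y)) + norm (LINT t:?B|lborel. g t) + norm (measure lborel ?B *\<^sub>R y)"
          by (intro order_trans[OF norm_triangle_ineq4] add_right_mono norm_triangle_ineq)
        also have "\<dots> \<le> (v - u) * (1 / real (Suc m)) + L * measure lborel ?B + norm y * measure lborel ?B"
        proof (intro add_mono)
          have "norm (LINT t:?A|lborel. (g t - y)) \<le> (\<integral>t. norm (indicator ?A t *\<^sub>R (g t - y)) \<partial>lborel)"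
            unfolding set_lebesgue_integral_def by (rule integral_norm_bound)
          also have "\<dots> \<le> (\<integral>t. (1 / real (Suc m)) * indicator ?A t \<partial>lborel)"
          proof (rule integral_mono)
            have "set_integrable lborel ?A (\<lambda>t. g t - y)"
              using fin[of ?A] by (intro set_integral_diff int) (auto simp: set_integrable_def)
            then show "integrable lborel (\<lambda>t. norm (indicator ?A t *\<^sub>R (g t - y)))"
              unfolding set_integrable_def by (rule integrable_norm)
            show "integrable lborel (\<lambda>t. (1 / real (Suc m)) * indicator ?A t)"
              using fin[of ?A] by (intro integrable_mult_right) (simp add: less_top[symmetric])
          qed (auto simp: indicator_def E_def)
          also have "\<dots> = (1 / real (Suc m)) * measure lborel ?A" using fin[of ?A] by simp
          also have "\<dots> \<le> (1 / real (Suc m)) * (v - u)" using fin[of ?A] by (intro mult_left_mono) auto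
          finally show "norm (LINT t:?A|lborel. (g t - y)) \<le> (v - u) * (1 / real (Suc m))" by (simp add: mult.commute)
          show "norm (LINT t:?B|lborel. g t) \<le> L * measure lborel ?B"
            using uv by (intro g_le) auto
        qed (simp add: mult.commute)
        also have "\<dots> \<le> (v - u) * (\<epsilon> / 4) + C * measure lborel ?B"
        proof -
          have "(v - u) * (1 / real (Suc m)) \<le> (v - u) * (\<epsilon> / 4)"
            using m uv by (intro mult_left_mono) auto
          then show ?thesis by (simp add: C_def algebra_simps add_increasing)
        qed
        also have "\<dots> \<le> (v - u) * (\<epsilon> / 4) + (\<epsilon> / 2) * (v - u)"
        proof -
          have "C * measure lborel ?B \<le> C * (1 / real (Suc k) * (v - u))"
            using mB \<open>C > 0\<close> by (intro mult_left_mono) auto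
          also have "\<dots> = C * (1 / real (Suc k)) * (v - u)" by (simp only: mult.assoc)
          also have "\<dots> \<le> (\<epsilon> / 2) * (v - u)"
            using Ck uv by (intro mult_right_mono) auto
          finally show ?thesis by simp
        qed
        finally have 1: "norm (\<gamma> v - \<gamma> u - (v - u) *\<^sub>R y) \<le> (v - u) * (\<epsilon> / 4) + (\<epsilon> / 2) * (v - u)" .
        have 2: "norm ((v - u) *\<^sub>R (y - g t)) \<le> (v - u) * (\<epsilon> / 4)"
          using uv yt m by (simp add: norm_minus_commute)
        have "\<gamma> v - \<gamma> u - (v - u) *\<^sub>R g t = (\<gamma> v - \<gamma> u - (v - u) *\<^sub>R y) + (v - u) *\<^sub>R (y - g t)"
          by (simp add: algebra_simps)
        then have "norm (\<gamma> v - \<gamma> u - (v - u) *\<^sub>R g t) \<le> ((v - u) * (\<epsilon> / 4) + (\<epsilon> / 2) * (v - u)) + (v - u) * (\<epsilon> / 4)"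
          using norm_triangle_mono[OF 1 2] by (simp only:)
        also have "\<dots> = \<epsilon> * (v - u)" by (simp add: field_simps)
        finally show ?thesis .
      qed
      note main = this
      show ?thesis
        by (intro exI[of _ \<delta>] conjI \<delta>(1) allI impI, elim conjE) (rule main)
    qed
    have "(\<gamma> has_vector_derivative g t) (at t)"
      unfolding has_vector_derivative_at_alt
    proof (intro allI impI)
      fix \<epsilon> :: real assume "\<epsilon> > 0"
      from key[OF this] obtain \<delta> where \<delta>: "\<delta> > 0"
        "\<forall>u v. a \<le> u \<and> u < v \<and> v \<le> b \<and> (t = u \<or> t = v) \<and> v - u < \<delta> \<longrightarrow>
        norm (\<gamma> v - \<gamma> u - (v - u) *\<^sub>R g t) \<le> \<epsilon> * (v - u)" by blast
      define d where "d = min \<delta> (min (t - a) (b - t))"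
      have "norm (\<gamma> s - \<gamma> t - (s - t) *\<^sub>R g t) \<le> \<epsilon> * \<bar>s - t\<bar>" if s: "\<bar>s - t\<bar> < d" for s
      proof (cases s t rule: linorder_cases)
        case less
        then have "norm (\<gamma> t - \<gamma> s - (t - s) *\<^sub>R g t) \<le> \<epsilon> * (t - s)"
          using s t by (intro \<delta>(2)[rule_format]) (auto simp: d_def)
        moreover have "\<gamma> s - \<gamma> t - (s - t) *\<^sub>R g t = - (\<gamma> t - \<gamma> s - (t - s) *\<^sub>R g t)"
          by (simp add: algebra_simps)
        ultimately show ?thesis using less by (simp only: norm_minus_cancel) simp
      next
        case greater
        then show ?thesis using s t \<delta>(2)[rule_format, of t s] by (auto simp: d_def)
      qed auto
      moreover have "d > 0" using \<delta>(1) t by (simp add: d_def)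
      ultimately show "\<exists>d>0. \<forall>s. \<bar>s - t\<bar> < d \<longrightarrow> norm (\<gamma> s - \<gamma> t - (s - t) *\<^sub>R g t) \<le> \<epsilon> * \<bar>s - t\<bar>"
        by blast
    qed
    then show "\<exists>D. (\<gamma> has_vector_derivative D) (at t)" by blast
  qed
qed

lemma curves_ae_differentiable_rnp:
  assumes "radon_nikodym_property TYPE('y::{banach, second_countable_topology})"
  shows "curves_ae_differentiable TYPE('y)"
  unfolding curves_ae_differentiable_def
proof (intro allI impI)
  fix \<gamma> :: "real \<Rightarrow> 'y" and L assume lip: "L-lipschitz_on UNIV \<gamma>"
  have "AE t in lborel. \<forall>n::nat. t \<in> {- real (Suc n)<..<real (Suc n)} \<longrightarrow> (\<exists>D. (\<gamma> has_vector_derivative D) (at t))"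
    unfolding AE_all_countable by (intro allI AE_lipschitz_curve_differentiable[OF assms lip]) simp
  then show "AE t in lborel. \<exists>D. (\<gamma> has_vector_derivative D) (at t)"
  proof (rule AE_mp, intro AE_I2 impI)
    fix t :: real
    assume *: "\<forall>n::nat. t \<in> {- real (Suc n)<..<real (Suc n)} \<longrightarrow> (\<exists>D. (\<gamma> has_vector_derivative D) (at t))"
    obtain n :: nat where "\<bar>t\<bar> < real n" using reals_Archimedean2 by blast
    then have "t \<in> {- real (Suc n)<..<real (Suc n)}" by auto
    with * show "\<exists>D. (\<gamma> has_vector_derivative D) (at t)" by blast
  qed
qed

text \<open>The difference quotients of a nondecreasing function are read off, as norms, from its multiples
  of a fixed vector.\<close>

lemma curves_ae_differentiable_real:
  assumes "curves_ae_differentiable TYPE('y::real_normed_vector)" and "\<exists>y::'y. y \<noteq> 0"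
  shows "curves_ae_differentiable TYPE(real)"
  unfolding curves_ae_differentiable_def
proof (intro allI impI)
  fix \<gamma> :: "real \<Rightarrow> real" and L assume lip: "L-lipschitz_on UNIV \<gamma>"
  obtain y :: 'y where "y \<noteq> 0" using assms(2) by blast
  \<comment> \<open>The linear term makes \<open>h\<close> nondecreasing, so its difference
    quotients are nonnegative and can be recovered from norms; it is subtracted again at the
    end.\<close>
  define h where "h t = \<gamma> t + L * t" for t
  have L0: "L \<ge> 0" using lipschitz_on_nonneg[OF lip] .
  have lip': "\<bar>\<gamma> s - \<gamma> t\<bar> \<le> L * \<bar>s - t\<bar>" for s t
    using lipschitz_onD[OF lip, of s t] by (simp add: dist_norm)
  have q: "0 \<le> (h s - h t) / (s - t)" for s t
  proof (cases "s \<ge> t")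
    case True
    then show ?thesis using lip'[of s t] by (auto simp: h_def algebra_simps abs_le_iff intro!: divide_nonneg_nonneg)
  next
    case False
    then show ?thesis using lip'[of s t] by (auto simp: h_def algebra_simps abs_le_iff intro!: divide_nonpos_nonpos)
  qed
  have "((2 * L) * norm y)-lipschitz_on UNIV (\<lambda>t. h t *\<^sub>R y)"
  proof (rule lipschitz_onI)
    fix s t :: real
    have "\<bar>h s - h t\<bar> \<le> 2 * L * \<bar>s - t\<bar>"
    proof -
      have "h s - h t = (\<gamma> s - \<gamma> t) + L * (s - t)" by (simp add: h_def algebra_simps)
      then have "\<bar>h s - h t\<bar> \<le> \<bar>\<gamma> s - \<gamma> t\<bar> + \<bar>L * (s - t)\<bar>" by linarith
      then show ?thesis using lip'[of s t] L0 by (simp add: abs_mult)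
    qed
    from mult_right_mono[OF this, of "norm y"]
    show "dist (h s *\<^sub>R y) (h t *\<^sub>R y) \<le> 2 * L * norm y * dist s t"
      by (simp add: dist_norm scaleR_diff_left[symmetric] mult_ac)
  qed (use L0 in simp)
  then have "AE t in lborel. \<exists>D. ((\<lambda>t. h t *\<^sub>R y) has_vector_derivative D) (at t)"
    using assms(1) unfolding curves_ae_differentiable_def by blast
  then show "AE t in lborel. \<exists>D. (\<gamma> has_vector_derivative D) (at t)"
  proof (rule AE_mp, intro AE_I2 impI)
    fix t assume "\<exists>D. ((\<lambda>t. h t *\<^sub>R y) has_vector_derivative D) (at t)"
    then obtain D where D: "((\<lambda>t. h t *\<^sub>R y) has_vector_derivative D) (at t)" by blast
    have "((\<lambda>s. (1 / (s - t)) *\<^sub>R (h s *\<^sub>R y - h t *\<^sub>R y)) \<longlongrightarrow> D) (at t)"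
      by (rule tendsto_difference_quotient[OF D])
    then have "((\<lambda>s. norm ((1 / (s - t)) *\<^sub>R (h s *\<^sub>R y - h t *\<^sub>R y)) / norm y) \<longlongrightarrow> norm D / norm y) (at t)"
      using \<open>y \<noteq> 0\<close> by (intro tendsto_intros) auto
    moreover have "norm ((1 / (s - t)) *\<^sub>R (h s *\<^sub>R y - h t *\<^sub>R y)) / norm y = (h s - h t) / (s - t)" for s
      using q[of s t] \<open>y \<noteq> 0\<close> by (simp add: scaleR_diff_left[symmetric] abs_divide[symmetric] del: abs_divide)
    ultimately have "((\<lambda>s. (h s - h t) / (s - t)) \<longlongrightarrow> norm D / norm y) (at t)" by simp
    then have "(h has_real_derivative norm D / norm y) (at t)"
      by (simp add: has_field_derivative_iff)
    then have "((\<lambda>t. h t - L * t) has_real_derivative norm D / norm y - L) (at t)"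
      by (auto intro!: derivative_eq_intros)
    then show "\<exists>D. (\<gamma> has_vector_derivative D) (at t)"
      by (auto simp: h_def has_real_derivative_iff_has_vector_derivative)
  qed
qed

section \<open>Differentiability of Lipschitz maps almost everywhere\<close>

locale finite_dim_haar = finite_basis B for B :: "'x::banach set" +
  fixes \<mu> :: "'x measure"
  assumes haar: "haar_measure \<mu>"
begin

lemma sets_\<mu> [measurable_cong, simp]: "sets \<mu> = sets borel"
  using haar by (simp add: haar_measure_def)

lemma space_\<mu> [simp]: "space \<mu> = UNIV"
  using sets_eq_imp_space_eq[OF sets_\<mu>] by simp

lemma emeasure_translate: "A \<in> sets borel \<Longrightarrow> emeasure \<mu> ((+) a ` A) = emeasure \<mu> A"
  using haar by (simp add: haar_measure_def)

lemma emeasure_cball_finite: "emeasure \<mu> (cball a r) < \<infinity>"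
  using haar compact_cball[of a r] by (simp add: haar_measure_def)

sublocale sigma_finite_measure \<mu>
proof
  have "(\<Union>n::nat. cball 0 (real n)) = (UNIV :: 'x set)"
    using real_arch_simple by (auto simp: set_eq_iff)
  then show "\<exists>A. countable A \<and> A \<subseteq> sets \<mu> \<and> \<Union>A = space \<mu> \<and> (\<forall>a\<in>A. emeasure \<mu> a \<noteq> \<infinity>)"
    using emeasure_cball_finite by (intro exI[of _ "range (\<lambda>n::nat. cball 0 (real n))"]) (auto simp: less_top)
qed

text \<open>The library's measurability of addition does not apply, because the type of the domain is
  not known to be second countable.\<close>

lemma measurable_shift:
  "(\<lambda>p. fst p + snd p *\<^sub>R v) \<in> borel_measurable (\<mu> \<Otimes>\<^sub>M (lborel :: real measure))"
proof (rule borel_measurableI)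
  fix S :: "'x set" assume "open S"
  define W where "W = (\<lambda>p. fst p + snd p *\<^sub>R v) -` S"
  have "open W"
    unfolding W_def by (intro open_vimage \<open>open S\<close> continuous_intros)
  obtain D :: "'x set" where D: "countable D" "\<And>x \<epsilon>. \<epsilon> > 0 \<Longrightarrow> \<exists>d\<in>D. dist d x < \<epsilon>"
    using countable_dense by blast
  \<comment> \<open>The open set \<open>W\<close> is exhausted by countably many open rectangles
    with centres in a countable dense set; such rectangles belong to the product
    \<sigma>-algebra.\<close>
  define R where "R i = ball (fst i) (1 / real (Suc (snd (snd i)))) \<times> ball (of_rat (fst (snd i)) :: real) (1 / real (Suc (snd (snd i))))"
    for i :: "'x \<times> rat \<times> nat"
  define I where "I = {i \<in> D \<times> UNIV \<times> UNIV. R i \<subseteq> W}"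
  have "W = (\<Union>i\<in>I. R i)"
  proof
    show "W \<subseteq> (\<Union>i\<in>I. R i)"
    proof
      fix p assume "p \<in> W"
      then obtain e where e: "e > 0" "ball p e \<subseteq> W" using \<open>open W\<close> open_contains_ball by blast
      obtain k where k: "1 / real (Suc k) < e / 4" using e nat_approx_posE[of "e / 4"] by auto
      let ?h = "1 / real (Suc k)"
      obtain d where d: "d \<in> D" "dist d (fst p) < ?h" using D(2)[of ?h "fst p"] by auto
      obtain q where q: "snd p < of_rat q" "of_rat q < snd p + ?h"
        using of_rat_dense[of "snd p" "snd p + ?h"] by auto
      have "R (d, q, k) \<subseteq> ball p e"
      proof
        fix p' assume "p' \<in> R (d, q, k)"
        then have *: "dist d (fst p') < ?h" "dist (of_rat q) (snd p') < ?h" by (auto simp: R_def)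
        have "dist p p' \<le> dist (fst p) (fst p') + dist (snd p) (snd p')"
          unfolding dist_prod_def by (rule sqrt_sum_squares_le_sum) auto
        also have "dist (fst p) (fst p') \<le> dist d (fst p) + dist d (fst p')"
          by (rule dist_triangle3)
        also have "dist (snd p) (snd p') \<le> dist (of_rat q) (snd p) + dist (of_rat q) (snd p')"
          by (rule dist_triangle3)
        finally show "p' \<in> ball p e"
          using * d(2) q k by (simp add: dist_real_def)
      qed
      then have "(d, q, k) \<in> I" using e(2) d(1) by (auto simp: I_def)
      moreover have "p \<in> R (d, q, k)"
        using d(2) q by (auto simp: R_def dist_real_def mem_Times_iff)
      ultimately show "p \<in> (\<Union>i\<in>I. R i)" by blast
    qed
  qed (auto simp: I_def)
  moreover have "countable I"
    unfolding I_def using D(1) by (intro countable_Collect countable_SIGMA) auto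
  moreover have "R i \<in> sets (\<mu> \<Otimes>\<^sub>M lborel)" for i
    unfolding R_def by (intro pair_measureI) auto
  ultimately have "W \<in> sets (\<mu> \<Otimes>\<^sub>M lborel)" by auto
  then show "(\<lambda>p. fst p + snd p *\<^sub>R v) -` S \<inter> space (\<mu> \<Otimes>\<^sub>M lborel) \<in> sets (\<mu> \<Otimes>\<^sub>M lborel)"
    by (simp add: W_def space_pair_measure)
qed

text \<open>Averaging the measure of the translates of \<open>N\<close> along a segment and exchanging the integrals.\<close>

lemma null_set_of_lines:
  assumes N: "N \<in> sets borel" and lines: "\<And>x. emeasure lborel {t. x + t *\<^sub>R v \<in> N} = 0"
  shows "emeasure \<mu> N = 0"
proof -
  interpret pair_sigma_finite \<mu> "lborel :: real measure"
    by (intro pair_sigma_finite.intro sigma_finite_measure_axioms lborel.sigma_finite_measure_axioms)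
  \<comment> \<open>The segment of parameters has length 1, so integrating the constant measure of
    the translates over it returns \<open>emeasure \<mu> N\<close> itself.\<close>
  let ?f = "\<lambda>p. indicator N (fst p + snd p *\<^sub>R v) * indicator {0..1} (snd p) :: ennreal"
  have [measurable]: "N \<in> sets borel" by (rule N)
  note measurable_shift[of v, measurable]
  have meas: "?f \<in> borel_measurable (\<mu> \<Otimes>\<^sub>M lborel)" by measurable
  have "(\<integral>\<^sup>+ t. \<integral>\<^sup>+ x. ?f (x, t) \<partial>\<mu> \<partial>lborel) = (\<integral>\<^sup>+ t. emeasure \<mu> N * indicator {0..1} t \<partial>(lborel :: real measure))"
  proof (rule nn_integral_cong)
    fix t :: real
    have eq: "{x. x + t *\<^sub>R v \<in> N} = (+) (- (t *\<^sub>R v)) ` N"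
    proof (intro equalityI subsetI)
      fix x assume "x \<in> {x. x + t *\<^sub>R v \<in> N}"
      then show "x \<in> (+) (- (t *\<^sub>R v)) ` N"
        by (intro image_eqI[of _ _ "x + t *\<^sub>R v"]) auto
    qed auto
    have "{x. x + t *\<^sub>R v \<in> N} = (\<lambda>x. x + t *\<^sub>R v) -` N \<inter> space borel" by auto
    also have "\<dots> \<in> sets borel"
      by (rule measurable_sets[OF _ N], intro borel_measurable_continuous_onI continuous_intros)
    finally have 1: "{x. x + t *\<^sub>R v \<in> N} \<in> sets borel" .
    have "(\<integral>\<^sup>+ x. indicator N (x + t *\<^sub>R v) * indicator {0..1} t \<partial>\<mu>)
       = (\<integral>\<^sup>+ x. indicator {0..1} t * indicator {x. x + t *\<^sub>R v \<in> N} x \<partial>\<mu>)"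
      by (intro nn_integral_cong) (auto simp: indicator_def)
    also have "\<dots> = indicator {0..1} t * emeasure \<mu> {x. x + t *\<^sub>R v \<in> N}"
      using 1 by (intro nn_integral_cmult_indicator) simp
    also have "emeasure \<mu> {x. x + t *\<^sub>R v \<in> N} = emeasure \<mu> N"
      by (simp only: eq emeasure_translate[OF N])
    finally show "(\<integral>\<^sup>+ x. ?f (x, t) \<partial>\<mu>) = emeasure \<mu> N * indicator {0..1} t"
      by (simp add: mult.commute)
  qed
  also have "\<dots> = emeasure \<mu> N"
    by (simp add: nn_integral_cmult_indicator)
  finally have swap: "(\<integral>\<^sup>+ t. \<integral>\<^sup>+ x. ?f (x, t) \<partial>\<mu> \<partial>lborel) = emeasure \<mu> N" .
  have "emeasure \<mu> N = (\<integral>\<^sup>+ x. \<integral>\<^sup>+ t. ?f (x, t) \<partial>lborel \<partial>\<mu>)"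
    by (rule trans[OF swap[symmetric] Fubini[OF meas]])
  also have "\<dots> = (\<integral>\<^sup>+ x. 0 \<partial>\<mu>)"
  proof (rule nn_integral_cong)
    fix x
    have "{t. x + t *\<^sub>R v \<in> N} = (\<lambda>t. x + t *\<^sub>R v) -` N \<inter> space borel" by auto
    also have "\<dots> \<in> sets borel"
      by (rule measurable_sets[OF _ N], intro borel_measurable_continuous_onI continuous_intros)
    finally have 1: "{t. x + t *\<^sub>R v \<in> N} \<in> sets lborel" by simp
    have "(\<integral>\<^sup>+ t. ?f (x, t) \<partial>lborel) \<le> (\<integral>\<^sup>+ t. indicator {t. x + t *\<^sub>R v \<in> N} t \<partial>lborel)"
      by (intro nn_integral_mono) (auto simp: indicator_def)
    also have "\<dots> = 0" using 1 lines[of x] by (simp only: nn_integral_indicator)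
    finally show "(\<integral>\<^sup>+ t. ?f (x, t) \<partial>lborel) = 0" by simp
  qed
  finally show ?thesis by simp
qed

end

section \<open>Directional derivatives\<close>

text \<open>With rational increments the Cauchy condition has only countable quantifiers, so the set
  of points where it holds will be Borel. Completeness provides the limit \<open>D\<close>, and
  continuity extends the estimate from rational to real increments.\<close>

lemma Cauchy_difference_quotients_imp_derivative:
  fixes \<gamma> :: "real \<Rightarrow> 'z::banach"
  assumes cont: "continuous_on UNIV \<gamma>"
    and Cauchy: "\<forall>k::nat. \<exists>n::nat. \<forall>p q :: rat. 0 < \<bar>p\<bar> \<and> \<bar>p\<bar> < 1 / of_nat (Suc n) \<and> 0 < \<bar>q\<bar> \<and> \<bar>q\<bar> < 1 / of_nat (Suc n) \<longrightarrow>
       norm ((1 / of_rat p) *\<^sub>R (\<gamma> (of_rat p) - \<gamma> 0) - (1 / of_rat q) *\<^sub>R (\<gamma> (of_rat q) - \<gamma> 0)) \<le> 1 / real (Suc k)"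
  shows "\<exists>D. (\<gamma> has_vector_derivative D) (at 0)"
proof -
  define Q where "Q s = (1 / s) *\<^sub>R (\<gamma> s - \<gamma> 0)" for s
  \<comment> \<open>The second \<open>Suc\<close> makes \<open>r i\<close> strictly smaller than
    \<open>1 / of_nat (Suc n)\<close> for all \<open>i \<ge> n\<close>, including
    \<open>i = n\<close>.\<close>
  define r :: "nat \<Rightarrow> rat" where "r i = 1 / of_nat (Suc (Suc i))" for i
  have r: "0 < \<bar>r i\<bar>" "\<bar>r i\<bar> < 1 / of_nat (Suc n)" if "i \<ge> n" for i n
    using that by (auto simp: r_def field_simps)
  obtain N where N: "\<And>k p q. 0 < \<bar>p::rat\<bar> \<Longrightarrow> \<bar>p\<bar> < 1 / of_nat (Suc (N k)) \<Longrightarrow> 0 < \<bar>q\<bar> \<Longrightarrow> \<bar>q\<bar> < 1 / of_nat (Suc (N k)) \<Longrightarrow>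
     norm (Q (of_rat p) - Q (of_rat q)) \<le> 1 / real (Suc k)"
    using Cauchy unfolding Q_def by metis
  have "Cauchy (\<lambda>i. Q (of_rat (r i)))"
  proof (rule metric_CauchyI)
    fix e :: real assume "e > 0"
    then obtain k where k: "1 / real (Suc k) < e" using nat_approx_posE by blast
    show "\<exists>M. \<forall>m\<ge>M. \<forall>n\<ge>M. dist (Q (of_rat (r m))) (Q (of_rat (r n))) < e"
    proof (intro exI[of _ "N k"] allI impI)
      fix m n assume "N k \<le> m" "N k \<le> n"
      then have "norm (Q (of_rat (r m)) - Q (of_rat (r n))) \<le> 1 / real (Suc k)"
        by (intro N[of _ k] r) auto
      then show "dist (Q (of_rat (r m))) (Q (of_rat (r n))) < e" using k by (simp add: dist_norm)
    qed
  qed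
  then obtain D where D: "(\<lambda>i. Q (of_rat (r i))) \<longlonglongrightarrow> D"
    using Cauchy_convergent_iff convergent_def by blast
  have QD: "norm (Q (of_rat p) - D) \<le> 1 / real (Suc k)" if "0 < \<bar>p\<bar>" "\<bar>p\<bar> < 1 / of_nat (Suc (N k))" for p :: rat and k
  proof (rule LIMSEQ_le_const2)
    show "(\<lambda>i. norm (Q (of_rat p) - Q (of_rat (r i)))) \<longlonglongrightarrow> norm (Q (of_rat p) - D)"
      by (intro tendsto_intros D)
    show "\<exists>M. \<forall>i\<ge>M. norm (Q (of_rat p) - Q (of_rat (r i))) \<le> 1 / real (Suc k)"
      using N[OF that r] by blast
  qed
  have "(\<gamma> has_vector_derivative D) (at 0)"
    unfolding has_vector_derivative_at_alt
  proof (intro allI impI)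
    fix \<epsilon> :: real assume "\<epsilon> > 0"
    then obtain k where k: "1 / real (Suc k) < \<epsilon>" using nat_approx_posE by blast
    define \<delta> :: real where "\<delta> = 1 / real (Suc (N k))"
    define F where "F s = norm (\<gamma> s - \<gamma> 0 - s *\<^sub>R D) - \<epsilon> * \<bar>s\<bar>" for s
    have contF: "continuous_on UNIV F"
      unfolding F_def by (intro continuous_intros cont)
    have Frat: "F (of_rat p) \<le> 0" if "\<bar>of_rat p\<bar> < \<delta>" for p
    proof (cases "p = 0")
      case False
      have "real_of_rat \<bar>p\<bar> < real_of_rat (1 / of_nat (Suc (N k)))"
        using that by (simp add: \<delta>_def of_rat_divide of_rat_add)
      then have "\<bar>p\<bar> < 1 / of_nat (Suc (N k))" by (simp only: of_rat_less)
      with False have "norm (Q (of_rat p) - D) \<le> 1 / real (Suc k)" by (intro QD) auto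
      with k have *: "norm (Q (of_rat p) - D) \<le> \<epsilon>" by simp
      have "\<gamma> (of_rat p) - \<gamma> 0 - of_rat p *\<^sub>R D = of_rat p *\<^sub>R (Q (of_rat p) - D)"
        using False by (simp add: Q_def scaleR_diff_right)
      then have "norm (\<gamma> (of_rat p) - \<gamma> 0 - of_rat p *\<^sub>R D) = \<bar>of_rat p\<bar> * norm (Q (of_rat p) - D)"
        by simp
      also have "\<dots> \<le> \<bar>of_rat p\<bar> * \<epsilon>" by (intro mult_left_mono *) simp
      finally show ?thesis by (simp add: F_def mult.commute)
    qed (simp add: F_def)
    have "F s \<le> 0" if s: "\<bar>s\<bar> < \<delta>" for s
    proof (rule ccontr)
      assume "\<not> F s \<le> 0"
      \<comment> \<open>An open set on which \<open>F\<close> is positive would contain a rational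
        number, contradicting \<open>Frat\<close>.\<close>
      have "open (F -` {0<..} \<inter> {- \<delta><..<\<delta>})"
        using contF by (intro open_Int open_vimage) auto
      moreover have "s \<in> F -` {0<..} \<inter> {- \<delta><..<\<delta>}"
        using s \<open>\<not> F s \<le> 0\<close> by auto
      ultimately obtain e where e: "e > 0" "ball s e \<subseteq> F -` {0<..} \<inter> {- \<delta><..<\<delta>}"
        using open_contains_ball by blast
      obtain p where "s < of_rat p" "of_rat p < s + e"
        using of_rat_dense[of s "s + e"] e by auto
      then have "of_rat p \<in> ball s e" by (auto simp: dist_real_def)
      with e(2) have "F (of_rat p) > 0" "- \<delta> < of_rat p" "of_rat p < \<delta>" by auto
      moreover from this have "F (of_rat p) \<le> 0" by (intro Frat) linarith
      ultimately show False by simp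
    qed
    then show "\<exists>\<delta>>0. \<forall>s. \<bar>s - 0\<bar> < \<delta> \<longrightarrow> norm (\<gamma> s - \<gamma> 0 - (s - 0) *\<^sub>R D) \<le> \<epsilon> * \<bar>s - 0\<bar>"
      by (intro exI[of _ \<delta>]) (auto simp: F_def \<delta>_def)
  qed
  then show ?thesis by blast
qed

lemma derivative_imp_Cauchy_difference_quotients:
  fixes \<gamma> :: "real \<Rightarrow> 'z::real_normed_vector"
  assumes "(\<gamma> has_vector_derivative D) (at t)"
  shows "\<exists>n::nat. \<forall>p q :: rat. 0 < \<bar>p\<bar> \<and> \<bar>p\<bar> < 1 / of_nat (Suc n) \<and> 0 < \<bar>q\<bar> \<and> \<bar>q\<bar> < 1 / of_nat (Suc n) \<longrightarrow>
       norm ((1 / of_rat p) *\<^sub>R (\<gamma> (t + of_rat p) - \<gamma> t) - (1 / of_rat q) *\<^sub>R (\<gamma> (t + of_rat q) - \<gamma> t)) \<le> 1 / real (Suc k)"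
proof -
  have "0 < 1 / (2 * real (Suc k))" by simp
  with assms obtain \<delta> where \<delta>: "\<delta> > 0" "\<And>s. \<bar>s - t\<bar> < \<delta> \<Longrightarrow> norm (\<gamma> s - \<gamma> t - (s - t) *\<^sub>R D) \<le> 1 / (2 * real (Suc k)) * \<bar>s - t\<bar>"
    unfolding has_vector_derivative_at_alt by metis
  obtain n where n: "1 / real (Suc n) < \<delta>" using \<delta>(1) nat_approx_posE by blast
  have *: "norm ((1 / of_rat p) *\<^sub>R (\<gamma> (t + of_rat p) - \<gamma> t) - D) \<le> 1 / (2 * real (Suc k))"
    if p: "0 < \<bar>p\<bar>" "\<bar>p\<bar> < 1 / of_nat (Suc n)" for p :: rat
  proof -
    have "real_of_rat \<bar>p\<bar> < real_of_rat (1 / of_nat (Suc n))"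
      using p(2) by (simp only: of_rat_less)
    also have "\<dots> = 1 / real (Suc n)" by (simp only: of_rat_divide of_rat_1 of_rat_of_nat_eq)
    finally have "\<bar>real_of_rat p\<bar> < \<delta>" using n by (simp add: abs_if of_rat_minus split: if_splits)
    then have "norm (\<gamma> (t + of_rat p) - \<gamma> t - of_rat p *\<^sub>R D) \<le> 1 / (2 * real (Suc k)) * \<bar>of_rat p\<bar>"
      using \<delta>(2)[of "t + of_rat p"] by simp
    moreover have "\<gamma> (t + of_rat p) - \<gamma> t - of_rat p *\<^sub>R D
        = of_rat p *\<^sub>R ((1 / of_rat p) *\<^sub>R (\<gamma> (t + of_rat p) - \<gamma> t) - D)"
      using p(1) by (simp add: scaleR_diff_right)
    ultimately have "\<bar>of_rat p\<bar> * norm ((1 / of_rat p) *\<^sub>R (\<gamma> (t + of_rat p) - \<gamma> t) - D) \<le> \<bar>of_rat p\<bar> * (1 / (2 * real (Suc k)))"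
      by (simp only: norm_scaleR mult.commute)
    moreover have "\<bar>real_of_rat p\<bar> > 0" using p(1) by simp
    ultimately show ?thesis by (simp only: mult_le_cancel_left_pos)
  qed
  show ?thesis
  proof (intro exI[of _ n] allI impI, elim conjE)
    fix p q :: rat assume "0 < \<bar>p\<bar>" "\<bar>p\<bar> < 1 / of_nat (Suc n)" "0 < \<bar>q\<bar>" "\<bar>q\<bar> < 1 / of_nat (Suc n)"
    from norm_triangle_le_diff[of "(1 / of_rat p) *\<^sub>R (\<gamma> (t + of_rat p) - \<gamma> t) - D" "(1 / of_rat q) *\<^sub>R (\<gamma> (t + of_rat q) - \<gamma> t) - D" "1 / real (Suc k)"]
      *[of p] *[of q] this
    show "norm ((1 / of_rat p) *\<^sub>R (\<gamma> (t + of_rat p) - \<gamma> t) - (1 / of_rat q) *\<^sub>R (\<gamma> (t + of_rat q) - \<gamma> t)) \<le> 1 / real (Suc k)"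
      by (simp add: field_simps)
  qed
qed

context finite_dim_haar
begin

text \<open>The set where the rational difference quotients along \<open>v\<close> are not Cauchy is
  Borel. On every line parallel to \<open>v\<close> its parameters form a null set, because the
  restriction of \<open>g\<close> to the line is a Lipschitz curve. Hence it is null.\<close>

lemma AE_directional_derivative:
  fixes g :: "'x \<Rightarrow> 'z::banach"
  assumes curves: "curves_ae_differentiable TYPE('z)" and lip: "L-lipschitz_on UNIV g"
  shows "AE x in \<mu>. \<exists>D. ((\<lambda>t. g (x + t *\<^sub>R v)) has_vector_derivative D) (at 0)"
proof -
  define Q where "Q x p = (1 / of_rat p) *\<^sub>R (g (x + of_rat p *\<^sub>R v) - g x)" for x and p :: rat
  define good where "good x \<longleftrightarrow> (\<forall>k::nat. \<exists>n::nat. \<forall>p q :: rat. 0 < \<bar>p\<bar> \<and> \<bar>p\<bar> < 1 / of_nat (Suc n) \<and> 0 < \<bar>q\<bar> \<and> \<bar>q\<bar> < 1 / of_nat (Suc n) \<longrightarrow>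
       norm (Q x p - Q x q) \<le> 1 / real (Suc k))" for x
  have cont: "continuous_on S g" for S
    using lipschitz_on_continuous_on[OF lip] continuous_on_subset by blast
  have [measurable]: "(\<lambda>x. norm (Q x p - Q x q)) \<in> borel_measurable borel" for p q
    unfolding Q_def
    by (intro borel_measurable_continuous_onI continuous_intros continuous_on_compose2[OF cont[of UNIV]]) auto
  have meas: "{x. \<not> good x} \<in> sets borel"
    unfolding good_def by measurable
  have "emeasure lborel {t. x + t *\<^sub>R v \<in> {x. \<not> good x}} = 0" for x
  proof -
    define \<gamma> where "\<gamma> t = g (x + t *\<^sub>R v)" for t
    have "(L * norm v)-lipschitz_on UNIV \<gamma>"
    proof (rule lipschitz_onI)
      fix s t :: real
      have "dist (\<gamma> s) (\<gamma> t) \<le> L * dist (x + s *\<^sub>R v) (x + t *\<^sub>R v)"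
        unfolding \<gamma>_def by (rule lipschitz_onD[OF lip]) auto
      also have "dist (x + s *\<^sub>R v) (x + t *\<^sub>R v) = dist s t * norm v"
        by (simp add: dist_norm scaleR_diff_left[symmetric])
      finally show "dist (\<gamma> s) (\<gamma> t) \<le> L * norm v * dist s t" by (simp add: mult_ac)
    qed (use lipschitz_on_nonneg[OF lip] in simp)
    then have "AE t in lborel. \<exists>D. (\<gamma> has_vector_derivative D) (at t)"
      using curves unfolding curves_ae_differentiable_def by blast
    then have "AE t in lborel. \<not> (x + t *\<^sub>R v \<in> {x. \<not> good x})"
    proof (rule AE_mp, intro AE_I2 impI)
      fix t assume "\<exists>D. (\<gamma> has_vector_derivative D) (at t)"
      then obtain D where D: "(\<gamma> has_vector_derivative D) (at t)" by blast
      have "Q (x + t *\<^sub>R v) p = (1 / of_rat p) *\<^sub>R (\<gamma> (t + of_rat p) - \<gamma> t)" for p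
        by (simp add: Q_def \<gamma>_def algebra_simps)
      then show "\<not> (x + t *\<^sub>R v \<in> {x. \<not> good x})"
        unfolding mem_Collect_eq not_not good_def
        by (simp only:) (intro allI derivative_imp_Cauchy_difference_quotients[OF D])
    qed
    from emeasure_eq_0_AE[OF this] show ?thesis by simp
  qed
  from null_set_of_lines[OF meas this] meas
  have "{x. \<not> good x} \<in> null_sets \<mu>" by (simp add: null_sets_def)
  then have "AE x in \<mu>. good x" by (rule AE_I') auto
  then show ?thesis
  proof (rule AE_mp, intro AE_I2 impI)
    fix x assume "good x"
    show "\<exists>D. ((\<lambda>t. g (x + t *\<^sub>R v)) has_vector_derivative D) (at 0)"
    proof (rule Cauchy_difference_quotients_imp_derivative)
      show "continuous_on UNIV (\<lambda>t. g (x + t *\<^sub>R v))"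
        by (intro continuous_intros continuous_on_compose2[OF cont[of UNIV]]) auto
    qed (use \<open>good x\<close> in \<open>simp add: good_def Q_def\<close>)
  qed
qed

end

section \<open>From directional to total derivatives\<close>

lemma infdist_near_point:
  fixes x v :: "'x::real_normed_vector"
  assumes "x \<in> E" and D: "((\<lambda>t. infdist (x + t *\<^sub>R v) E) has_vector_derivative D) (at 0)" and "\<epsilon> > 0"
  shows "\<exists>\<delta>>0. \<forall>t. \<bar>t\<bar> < \<delta> \<longrightarrow> (\<exists>x'\<in>E. dist (x + t *\<^sub>R v) x' \<le> \<epsilon> * \<bar>t\<bar>)"
proof -
  have "D = 0"
  proof (rule DERIV_local_min[where d=1])
    show "((\<lambda>t. infdist (x + t *\<^sub>R v) E) has_real_derivative D) (at 0)"
      using D by (simp add: has_real_derivative_iff_has_vector_derivative)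
  qed (use \<open>x \<in> E\<close> in \<open>auto simp: infdist_nonneg\<close>)
  with D have "\<forall>\<epsilon>>0. \<exists>\<delta>>0. \<forall>t. \<bar>t\<bar> < \<delta> \<longrightarrow> infdist (x + t *\<^sub>R v) E \<le> \<epsilon> * \<bar>t\<bar>"
    using \<open>x \<in> E\<close> by (simp add: has_vector_derivative_at_alt infdist_nonneg)
  \<comment> \<open>The infimum defining the distance need not be attained; halving \<epsilon>
    leaves room for a strict inequality and so for an actual point of \<open>E\<close>.\<close>
  then obtain \<delta> where \<delta>: "\<delta> > 0" "\<And>t. \<bar>t\<bar> < \<delta> \<Longrightarrow> infdist (x + t *\<^sub>R v) E \<le> \<epsilon> / 2 * \<bar>t\<bar>"
    using \<open>\<epsilon> > 0\<close> by (metis half_gt_zero)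
  have "\<exists>x'\<in>E. dist (x + t *\<^sub>R v) x' \<le> \<epsilon> * \<bar>t\<bar>" if t: "\<bar>t\<bar> < \<delta>" for t
  proof (cases "t = 0")
    case True
    then show ?thesis using \<open>x \<in> E\<close> by (intro bexI[of _ x]) auto
  next
    case False
    have "(INF a\<in>E. dist (x + t *\<^sub>R v) a) \<le> \<epsilon> / 2 * \<bar>t\<bar>"
      using \<delta>(2)[OF t] \<open>x \<in> E\<close> by (simp add: infdist_notempty[symmetric] ex_in_conv[symmetric] exI)
    also have "\<dots> < \<epsilon> * \<bar>t\<bar>" using False \<open>\<epsilon> > 0\<close> by simp
    finally obtain x' where "x' \<in> E" "dist (x + t *\<^sub>R v) x' < \<epsilon> * \<bar>t\<bar>"
      using \<open>x \<in> E\<close> by (subst (asm) cINF_less_iff) auto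
    then show ?thesis by (intro bexI[of _ x']) auto
  qed
  with \<delta>(1) show ?thesis by blast
qed

text \<open>Differentiability at \<open>x\<close> along the span of \<open>F\<close>, expressed in the coefficients so that \<open>F\<close>
  need not be independent.\<close>

definition diff_along :: "'x::real_normed_vector set \<Rightarrow> ('x \<Rightarrow> 'z::real_normed_vector) \<Rightarrow> 'x \<Rightarrow> ('x \<Rightarrow> 'z) \<Rightarrow> bool" where
  "diff_along F g x y \<longleftrightarrow> (\<forall>\<epsilon>>0. \<exists>\<delta>>0. \<forall>c. (\<Sum>b\<in>F. \<bar>c b\<bar>) < \<delta> \<longrightarrow>
     norm (g (x + (\<Sum>b\<in>F. c b *\<^sub>R b)) - g x - (\<Sum>b\<in>F. c b *\<^sub>R y b)) \<le> \<epsilon> * (\<Sum>b\<in>F. \<bar>c b\<bar>))"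

text \<open>Accuracy, scale and approximate derivative are the same for all points of the set, so
  the expansion can be transferred from one point to another. With the values of \<Lambda> on the
  finite set \<open>F\<close> taken from a countable dense set, only countably many such sets
  occur.\<close>

definition uniform_diff_set :: "'x::real_normed_vector set \<Rightarrow> ('x \<Rightarrow> 'z::real_normed_vector) \<Rightarrow> nat \<Rightarrow> nat \<Rightarrow> ('x \<Rightarrow> 'z) \<Rightarrow> 'x set" where
  "uniform_diff_set F g m n \<Lambda> = {x. \<forall>c. (\<Sum>b\<in>F. \<bar>c b\<bar>) < 1 / real (Suc n) \<longrightarrow>
     norm (g (x + (\<Sum>b\<in>F. c b *\<^sub>R b)) - g x - (\<Sum>b\<in>F. c b *\<^sub>R \<Lambda> b)) \<le> 1 / real (Suc m) * (\<Sum>b\<in>F. \<bar>c b\<bar>)}"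

lemma norm_sum_scaleR_diff_le:
  assumes "\<And>b. b \<in> F \<Longrightarrow> norm (\<Lambda> b - y b) \<le> e"
  shows "norm ((\<Sum>b\<in>F. c b *\<^sub>R \<Lambda> b) - (\<Sum>b\<in>F. c b *\<^sub>R y b)) \<le> e * (\<Sum>b\<in>F. \<bar>c b\<bar>)"
proof -
  have "norm (\<Sum>b\<in>F. c b *\<^sub>R (\<Lambda> b - y b)) \<le> (\<Sum>b\<in>F. \<bar>c b\<bar> * norm (\<Lambda> b - y b))"
    by (rule order_trans[OF norm_sum]) simp
  also have "\<dots> \<le> (\<Sum>b\<in>F. \<bar>c b\<bar> * e)"
    by (intro sum_mono mult_left_mono assms) auto
  finally show ?thesis
    by (simp add: scaleR_diff_right sum_subtractf sum_distrib_left mult.commute)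
qed

lemma diff_along_imp_uniform_diff_set:
  assumes "finite F" and diff: "diff_along F g x y" and D: "\<And>X. open X \<Longrightarrow> X \<noteq> {} \<Longrightarrow> \<exists>d\<in>D. d \<in> X"
  obtains n \<Lambda> where "\<Lambda> \<in> PiE F (\<lambda>_. D)" "x \<in> uniform_diff_set F g m n \<Lambda>"
    "\<And>b. b \<in> F \<Longrightarrow> norm (\<Lambda> b - y b) \<le> 1 / real (Suc m)"
proof -
  \<comment> \<open>One \<open>e\<close> is spent on the expansion with the true derivatives
    \<open>y\<close>, the other on replacing \<open>y\<close> by \<Lambda>.\<close>
  define e where "e = 1 / (2 * real (Suc m))"
  have e: "e > 0" "e \<le> 1 / real (Suc m)" "e + e = 1 / real (Suc m)" by (auto simp: e_def field_simps)
  obtain \<delta> where \<delta>: "\<delta> > 0" "\<And>c. (\<Sum>b\<in>F. \<bar>c b\<bar>) < \<delta> \<Longrightarrow>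
     norm (g (x + (\<Sum>b\<in>F. c b *\<^sub>R b)) - g x - (\<Sum>b\<in>F. c b *\<^sub>R y b)) \<le> e * (\<Sum>b\<in>F. \<bar>c b\<bar>)"
    using diff e(1) unfolding diff_along_def by meson
  obtain n where n: "1 / real (Suc n) < \<delta>" using \<delta>(1) nat_approx_posE by blast
  have "\<exists>d\<in>D. norm (d - y b) \<le> e" for b
    using D[of "ball (y b) e"] e(1) by (auto simp: dist_norm norm_minus_commute intro: less_imp_le)
  then obtain \<Lambda>0 where \<Lambda>0: "\<And>b. \<Lambda>0 b \<in> D" "\<And>b. norm (\<Lambda>0 b - y b) \<le> e" by metis
  \<comment> \<open>Restriction places the function in \<open>PiE F (\<lambda>_. D)\<close>, which
    is countable for finite \<open>F\<close>.\<close>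
  define \<Lambda> where "\<Lambda> = restrict \<Lambda>0 F"
  have \<Lambda>: "norm (\<Lambda> b - y b) \<le> e" if "b \<in> F" for b using that \<Lambda>0 by (simp add: \<Lambda>_def)
  show ?thesis
  proof
    show "\<Lambda> \<in> PiE F (\<lambda>_. D)" using \<Lambda>0 by (simp add: \<Lambda>_def)
    show "x \<in> uniform_diff_set F g m n \<Lambda>"
      unfolding uniform_diff_set_def
    proof (intro CollectI allI impI)
      fix c assume c: "(\<Sum>b\<in>F. \<bar>c b\<bar>) < 1 / real (Suc n)"
      then have 1: "norm (g (x + (\<Sum>b\<in>F. c b *\<^sub>R b)) - g x - (\<Sum>b\<in>F. c b *\<^sub>R y b)) \<le> e * (\<Sum>b\<in>F. \<bar>c b\<bar>)"
        using n by (intro \<delta>(2)) auto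
      have "norm (g (x + (\<Sum>b\<in>F. c b *\<^sub>R b)) - g x - (\<Sum>b\<in>F. c b *\<^sub>R \<Lambda> b))
        = norm ((g (x + (\<Sum>b\<in>F. c b *\<^sub>R b)) - g x - (\<Sum>b\<in>F. c b *\<^sub>R y b)) - ((\<Sum>b\<in>F. c b *\<^sub>R \<Lambda> b) - (\<Sum>b\<in>F. c b *\<^sub>R y b)))"
        by simp
      also have "\<dots> \<le> e * (\<Sum>b\<in>F. \<bar>c b\<bar>) + e * (\<Sum>b\<in>F. \<bar>c b\<bar>)"
        by (intro order_trans[OF norm_triangle_ineq4] add_mono 1 norm_sum_scaleR_diff_le \<Lambda>)
      also have "\<dots> = 1 / real (Suc m) * (\<Sum>b\<in>F. \<bar>c b\<bar>)"
        by (simp only: distrib_right[symmetric] e(3))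
      finally show "norm (g (x + (\<Sum>b\<in>F. c b *\<^sub>R b)) - g x - (\<Sum>b\<in>F. c b *\<^sub>R \<Lambda> b)) \<le> 1 / real (Suc m) * (\<Sum>b\<in>F. \<bar>c b\<bar>)" .
    qed
    show "norm (\<Lambda> b - y b) \<le> 1 / real (Suc m)" if "b \<in> F" for b
      using \<Lambda>[OF that] e(2) by simp
  qed
qed

text \<open>The increment along \<open>v\<close> is followed by an increment in the span of \<open>F\<close>, the latter taken at a
  point \<open>x'\<close> near \<open>x + t v\<close> where \<open>g\<close> has almost the same derivative along \<open>F\<close> as at \<open>x\<close>.\<close>

lemma diff_along_insert:
  fixes g :: "'x::real_normed_vector \<Rightarrow> 'z::real_normed_vector"
  assumes "finite F" "v \<notin> F" and lip: "L-lipschitz_on UNIV g" and diff: "diff_along F g x y"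
    and dense: "\<And>X. open X \<Longrightarrow> X \<noteq> {} \<Longrightarrow> \<exists>d\<in>D. d \<in> X"
    and dir: "((\<lambda>t. g (x + t *\<^sub>R v)) has_vector_derivative y') (at 0)"
    and dist: "\<And>m n \<Lambda>. \<Lambda> \<in> PiE F (\<lambda>_. D) \<Longrightarrow>
      \<exists>d. ((\<lambda>t. infdist (x + t *\<^sub>R v) (uniform_diff_set F g m n \<Lambda>)) has_vector_derivative d) (at 0)"
  shows "diff_along (insert v F) g x (y(v := y'))"
  unfolding diff_along_def
proof (intro allI impI)
  fix \<epsilon> :: real assume "\<epsilon> > 0"
  have L0: "L \<ge> 0" using lipschitz_on_nonneg[OF lip] .
  obtain m where m: "1 / real (Suc m) < \<epsilon> / 4" using \<open>\<epsilon> > 0\<close> nat_approx_posE[of "\<epsilon> / 4"] by auto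
  \<comment> \<open>Passing from \<open>x + t v\<close> to \<open>x'\<close> and back costs
    \<open>L * \<eta> * \<bar>t\<bar>\<close> each time, and the derivative along \<open>v\<close>
    costs one more \<open>\<eta> * \<bar>t\<bar>\<close>; hence the factor
    \<open>2 * L + 1\<close>.\<close>
  define \<eta> where "\<eta> = \<epsilon> / (2 * (2 * L + 1))"
  have \<eta>: "\<eta> > 0" "(2 * L + 1) * \<eta> = \<epsilon> / 2" using \<open>\<epsilon> > 0\<close> L0 by (auto simp: \<eta>_def field_simps add_nonneg_pos)
  obtain n \<Lambda> where \<Lambda>: "\<Lambda> \<in> PiE F (\<lambda>_. D)" "x \<in> uniform_diff_set F g m n \<Lambda>"
    "\<And>b. b \<in> F \<Longrightarrow> norm (\<Lambda> b - y b) \<le> 1 / real (Suc m)"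
    using diff_along_imp_uniform_diff_set[OF \<open>finite F\<close> diff dense] by metis
  define E where "E = uniform_diff_set F g m n \<Lambda>"
  obtain \<delta>1 where \<delta>1: "\<delta>1 > 0" "\<And>t. \<bar>t\<bar> < \<delta>1 \<Longrightarrow> \<exists>x'\<in>E. dist (x + t *\<^sub>R v) x' \<le> \<eta> * \<bar>t\<bar>"
    using dist[OF \<Lambda>(1)] infdist_near_point[OF \<Lambda>(2) _ \<eta>(1)] unfolding E_def by metis
  have "\<exists>\<delta>>0. \<forall>t. \<bar>t\<bar> < \<delta> \<longrightarrow> norm (g (x + t *\<^sub>R v) - g x - t *\<^sub>R y') \<le> \<eta> * \<bar>t\<bar>"
    using dir \<eta>(1) by (simp add: has_vector_derivative_at_alt)
  then obtain \<delta>2 where \<delta>2: "\<delta>2 > 0" "\<And>t. \<bar>t\<bar> < \<delta>2 \<Longrightarrow> norm (g (x + t *\<^sub>R v) - g x - t *\<^sub>R y') \<le> \<eta> * \<bar>t\<bar>"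
    by blast
  define \<delta> where "\<delta> = min (1 / real (Suc n)) (min \<delta>1 \<delta>2)"
  have "norm (g (x + (\<Sum>b\<in>insert v F. c b *\<^sub>R b)) - g x - (\<Sum>b\<in>insert v F. c b *\<^sub>R (y(v := y')) b))
     \<le> \<epsilon> * (\<Sum>b\<in>insert v F. \<bar>c b\<bar>)" if c: "(\<Sum>b\<in>insert v F. \<bar>c b\<bar>) < \<delta>" for c
  proof -
    define t w s where "t = c v" and "w = (\<Sum>b\<in>F. c b *\<^sub>R b)" and "s = (\<Sum>b\<in>F. \<bar>c b\<bar>)"
    have s0: "s \<ge> 0" by (simp add: s_def sum_nonneg)
    have ts: "\<bar>t\<bar> + s < \<delta>" using c assms(1,2) by (simp add: t_def s_def)
    with s0 have t: "\<bar>t\<bar> < \<delta>1" "\<bar>t\<bar> < \<delta>2" and s: "s < 1 / real (Suc n)" by (auto simp: \<delta>_def)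
    obtain x' where x': "x' \<in> E" "dist (x + t *\<^sub>R v) x' \<le> \<eta> * \<bar>t\<bar>" using \<delta>1(2)[OF t(1)] by blast
    let ?Y = "\<Sum>b\<in>F. c b *\<^sub>R y b" and ?\<Lambda> = "\<Sum>b\<in>F. c b *\<^sub>R \<Lambda> b"
    have gl: "norm (g p - g q) \<le> L * (\<eta> * \<bar>t\<bar>)" if "dist p q \<le> \<eta> * \<bar>t\<bar>" for p q
      using lipschitz_onD[OF lip, of p q] mult_left_mono[OF that L0] by (simp add: dist_norm)
    have 1: "norm (g (x + t *\<^sub>R v + w) - g (x' + w)) \<le> L * (\<eta> * \<bar>t\<bar>)"
      using x'(2) by (intro gl) (simp add: dist_norm)
    \<comment> \<open>This is where uniformity on \<open>E\<close> matters: the expansion is used at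
      \<open>x'\<close> with the scale and the \<Lambda> that were chosen for
      \<open>x\<close>.\<close>
    have 2: "norm (g (x' + w) - g x' - ?\<Lambda>) \<le> 1 / real (Suc m) * s"
      using x'(1) s unfolding E_def uniform_diff_set_def w_def s_def by blast
    have 3: "norm (g x' - g (x + t *\<^sub>R v)) \<le> L * (\<eta> * \<bar>t\<bar>)"
      using x'(2) by (intro gl) (simp add: dist_commute)
    have 4: "norm (g (x + t *\<^sub>R v) - g x - t *\<^sub>R y') \<le> \<eta> * \<bar>t\<bar>" by (rule \<delta>2(2)[OF t(2)])
    have 5: "norm (?\<Lambda> - ?Y) \<le> 1 / real (Suc m) * s"
      unfolding s_def by (intro norm_sum_scaleR_diff_le \<Lambda>(3))
    have "(\<Sum>b\<in>insert v F. c b *\<^sub>R b) = t *\<^sub>R v + w"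
      using assms(1,2) by (simp add: t_def w_def)
    moreover have "(\<Sum>b\<in>insert v F. c b *\<^sub>R (y(v := y')) b) = t *\<^sub>R y' + ?Y"
    proof -
      have "(\<Sum>b\<in>F. c b *\<^sub>R (y(v := y')) b) = ?Y"
        using assms(2) by (intro sum.cong) auto
      then show ?thesis using assms(1,2) by (simp add: t_def)
    qed
    ultimately have "g (x + (\<Sum>b\<in>insert v F. c b *\<^sub>R b)) - g x - (\<Sum>b\<in>insert v F. c b *\<^sub>R (y(v := y')) b)
      = (g (x + t *\<^sub>R v + w) - g (x' + w)) + (g (x' + w) - g x' - ?\<Lambda>) + (g x' - g (x + t *\<^sub>R v))
        + (g (x + t *\<^sub>R v) - g x - t *\<^sub>R y') + (?\<Lambda> - ?Y)"
      by (simp add: add.assoc)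
    also have "norm \<dots> \<le> L * (\<eta> * \<bar>t\<bar>) + 1 / real (Suc m) * s + L * (\<eta> * \<bar>t\<bar>) + \<eta> * \<bar>t\<bar> + 1 / real (Suc m) * s"
      by (intro norm_triangle_mono 1 2 3 4 5)
    also have "\<dots> = ((2 * L + 1) * \<eta>) * \<bar>t\<bar> + 2 * (1 / real (Suc m)) * s"
      by (simp add: algebra_simps)
    also have "\<dots> \<le> \<epsilon> * \<bar>t\<bar> + \<epsilon> * s"
    proof (intro add_mono mult_right_mono s0)
      show "(2 * L + 1) * \<eta> \<le> \<epsilon>" using \<eta>(2) \<open>\<epsilon> > 0\<close> by simp
      show "2 * (1 / real (Suc m)) \<le> \<epsilon>" using m \<open>\<epsilon> > 0\<close> by simp
    qed simp
    also have "\<dots> = \<epsilon> * (\<Sum>b\<in>insert v F. \<bar>c b\<bar>)"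
      using assms(1,2) by (simp add: t_def s_def distrib_left)
    finally show ?thesis .
  qed
  moreover have "\<delta> > 0" using \<delta>1(1) \<delta>2(1) by (simp add: \<delta>_def)
  ultimately show "\<exists>\<delta>>0. \<forall>c. (\<Sum>b\<in>insert v F. \<bar>c b\<bar>) < \<delta> \<longrightarrow>
     norm (g (x + (\<Sum>b\<in>insert v F. c b *\<^sub>R b)) - g x - (\<Sum>b\<in>insert v F. c b *\<^sub>R (y(v := y')) b))
     \<le> \<epsilon> * (\<Sum>b\<in>insert v F. \<bar>c b\<bar>)"
    by blast
qed

lemma infdist_lipschitz: "1-lipschitz_on UNIV (\<lambda>x. infdist x S)"
  by (rule lipschitz_onI) (auto simp: dist_real_def infdist_triangle_abs)

context finite_dim_haar
begin

text \<open>Directions are added one at a time. For each new direction \<open>v\<close>, one null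
  set takes care of \<open>g\<close> and of the countably many distance functions, of which only the
  derivatives along \<open>v\<close> are required.\<close>

lemma AE_diff_along:
  fixes g :: "'x \<Rightarrow> 'z::{banach, second_countable_topology}"
  assumes curves: "curves_ae_differentiable TYPE('z)" "curves_ae_differentiable TYPE(real)"
    and lip: "L-lipschitz_on UNIV g" and "finite F"
  shows "AE x in \<mu>. \<exists>y. diff_along F g x y"
  using \<open>finite F\<close>
proof (induction F)
  case empty
  then show ?case by (auto simp: diff_along_def intro: exI[of _ 1])
next
  case (insert v F)
  obtain D :: "'z set" where D: "countable D" "\<And>X. open X \<Longrightarrow> X \<noteq> {} \<Longrightarrow> \<exists>d\<in>D. d \<in> X"
    using countable_dense_setE by metis
  have "AE x in \<mu>. \<forall>\<Lambda>\<in>PiE F (\<lambda>_. D). \<forall>m n.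
      \<exists>d. ((\<lambda>t. infdist (x + t *\<^sub>R v) (uniform_diff_set F g m n \<Lambda>)) has_vector_derivative d) (at 0)"
    using countable_PiE[OF \<open>finite F\<close>, of "\<lambda>_. D"] D(1)
    by (simp only: AE_ball_countable AE_all_countable)
       (intro ballI allI AE_directional_derivative[OF curves(2) infdist_lipschitz])
  with insert.IH AE_directional_derivative[OF curves(1) lip, of v]
  show ?case
  proof eventually_elim
    case (elim x)
    then obtain y y' where "diff_along F g x y" "((\<lambda>t. g (x + t *\<^sub>R v)) has_vector_derivative y') (at 0)" by blast
    from diff_along_insert[OF insert.hyps lip this(1) D(2) this(2)] elim(3) show ?case by blast
  qed
qed

text \<open>Rademacher's theorem. For a basis, differentiability in the coefficients is total
  differentiability, because the l1 norm of the coefficients is bounded by a multiple of the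
  norm.\<close>

theorem AE_lipschitz_differentiable:
  fixes g :: "'x \<Rightarrow> 'z::{banach, second_countable_topology}"
  assumes curves: "curves_ae_differentiable TYPE('z)" "curves_ae_differentiable TYPE(real)"
    and lip: "L-lipschitz_on UNIV g"
  shows "AE x in \<mu>. \<exists>A. (g has_derivative A) (at x)"
  using AE_diff_along[OF curves lip finite_B]
proof eventually_elim
  case (elim x)
  then obtain y where y: "diff_along B g x y" by blast
  obtain K where K: "K > 0" "\<And>u. (\<Sum>b\<in>B. \<bar>representation B u b\<bar>) \<le> K * norm u"
    using sum_representation_le by blast
  define A where "A u = (\<Sum>b\<in>B. representation B u b *\<^sub>R y b)" for u
  have "linear A"
    unfolding A_def
    by (intro linearI)
       (simp_all add: representation_add representation_scale independent_B span_B scaleR_add_left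
         sum.distrib scaleR_sum_right)
  have "(g has_derivative A) (at x)"
    unfolding has_derivative_at_alt
  proof (intro conjI allI impI)
    show "bounded_linear A" using \<open>linear A\<close> by (rule bounded_linear_of_linear)
    fix \<epsilon> :: real assume "\<epsilon> > 0"
    then have "\<epsilon> / K > 0" using K(1) by simp
    then obtain \<delta> where \<delta>: "\<delta> > 0" "\<And>c. (\<Sum>b\<in>B. \<bar>c b\<bar>) < \<delta> \<Longrightarrow>
     norm (g (x + (\<Sum>b\<in>B. c b *\<^sub>R b)) - g x - (\<Sum>b\<in>B. c b *\<^sub>R y b)) \<le> \<epsilon> / K * (\<Sum>b\<in>B. \<bar>c b\<bar>)"
      using y unfolding diff_along_def by meson
    have "norm (g z - g x - A (z - x)) \<le> \<epsilon> * norm (z - x)" if z: "norm (z - x) < \<delta> / K" for z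
    proof -
      let ?c = "representation B (z - x)"
      have "(\<Sum>b\<in>B. \<bar>?c b\<bar>) < \<delta>"
        using K(2)[of "z - x"] z K(1) by (simp add: field_simps)
      from \<delta>(2)[OF this] have "norm (g z - g x - A (z - x)) \<le> \<epsilon> / K * (\<Sum>b\<in>B. \<bar>?c b\<bar>)"
        by (simp add: sum_representation A_def)
      also have "\<dots> \<le> \<epsilon> / K * (K * norm (z - x))"
        using \<open>\<epsilon> / K > 0\<close> by (intro mult_left_mono K(2)) simp
      finally show ?thesis using K(1) by simp
    qed
    then show "\<exists>d>0. \<forall>z. norm (z - x) < d \<longrightarrow> norm (g z - g x - A (z - x)) \<le> \<epsilon> * norm (z - x)"
      using \<delta>(1) K(1) by (intro exI[of _ "\<delta> / K"]) auto
  qed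
  then show ?case by blast
qed

end

section \<open>Unordered tuples\<close>

lemma finite_mset_eq: "finite {xs. mset xs = S}"
proof (rule finite_subset)
  show "{xs. mset xs = S} \<subseteq> {xs. set xs \<subseteq> set_mset S \<and> length xs = size S}"
    by auto
qed (simp add: finite_lists_length_eq)

lemma finite_qdist_values:
  "finite {sqrt (\<Sum>i<size S. (norm (ys ! i - zs ! i))\<^sup>2) | ys zs. mset ys = S \<and> mset zs = (T :: 'y::real_normed_vector multiset)}"
  (is "finite ?V")
proof (rule finite_subset)
  show "?V \<subseteq> (\<lambda>(ys, zs). sqrt (\<Sum>i<size S. (norm (ys ! i - zs ! i))\<^sup>2)) ` ({ys. mset ys = S} \<times> {zs. mset zs = T})"
    by auto
qed (intro finite_imageI finite_cartesian_product finite_mset_eq)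

lemma qdist_le:
  assumes "mset ys = S" "mset zs = T"
  shows "qdist S T \<le> L2_set (\<lambda>i. norm (ys ! i - zs ! i)) {..<size S}"
  unfolding qdist_def L2_set_def
  by (rule Min_le[OF finite_qdist_values]) (use assms in blast)

lemma qdist_attained:
  obtains ys zs where "mset ys = S" "mset zs = T"
    "qdist S T = L2_set (\<lambda>i. norm (ys ! i - zs ! i)) {..<size S}"
proof -
  let ?V = "{sqrt (\<Sum>i<size S. (norm (ys ! i - zs ! i))\<^sup>2) | ys zs. mset ys = S \<and> mset zs = T}"
  obtain ys zs where "mset ys = S" "mset zs = T" using ex_mset by metis
  then have "?V \<noteq> {}" by blast
  with finite_qdist_values have "qdist S T \<in> ?V" unfolding qdist_def by (rule Min_in)
  then show ?thesis using that by (auto simp: L2_set_def)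
qed

text \<open>The permutation that turns the left list of an optimal pair into \<open>xs\<close> is
  applied to the right list too, which leaves the cost unchanged. This allows optimal matchings to
  be composed in the triangle inequality.\<close>

lemma qdist_attained_left:
  assumes "mset xs = S" "size S = size T"
  obtains zs where "mset zs = T" "qdist S T = L2_set (\<lambda>i. norm (xs ! i - zs ! i)) {..<size S}"
proof -
  obtain ys zs where yz: "mset ys = S" "mset zs = T"
    "qdist S T = L2_set (\<lambda>i. norm (ys ! i - zs ! i)) {..<size S}"
    using qdist_attained by blast
  obtain p where p: "p permutes {..<length ys}" "permute_list p ys = xs"
    using mset_eq_permutation[of xs ys] yz(1) assms(1) by metis
  have len: "length ys = size S" "length zs = size S"
    using yz assms(2) size_mset by metis+
  have "mset (permute_list p zs) = T"
    using p(1) yz(2) len by simp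
  moreover have "(\<Sum>i<size S. (norm (ys ! i - zs ! i))\<^sup>2) = (\<Sum>i<size S. (norm (xs ! i - permute_list p zs ! i))\<^sup>2)"
  proof -
    have "(\<Sum>i<size S. (norm (ys ! i - zs ! i))\<^sup>2) = (\<Sum>i<size S. (norm (ys ! p i - zs ! p i))\<^sup>2)"
      using sum.permute[of p "{..<size S}" "\<lambda>i. (norm (ys ! i - zs ! i))\<^sup>2"] p(1) len by (simp add: o_def)
    also have "\<dots> = (\<Sum>i<size S. (norm (xs ! i - permute_list p zs ! i))\<^sup>2)"
      using p len by (intro sum.cong) (auto simp: permute_list_nth)
    finally show ?thesis .
  qed
  ultimately show ?thesis using that yz(3) by (simp add: L2_set_def)
qed

lemma qdist_nonneg: "0 \<le> qdist S T"
  by (rule qdist_attained[of S T]) simp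

lemma qdist_refl: "qdist S S = 0"
proof -
  obtain xs where "mset xs = S" using ex_mset by blast
  then have "qdist S S \<le> L2_set (\<lambda>i. norm (xs ! i - xs ! i)) {..<size S}" by (intro qdist_le)
  then show ?thesis using qdist_nonneg[of S S] by (simp add: L2_set_def)
qed

lemma qdist_commute:
  assumes "size S = size T"
  shows "qdist S T = qdist T S"
proof -
  have "qdist S T \<le> qdist T S" if "size S = size T" for S T :: "'a multiset"
  proof -
    obtain ys zs where yz: "mset ys = T" "mset zs = S" "qdist T S = L2_set (\<lambda>i. norm (ys ! i - zs ! i)) {..<size T}"
      using qdist_attained by blast
    then show ?thesis
      using qdist_le[OF yz(2,1)] that by (simp add: norm_minus_commute)
  qed
  from this[OF assms] this[OF assms[symmetric]] show ?thesis by simp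
qed

lemma qdist_triangle:
  assumes "size S = size T" "size T = size U"
  shows "qdist S U \<le> qdist S T + qdist T U"
proof -
  obtain xs ys where xy: "mset xs = S" "mset ys = T" "qdist S T = L2_set (\<lambda>i. norm (xs ! i - ys ! i)) {..<size S}"
    using qdist_attained by blast
  obtain zs where z: "mset zs = U" "qdist T U = L2_set (\<lambda>i. norm (ys ! i - zs ! i)) {..<size T}"
    using qdist_attained_left[OF xy(2) assms(2)] by blast
  have "qdist S U \<le> L2_set (\<lambda>i. norm (xs ! i - zs ! i)) {..<size S}"
    by (rule qdist_le[OF xy(1) z(1)])
  also have "\<dots> \<le> L2_set (\<lambda>i. norm (xs ! i - ys ! i) + norm (ys ! i - zs ! i)) {..<size S}"
    by (intro L2_set_mono norm_diff_triangle_le[OF order_refl order_refl]) auto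
  also have "\<dots> \<le> qdist S T + qdist T U"
    using xy(3) z(2) assms by (simp add: L2_set_triangle_ineq)
  finally show ?thesis .
qed

lemma qdist_eq_0_imp_eq:
  assumes "size S = size T" "qdist S T = 0"
  shows "S = T"
proof -
  obtain xs ys where xy: "mset xs = S" "mset ys = T" "qdist S T = L2_set (\<lambda>i. norm (xs ! i - ys ! i)) {..<size S}"
    using qdist_attained by blast
  then have "L2_set (\<lambda>i. norm (xs ! i - ys ! i)) {..<size S} = 0"
    using assms(2) by simp
  then have "\<forall>i\<in>{..<size S}. norm (xs ! i - ys ! i) = 0"
    by (simp only: L2_set_eq_0_iff finite_lessThan)
  moreover have "length xs = size S" "length ys = size S" using xy assms(1) size_mset by metis+
  ultimately have "xs = ys" by (intro nth_equalityI) auto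
  with xy show ?thesis by simp
qed

lemma sum_mset_conv_nth:
  fixes h :: "'a \<Rightarrow> 'b::comm_monoid_add"
  shows "(\<Sum>c\<in>#mset cs. h c) = (\<Sum>i<length cs. h (cs ! i))"
proof -
  have "(\<Sum>c\<in>#mset cs. h c) = sum_list (map h cs)"
    by (metis mset_map sum_mset_sum_list)
  then show ?thesis by (simp add: sum_list_sum_nth atLeast0LessThan)
qed

lemma qdist_image_le_sqrt:
  "qdist (image_mset u C) (image_mset w C) \<le> sqrt (\<Sum>c\<in>#C. (norm (u c - w c))\<^sup>2)"
proof -
  obtain cs where cs: "mset cs = C" using ex_mset by blast
  have "qdist (image_mset u C) (image_mset w C) \<le> L2_set (\<lambda>i. norm (map u cs ! i - map w cs ! i)) {..<size (image_mset u C)}"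
    using cs by (intro qdist_le) auto
  also have "\<dots> = sqrt (\<Sum>c\<in>#C. (norm (u c - w c))\<^sup>2)"
    unfolding L2_set_def cs[symmetric] by (simp add: sum_mset_conv_nth)
  finally show ?thesis .
qed

lemma qdist_image_le_sum:
  "qdist (image_mset u C) (image_mset w C) \<le> (\<Sum>c\<in>#C. norm (u c - w c))"
proof -
  obtain cs where cs: "mset cs = C" using ex_mset by blast
  have "sqrt (\<Sum>c\<in>#C. (norm (u c - w c))\<^sup>2) = L2_set (\<lambda>i. norm (u (cs ! i) - w (cs ! i))) {..<length cs}"
    unfolding L2_set_def cs[symmetric] by (simp add: sum_mset_conv_nth)
  also have "\<dots> \<le> (\<Sum>c\<in>#C. norm (u c - w c))"
    unfolding cs[symmetric] sum_mset_conv_nth by (intro L2_set_le_sum) simp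
  finally show ?thesis using qdist_image_le_sqrt[of u C w] by simp
qed

text \<open>In an optimal matching each pair of points is at distance at most
  \<open>qdist S T\<close>, so every one of the \<open>size S\<close> summands changes by at most
  \<open>K * qdist S T\<close>.\<close>

lemma norm_sum_mset_diff_le_qdist:
  assumes size: "size S = size T" and lip: "K-lipschitz_on UNIV \<psi>"
  shows "norm ((\<Sum>y\<in>#S. \<psi> y) - (\<Sum>y\<in>#T. \<psi> y)) \<le> real (size S) * K * qdist S T"
proof -
  obtain ys zs where yz: "mset ys = S" "mset zs = T" "qdist S T = L2_set (\<lambda>i. norm (ys ! i - zs ! i)) {..<size S}"
    using qdist_attained by blast
  have len: "length ys = size S" "length zs = size S" using yz size size_mset by metis+
  have "(\<Sum>y\<in>#S. \<psi> y) - (\<Sum>y\<in>#T. \<psi> y) = (\<Sum>i<size S. \<psi> (ys ! i) - \<psi> (zs ! i))"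
    using sum_mset_conv_nth[of \<psi> ys] sum_mset_conv_nth[of \<psi> zs] yz(1,2) len by (simp add: sum_subtractf)
  also have "norm \<dots> \<le> (\<Sum>i<size S. K * qdist S T)"
  proof (rule sum_norm_le)
    fix i assume "i \<in> {..<size S}"
    have "norm (\<psi> (ys ! i) - \<psi> (zs ! i)) \<le> K * norm (ys ! i - zs ! i)"
      using lipschitz_onD[OF lip, of "ys ! i" "zs ! i"] by (simp add: dist_norm)
    also have "\<dots> \<le> K * qdist S T"
      unfolding yz(3) using \<open>i \<in> _\<close> lipschitz_on_nonneg[OF lip]
      by (intro mult_left_mono member_le_L2_set[of "{..<size S}" i "\<lambda>i. norm (ys ! i - zs ! i)"]) auto
    finally show "norm (\<psi> (ys ! i) - \<psi> (zs ! i)) \<le> K * qdist S T" .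
  qed
  finally show ?thesis by simp
qed

section \<open>Means of clusters\<close>

definition cutoff :: "real \<Rightarrow> 'y::real_normed_vector \<Rightarrow> 'y" where
  "cutoff r v = max 0 (min 1 (2 - norm v / r)) *\<^sub>R v"

lemma cutoff_near: "r > 0 \<Longrightarrow> norm v \<le> r \<Longrightarrow> cutoff r v = v"
  by (simp add: cutoff_def max_def min_def)

lemma cutoff_far: "r > 0 \<Longrightarrow> 2 * r \<le> norm v \<Longrightarrow> cutoff r v = 0"
  by (simp add: cutoff_def max_def min_def field_simps)

text \<open>The constant does not depend on \<open>r\<close>: the scalar factor is
  \<open>1 / r\<close>-Lipschitz and its change multiplies a vector of norm at most
  \<open>2 * r\<close>, which gives 2, and the change of the vector gives 1. By symmetry
  \<open>w\<close> is the shorter vector; if even \<open>w\<close> is longer than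
  \<open>2 * r\<close>, then both values vanish.\<close>

lemma cutoff_lipschitz:
  assumes "r > 0"
  shows "3-lipschitz_on UNIV (cutoff r :: 'y::real_normed_vector \<Rightarrow> 'y)"
proof -
  define \<phi> where "\<phi> v = max 0 (min 1 (2 - norm v / r))" for v :: 'y
  have \<phi>: "0 \<le> \<phi> v" "\<phi> v \<le> 1" for v by (auto simp: \<phi>_def)
  have \<phi>_diff: "\<bar>\<phi> v - \<phi> w\<bar> \<le> norm (v - w) / r" for v w
  proof -
    have "\<bar>\<phi> v - \<phi> w\<bar> \<le> \<bar>norm v / r - norm w / r\<bar>" by (auto simp: \<phi>_def)
    also have "\<dots> = \<bar>norm v - norm w\<bar> / r" using assms by (simp add: diff_divide_distrib[symmetric])
    also have "\<dots> \<le> norm (v - w) / r" using assms by (intro divide_right_mono norm_triangle_ineq3) auto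
    finally show ?thesis .
  qed
  have *: "norm (cutoff r v - cutoff r w) \<le> 3 * norm (v - w)" if "norm w \<le> norm v" for v w :: 'y
  proof (cases "norm w \<le> 2 * r")
    case True
    have "cutoff r v - cutoff r w = \<phi> v *\<^sub>R (v - w) + (\<phi> v - \<phi> w) *\<^sub>R w"
      by (simp add: cutoff_def \<phi>_def algebra_simps)
    also have "norm \<dots> \<le> 1 * norm (v - w) + (norm (v - w) / r) * (2 * r)"
    proof (intro norm_triangle_mono)
      show "norm (\<phi> v *\<^sub>R (v - w)) \<le> 1 * norm (v - w)"
        unfolding norm_scaleR using \<phi>[of v] by (intro mult_right_mono) auto
      show "norm ((\<phi> v - \<phi> w) *\<^sub>R w) \<le> (norm (v - w) / r) * (2 * r)"
        unfolding norm_scaleR using \<phi>_diff[of v w] True assms by (intro mult_mono) auto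
    qed
    also have "\<dots> = 3 * norm (v - w)" using assms by simp
    finally show ?thesis .
  next
    case False
    then show ?thesis using that assms by (simp add: cutoff_far)
  qed
  show ?thesis
  proof (rule lipschitz_onI)
    fix v w :: 'y
    show "dist (cutoff r v) (cutoff r w) \<le> 3 * dist v w"
      using *[of v w] *[of w v] by (cases "norm w \<le> norm v") (auto simp: dist_norm norm_minus_commute)
  qed simp
qed

text \<open>If \<open>S\<close> has \<open>count C c\<close> points within distance \<open>r\<close> of \<open>c\<close> and its other points are at
  distance at least \<open>2 r\<close>, then this is the mean of the former.\<close>

definition cluster_mean :: "'y::real_normed_vector multiset \<Rightarrow> real \<Rightarrow> 'y multiset \<Rightarrow> 'y \<Rightarrow> 'y" where
  "cluster_mean C r S c = c + (1 / real (count C c)) *\<^sub>R (\<Sum>y\<in>#S. cutoff r (y - c))"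

text \<open>There is no condition relating \<open>S\<close> and \<open>T\<close> to the centres
  \<open>C\<close>. Hence the cluster means of a Lipschitz multivalued map are Lipschitz on the
  whole domain, also where they have no meaning as means.\<close>

lemma cluster_mean_lipschitz:
  assumes "r > 0" "size S = size T"
  shows "norm (cluster_mean C r S c - cluster_mean C r T c) \<le> 3 * real (size S) * qdist S T"
proof -
  have "3-lipschitz_on UNIV (\<lambda>y. cutoff r (y - c))"
  proof (rule lipschitz_onI)
    show "dist (cutoff r (y - c)) (cutoff r (z - c)) \<le> 3 * dist y z" for y z
      using lipschitz_onD[OF cutoff_lipschitz[OF assms(1)], of "y - c" "z - c"] by (simp add: dist_norm)
  qed simp
  note 1 = norm_sum_mset_diff_le_qdist[OF assms(2) this]
  have "norm (cluster_mean C r S c - cluster_mean C r T c)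
      = (1 / real (count C c)) * norm ((\<Sum>y\<in>#S. cutoff r (y - c)) - (\<Sum>y\<in>#T. cutoff r (y - c)))"
    by (simp add: cluster_mean_def scaleR_diff_right[symmetric])
  \<comment> \<open>If \<open>c\<close> is not in \<open>C\<close>, the factor is
    \<open>1 / 0\<close>, which is 0.\<close>
  also have "\<dots> \<le> 1 * norm ((\<Sum>y\<in>#S. cutoff r (y - c)) - (\<Sum>y\<in>#T. cutoff r (y - c)))"
    by (intro mult_right_mono) (auto simp: divide_le_eq)
  finally show ?thesis using 1 by simp
qed

lemma sum_mset_if_eq: "(\<Sum>z\<in>#S. if z = y then w else 0) = real (count S y) *\<^sub>R (w :: 'y::real_vector)"
  by (induction S) (auto simp: scaleR_add_left)

lemma finite_separation:
  fixes S :: "'y::metric_space set"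
  assumes "finite S"
  obtains \<delta> where "\<delta> > 0" "\<And>y z. y \<in> S \<Longrightarrow> z \<in> S \<Longrightarrow> y \<noteq> z \<Longrightarrow> \<delta> \<le> dist y z"
proof
  let ?P = "insert 1 ((\<lambda>(y, z). dist y z) ` {p \<in> S \<times> S. fst p \<noteq> snd p})"
  have fin: "finite ?P" using assms by simp
  show "0 < Min ?P" using fin by (subst Min_gr_iff) auto
  show "Min ?P \<le> dist y z" if "y \<in> S" "z \<in> S" "y \<noteq> z" for y z
    using fin that by (intro Min_le) force+
qed

text \<open>Every point of \<open>S\<close> is replaced by a centre in \<open>D\<close> nearer than
  a quarter of the least distance between distinct points of \<open>S\<close>. Then each cluster is
  a single repeated point, which is its own mean, and the centres carry the multiplicities of the
  points because distinct points have distinct centres.\<close>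

lemma cluster_mean_exists:
  fixes S :: "'y::real_normed_vector multiset"
  assumes dense: "\<And>X. open X \<Longrightarrow> X \<noteq> {} \<Longrightarrow> \<exists>d\<in>D. d \<in> X"
  obtains C k where "set_mset C \<subseteq> D" "size C = size S" "image_mset (cluster_mean C (1 / real (Suc k)) S) C = S"
proof -
  obtain \<delta> where \<delta>: "\<delta> > 0" "\<And>y z. y \<in># S \<Longrightarrow> z \<in># S \<Longrightarrow> y \<noteq> z \<Longrightarrow> \<delta> \<le> dist y z"
    using finite_separation[of "set_mset S"] by auto
  obtain k where k: "1 / real (Suc k) < \<delta> / 4" using \<delta>(1) nat_approx_posE[of "\<delta> / 4"] by auto
  define r where "r = 1 / real (Suc k)"
  have r: "r > 0" "4 * r < \<delta>" using k by (auto simp: r_def)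
  have "\<exists>d\<in>D. norm (y - d) < r" for y using dense[of "ball y r"] r(1) by (auto simp: dist_norm)
  then obtain d where d: "\<And>y. d y \<in> D" "\<And>y. norm (y - d y) < r" by metis
  have far: "norm (z - d y) \<ge> 2 * r" if "y \<in># S" "z \<in># S" "z \<noteq> y" for y z
  proof -
    have "dist z y \<le> norm (z - d y) + norm (y - d y)"
      by (metis dist_norm dist_triangle2)
    then show ?thesis using \<delta>(2)[OF that(2,1,3)] d(2)[of y] r by simp
  qed
  define C where "C = image_mset d S"
  have inj: "z = y" if "y \<in># S" "z \<in># S" "d z = d y" for y z
    using far[OF that(1,2)] d(2)[of z] that(3) r(1) by (cases "z = y") auto
  have "cluster_mean C r S (d y) = y" if y: "y \<in># S" for y
  proof -
    have "d -` {d y} \<inter> set_mset S = {y}" using inj[OF y] y by auto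
    then have count: "count C (d y) = count S y" by (simp add: C_def count_image_mset)
    have "(\<Sum>z\<in>#S. cutoff r (z - d y)) = (\<Sum>z\<in>#S. if z = y then y - d y else 0)"
    proof (intro arg_cong[of _ _ sum_mset] image_mset_cong)
      fix z assume "z \<in># S"
      then show "cutoff r (z - d y) = (if z = y then y - d y else 0)"
        using far[OF y] d(2)[of y] r(1) by (auto simp: cutoff_near cutoff_far)
    qed
    also have "\<dots> = real (count S y) *\<^sub>R (y - d y)" by (rule sum_mset_if_eq)
    finally have "(\<Sum>z\<in>#S. cutoff r (z - d y)) = real (count S y) *\<^sub>R (y - d y)" .
    then show ?thesis using y by (simp add: cluster_mean_def count count_eq_zero_iff)
  qed
  then have "image_mset (cluster_mean C r S) C = image_mset (\<lambda>y. y) S"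
    unfolding C_def image_mset.compositionality by (intro image_mset_cong) (simp add: C_def)
  then show ?thesis using that[of C k] d(1) by (auto simp: C_def r_def)
qed

section \<open>Tangents in the strong sense\<close>

text \<open>The neighbourhoods in \<open>nhds a\<close> include \<open>a\<close> itself, so the
  condition at \<open>x = a\<close> makes the tangent take the value \<open>f a\<close>
  there.\<close>

definition multi_differentiable :: "('x::real_normed_vector \<Rightarrow> 'y::real_normed_vector multiset) \<Rightarrow> 'x \<Rightarrow> ('x \<Rightarrow> 'y) multiset \<Rightarrow> bool" where
  "multi_differentiable f a As \<longleftrightarrow> (\<forall>A\<in>#As. affine_map A) \<and>
    (\<forall>\<epsilon>>0. \<forall>\<^sub>F x in nhds a. qdist (f x) {#A x. A \<in># As#} \<le> \<epsilon> * norm (x - a))"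

lemma sum_mset_le_const:
  fixes h :: "'c \<Rightarrow> real"
  assumes "\<And>c. c \<in># C \<Longrightarrow> h c \<le> e"
  shows "(\<Sum>c\<in>#C. h c) \<le> real (size C) * e"
  using assms by (induction C) (auto simp: algebra_simps intro: add_mono)

text \<open>On \<open>S\<close> the map is a tuple of differentiable functions. A point
  \<open>x\<close> near \<open>a\<close> is compared with a point \<open>x'\<close> of
  \<open>S\<close> whose distance from \<open>x\<close> is small relative to
  \<open>norm (x - a)\<close>; the Lipschitz bounds of \<open>f\<close> and of the affine tuple pay
  for the passage.\<close>

lemma multi_differentiable_on_cluster_set:
  fixes f :: "'x::real_normed_vector \<Rightarrow> 'y::real_normed_vector multiset"
  assumes size: "\<And>x. size (f x) = Q" "size C = Q"
    and lip: "\<And>x x'. qdist (f x) (f x') \<le> K * norm (x - x')" and "K \<ge> 0"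
    and u: "\<And>c. c \<in># C \<Longrightarrow> (u c has_derivative A c) (at a)"
    and S: "\<And>x. x \<in> S \<Longrightarrow> f x = image_mset (\<lambda>c. u c x) C" and "a \<in> S"
    and inf: "((\<lambda>x. infdist x S) has_derivative I) (at a)"
  shows "multi_differentiable f a (image_mset (\<lambda>c x. u c a + A c (x - a)) C)"
  unfolding multi_differentiable_def
proof (intro conjI ballI allI impI)
  fix T assume "T \<in># image_mset (\<lambda>c x. u c a + A c (x - a)) C"
  then obtain c where c: "c \<in># C" "T = (\<lambda>x. u c a + A c (x - a))" by auto
  have "linear (A c)" using u[OF c(1)] has_derivative_linear by blast
  then have "T x - T 0 = A c x" for x by (simp add: c(2) linear_diff linear_0)
  then show "affine_map T" using \<open>linear (A c)\<close> by (simp add: affine_map_def)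
next
  fix \<epsilon> :: real assume "\<epsilon> > 0"
  have lin: "bounded_linear (A c)" if "c \<in># C" for c
    using u[OF that] by (rule has_derivative_bounded_linear)
  define M where "M = Max (insert 0 ((\<lambda>c. onorm (A c)) ` set_mset C))"
  have M: "0 \<le> M" "\<And>c. c \<in># C \<Longrightarrow> onorm (A c) \<le> M"
    by (auto simp: M_def)
  \<comment> \<open>In units of \<open>\<eta> * norm (x - a)\<close> the three errors are
    \<open>2 * K\<close> for moving \<open>f\<close>, \<open>3 * Q\<close> for the expansions at
    \<open>x'\<close> and \<open>2 * Q * M\<close> for moving the affine maps; the 1 keeps the
    denominator positive. The bound \<open>\<eta> \<le> 1\<close> places \<open>x'\<close> within
    \<open>3 * norm (x - a)\<close> of \<open>a\<close>.\<close>
  define \<eta> where "\<eta> = min 1 (\<epsilon> / (2 * (K + real Q * 2 + real Q * M + 1)))"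
  have pos: "K + real Q * 2 + real Q * M + 1 > 0" using \<open>K \<ge> 0\<close> M(1) by (intro add_nonneg_pos) auto
  have \<eta>: "\<eta> > 0" "\<eta> \<le> 1" using \<open>\<epsilon> > 0\<close> pos by (auto simp: \<eta>_def)
  have \<eta>\<epsilon>: "2 * \<eta> * (K + real Q * 2 + real Q * M + 1) \<le> \<epsilon>"
  proof -
    have "\<eta> \<le> \<epsilon> / (2 * (K + real Q * 2 + real Q * M + 1))" by (simp add: \<eta>_def)
    then show ?thesis using pos by (simp add: field_simps)
  qed
  have "I = (\<lambda>h. 0)"
    by (rule has_derivative_local_min[OF inf]) (use \<open>a \<in> S\<close> in \<open>simp add: infdist_nonneg\<close>)
  then have ev_inf: "\<forall>\<^sub>F x in nhds a. infdist x S \<le> \<eta> * norm (x - a)"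
    using inf \<eta>(1) \<open>a \<in> S\<close> unfolding has_derivative_at_alt eventually_nhds_metric
    by (auto simp: dist_norm infdist_nonneg)
  have "\<forall>\<^sub>F x in nhds a. norm (u c x - u c a - A c (x - a)) \<le> \<eta> * norm (x - a)" if "c \<in># C" for c
    using u[OF that] \<eta>(1) unfolding has_derivative_at_alt eventually_nhds_metric by (auto simp: dist_norm)
  then have "\<forall>\<^sub>F x in nhds a. \<forall>c\<in>set_mset C. norm (u c x - u c a - A c (x - a)) \<le> \<eta> * norm (x - a)"
    by (intro eventually_ball_finite) auto
  then obtain \<delta> where \<delta>: "\<delta> > 0" "\<And>x c. dist x a < \<delta> \<Longrightarrow> c \<in># C \<Longrightarrow> norm (u c x - u c a - A c (x - a)) \<le> \<eta> * norm (x - a)"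
    unfolding eventually_nhds_metric by blast
  \<comment> \<open>The expansions of the \<open>u c\<close> are applied at \<open>x'\<close>, which
    may be three times as far from \<open>a\<close> as \<open>x\<close>.\<close>
  have ev_ball: "\<forall>\<^sub>F x in nhds a. 3 * dist x a < \<delta>"
    unfolding eventually_nhds_metric using \<delta>(1) by (intro exI[of _ "\<delta> / 3"]) auto
  let ?T = "\<lambda>x. image_mset (\<lambda>c. u c a + A c (x - a)) C"
  from ev_inf ev_ball show "\<forall>\<^sub>F x in nhds a. qdist (f x) {#T x. T \<in># image_mset (\<lambda>c x. u c a + A c (x - a)) C#} \<le> \<epsilon> * norm (x - a)"
  proof eventually_elim
    case (elim x)
    define \<rho> where "\<rho> = norm (x - a)"
    obtain x' where x': "x' \<in> S" "norm (x - x') \<le> 2 * \<eta> * \<rho>"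
    proof (cases "x = a")
      case True
      then show ?thesis using that[of a] \<open>a \<in> S\<close> by (simp add: \<rho>_def)
    next
      case False
      then have "\<rho> > 0" by (simp add: \<rho>_def)
      have "S \<noteq> {}" using \<open>a \<in> S\<close> by blast
      then have "(INF s\<in>S. dist x s) \<le> \<eta> * \<rho>"
        using elim(1) by (simp add: infdist_notempty \<rho>_def)
      also have "\<dots> < 2 * \<eta> * \<rho>" using \<open>\<rho> > 0\<close> \<eta>(1) by simp
      finally obtain s where "s \<in> S" "dist x s < 2 * \<eta> * \<rho>"
        using \<open>S \<noteq> {}\<close> by (subst (asm) cINF_less_iff) auto
      then show ?thesis using that[of s] by (simp add: dist_norm)
    qed
    have x'a: "norm (x' - a) \<le> 3 * \<rho>"
    proof -
      have "norm (x' - a) \<le> norm (x' - x) + \<rho>"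
        unfolding \<rho>_def by (rule norm_diff_triangle_le[OF order_refl order_refl])
      moreover have "2 * \<eta> * \<rho> \<le> 2 * 1 * \<rho>" using \<eta> by (intro mult_right_mono mult_left_mono) (auto simp: \<rho>_def)
      ultimately show ?thesis using x'(2) by (simp add: norm_minus_commute)
    qed
    have 1: "qdist (f x) (f x') \<le> K * (2 * \<eta> * \<rho>)"
      using lip[of x x'] mult_left_mono[OF x'(2) \<open>K \<ge> 0\<close>] by simp
    have "qdist (f x') (?T x') \<le> (\<Sum>c\<in>#C. norm (u c x' - (u c a + A c (x' - a))))"
      unfolding S[OF x'(1)] by (rule qdist_image_le_sum)
    also have "\<dots> \<le> real Q * (\<eta> * (3 * \<rho>))"
      unfolding size(2)[symmetric]
    proof (rule sum_mset_le_const)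
      fix c assume "c \<in># C"
      have "norm (u c x' - u c a - A c (x' - a)) \<le> \<eta> * norm (x' - a)"
        using x'a elim(2) \<open>c \<in># C\<close> by (intro \<delta>(2)) (auto simp: dist_norm \<rho>_def)
      also have "\<dots> \<le> \<eta> * (3 * \<rho>)" using x'a \<eta>(1) by (intro mult_left_mono) auto
      finally show "norm (u c x' - (u c a + A c (x' - a))) \<le> \<eta> * (3 * \<rho>)" by (simp add: diff_diff_add)
    qed
    finally have 2: "qdist (f x') (?T x') \<le> real Q * (\<eta> * (3 * \<rho>))" .
    have "qdist (?T x') (?T x) \<le> (\<Sum>c\<in>#C. norm ((u c a + A c (x' - a)) - (u c a + A c (x - a))))"
      by (rule qdist_image_le_sum)
    also have "\<dots> \<le> real Q * (M * (2 * \<eta> * \<rho>))"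
      unfolding size(2)[symmetric]
    proof (rule sum_mset_le_const)
      fix c assume c: "c \<in># C"
      interpret bounded_linear "A c" by (rule lin[OF c])
      have "norm ((u c a + A c (x' - a)) - (u c a + A c (x - a))) = norm (A c (x' - x))"
        by (simp add: diff)
      also have "\<dots> \<le> onorm (A c) * norm (x' - x)" by (rule onorm[OF lin[OF c]])
      also have "\<dots> \<le> M * (2 * \<eta> * \<rho>)"
        using x'(2) M c by (intro mult_mono) (auto simp: norm_minus_commute)
      finally show "norm ((u c a + A c (x' - a)) - (u c a + A c (x - a))) \<le> M * (2 * \<eta> * \<rho>)" .
    qed
    finally have 3: "qdist (?T x') (?T x) \<le> real Q * (M * (2 * \<eta> * \<rho>))" .
    have "qdist (f x) (?T x) \<le> qdist (f x) (f x') + (qdist (f x') (?T x') + qdist (?T x') (?T x))"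
      using size
      by (intro order_trans[OF qdist_triangle[of "f x" "f x'"]] add_left_mono qdist_triangle) auto
    also have "\<dots> \<le> K * (2 * \<eta> * \<rho>) + (real Q * (\<eta> * (3 * \<rho>)) + real Q * (M * (2 * \<eta> * \<rho>)))"
      by (intro add_mono 1 2 3)
    also have "\<dots> \<le> (2 * \<eta> * (K + real Q * 2 + real Q * M + 1)) * \<rho>"
    proof -
      have "0 \<le> \<eta> * \<rho>" "0 \<le> real Q * (\<eta> * \<rho>)" using \<eta>(1) by (simp_all add: \<rho>_def)
      then show ?thesis by (simp add: algebra_simps)
    qed
    also have "\<dots> \<le> \<epsilon> * \<rho>" using \<eta>\<epsilon> by (intro mult_right_mono) (simp_all add: \<rho>_def)
    finally show ?case by (simp add: \<rho>_def image_mset.compositionality o_def)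
  qed
qed

context finite_dim_haar
begin

theorem AE_multi_differentiable:
  fixes f :: "'x \<Rightarrow> 'y::{banach, second_countable_topology} multiset"
  assumes curves: "curves_ae_differentiable TYPE('y)" "curves_ae_differentiable TYPE(real)"
    and size: "\<And>x. size (f x) = Q"
    and lip: "\<And>x x'. qdist (f x) (f x') \<le> K * norm (x - x')" and K: "K \<ge> 0"
  shows "AE a in \<mu>. \<exists>As. size As = Q \<and> multi_differentiable f a As"
proof -
  obtain D :: "'y set" where D: "countable D" "\<And>X. open X \<Longrightarrow> X \<noteq> {} \<Longrightarrow> \<exists>d\<in>D. d \<in> X"
    using countable_dense_setE by metis
  define u where "u C k c x = cluster_mean C (1 / real (Suc k)) (f x) c" for C k c x
  define S where "S C k = {x. f x = image_mset (\<lambda>c. u C k c x) C}" for C k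
  have u_lip: "(3 * real Q * K)-lipschitz_on UNIV (u C k c)" for C k c
  proof (rule lipschitz_onI)
    fix x x'
    have "dist (u C k c x) (u C k c x') \<le> 3 * real Q * qdist (f x) (f x')"
      unfolding u_def dist_norm using cluster_mean_lipschitz[of "1 / real (Suc k)" "f x" "f x'"] by (simp add: size)
    also have "\<dots> \<le> 3 * real Q * (K * norm (x - x'))" by (intro mult_left_mono lip) auto
    finally show "dist (u C k c x) (u C k c x') \<le> 3 * real Q * K * dist x x'" by (simp add: dist_norm mult.assoc)
  qed (use K in simp)
  have "countable (mset ` lists D)" using D(1) by (intro countable_image countable_lists)
  moreover have "countable D" by (rule D(1))
  \<comment> \<open>One null set serves all centres and radii, so that outside it \<open>C\<close>
    and \<open>k\<close> may be chosen depending on the point.\<close>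
  ultimately have "AE a in \<mu>. \<forall>C\<in>mset ` lists D. \<forall>k.
     (\<exists>I. ((\<lambda>x. infdist x (S C k)) has_derivative I) (at a)) \<and> (\<forall>c\<in>set_mset C. \<exists>A. (u C k c has_derivative A) (at a))"
    by (simp only: AE_ball_countable AE_all_countable AE_conj_iff countable_finite finite_set_mset)
       (intro ballI allI conjI AE_lipschitz_differentiable[OF curves(2) curves(2) infdist_lipschitz]
          AE_lipschitz_differentiable[OF curves u_lip])
  then show ?thesis
  proof eventually_elim
    case (elim a)
    obtain C k where C: "set_mset C \<subseteq> D" "size C = size (f a)" "image_mset (cluster_mean C (1 / real (Suc k)) (f a)) C = f a"
      using cluster_mean_exists[OF D(2)] by metis
    obtain cs where cs: "mset cs = C" using ex_mset by blast
    with C(1) have "C \<in> mset ` lists D" by (intro image_eqI[of _ _ cs]) auto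
    with elim obtain I where I: "((\<lambda>x. infdist x (S C k)) has_derivative I) (at a)"
      and "\<forall>c\<in>set_mset C. \<exists>A. (u C k c has_derivative A) (at a)" by blast
    then obtain A where A: "\<And>c. c \<in># C \<Longrightarrow> (u C k c has_derivative A c) (at a)" by metis
    have "a \<in> S C k" using C(3) by (simp add: S_def u_def)
    have "multi_differentiable f a (image_mset (\<lambda>c x. u C k c a + A c (x - a)) C)"
      by (rule multi_differentiable_on_cluster_set[OF size _ lip K A _ \<open>a \<in> S C k\<close> I])
         (use C(2) size in \<open>auto simp: S_def\<close>)
    then show ?case using C(2) size by (intro exI conjI) auto
  qed
qed

end

section \<open>Approximate tangents\<close>

lemma multi_differentiable_at:
  assumes "multi_differentiable f a As" "\<And>x. size (f x) = size As"
  shows "f a = {#A a. A \<in># As#}"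
proof (rule qdist_eq_0_imp_eq)
  have "\<forall>\<^sub>F x in nhds a. qdist (f x) {#A x. A \<in># As#} \<le> 1 * norm (x - a)"
    using assms(1) unfolding multi_differentiable_def by (meson zero_less_one)
  then have "qdist (f a) {#A a. A \<in># As#} \<le> 1 * norm (a - a)" by (rule eventually_nhds_x_imp_x)
  then show "qdist (f a) {#A a. A \<in># As#} = 0" using qdist_nonneg[of "f a" "{#A a. A \<in># As#}"] by simp
qed (simp add: assms(2))

lemma affine_map_diff:
  assumes "affine_map A"
  shows "A x - A y = (A (x - y) - A 0)"
  using linear_diff[of "\<lambda>x. A x - A 0" x y] assms by (simp add: affine_map_def)

section \<open>Haar measure of balls, and approximate against strong tangents\<close>

context finite_dim_haar
begin

lemma cball_fmeasurable [simp]: "cball a r \<in> fmeasurable \<mu>"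
  using emeasure_cball_finite by (simp add: fmeasurable_def)

lemma measure_cball_eq: "measure \<mu> (cball x r) = measure \<mu> (cball y r)"
proof -
  have "(+) (x - y) ` cball y r = cball x r"
    using cball_translation[of "x - y" y r] by simp
  then show ?thesis using emeasure_translate[of "cball y r" "x - y"] by (simp add: measure_def)
qed

text \<open>If one ball of radius \<open>r\<close> were null, all its translates would be, and
  countably many of them cover the space.\<close>

lemma measure_cball_pos:
  assumes "r > 0"
  shows "measure \<mu> (cball x r) > 0"
proof (rule ccontr)
  assume "\<not> measure \<mu> (cball x r) > 0"
  then have "measure \<mu> (cball y r) = 0" for y
    using measure_cball_eq[of y r x] by (simp add: zero_less_measure_iff)
  then have null: "cball y r \<in> null_sets \<mu>" for y
    using emeasure_eq_measure2[OF cball_fmeasurable, of y r] by (simp add: null_sets_def)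
  obtain D :: "'x set" where D: "countable D" "\<And>x \<epsilon>. \<epsilon> > 0 \<Longrightarrow> \<exists>d\<in>D. dist d x < \<epsilon>"
    using countable_dense by blast
  have "(\<Union>d\<in>D. cball d r) = UNIV"
    using D(2)[OF assms] by (force simp: set_eq_iff intro: less_imp_le)
  moreover have "(\<Union>d\<in>D. cball d r) \<in> null_sets \<mu>"
    using D(1) null by (intro null_sets_UN') auto
  ultimately show False using haar by (auto simp: haar_measure_def)
qed

text \<open>A finite net of the ball of radius 2 is scaled by \<rho> and translated. The number of
  its points does not depend on \<rho>, and balls of equal radius have equal measure.\<close>

lemma measure_cball_doubling:
  assumes "\<epsilon> > 0"
  obtains N where "N > 0" "\<And>a x \<rho>. \<rho> > 0 \<Longrightarrow> measure \<mu> (cball a (2 * \<rho>)) \<le> N * measure \<mu> (cball x (\<epsilon> * \<rho>))"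
proof -
  obtain P where P: "finite P" "cball (0::'x) 2 \<subseteq> (\<Union>p\<in>P. ball p \<epsilon>)"
    using finite_net[OF assms] by blast
  have "measure \<mu> (cball a (2 * \<rho>)) \<le> real (card P + 1) * measure \<mu> (cball x (\<epsilon> * \<rho>))" if "\<rho> > 0" for a x \<rho>
  proof -
    have "cball a (2 * \<rho>) \<subseteq> (\<Union>p\<in>P. cball (a + \<rho> *\<^sub>R p) (\<epsilon> * \<rho>))"
    proof
      fix z assume "z \<in> cball a (2 * \<rho>)"
      then have "norm ((1 / \<rho>) *\<^sub>R (z - a)) \<le> 2"
        unfolding norm_scaleR using that by (simp add: dist_norm norm_minus_commute divide_le_eq)
      then have "(1 / \<rho>) *\<^sub>R (z - a) \<in> cball 0 2" by simp
      with P(2) obtain p where p: "p \<in> P" "norm (p - (1 / \<rho>) *\<^sub>R (z - a)) < \<epsilon>"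
        by (force simp: dist_norm)
      have "\<rho> * norm (p - (1 / \<rho>) *\<^sub>R (z - a)) = norm (\<rho> *\<^sub>R (p - (1 / \<rho>) *\<^sub>R (z - a)))"
        using that by simp
      also have "\<rho> *\<^sub>R (p - (1 / \<rho>) *\<^sub>R (z - a)) = a + \<rho> *\<^sub>R p - z"
        using that by (simp add: scaleR_diff_right)
      finally have "norm (a + \<rho> *\<^sub>R p - z) \<le> \<rho> * \<epsilon>"
        using mult_left_mono[OF less_imp_le[OF p(2)], of \<rho>] that by simp
      then show "z \<in> (\<Union>p\<in>P. cball (a + \<rho> *\<^sub>R p) (\<epsilon> * \<rho>))"
        using p(1) by (auto simp: dist_norm mult.commute)
    qed
    then have "measure \<mu> (cball a (2 * \<rho>)) \<le> measure \<mu> (\<Union>p\<in>P. cball (a + \<rho> *\<^sub>R p) (\<epsilon> * \<rho>))"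
      using P(1) by (intro measure_mono_fmeasurable fmeasurable.finite_UN) auto
    also have "\<dots> \<le> (\<Sum>p\<in>P. measure \<mu> (cball (a + \<rho> *\<^sub>R p) (\<epsilon> * \<rho>)))"
      using P(1) by (intro measure_UNION_le) auto
    also have "\<dots> = (\<Sum>p\<in>P. measure \<mu> (cball x (\<epsilon> * \<rho>)))"
      by (intro sum.cong refl measure_cball_eq)
    also have "\<dots> \<le> real (card P + 1) * measure \<mu> (cball x (\<epsilon> * \<rho>))"
      by (simp add: distrib_right)
    finally show ?thesis .
  qed
  then show ?thesis using that[of "real (card P + 1)"] by simp
qed

lemma bounded_linear_affine_part:
  fixes A :: "'x \<Rightarrow> 'y::real_normed_vector"
  assumes "affine_map A"
  shows "bounded_linear (\<lambda>x. A x - A 0)"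
  using assms by (intro bounded_linear_of_linear) (simp add: affine_map_def)

lemma norm_affine_diff_le:
  fixes A :: "'x \<Rightarrow> 'y::real_normed_vector"
  assumes "affine_map A"
  shows "norm (A x - A y) \<le> onorm (\<lambda>x. A x - A 0) * norm (x - y)"
  using onorm[OF bounded_linear_affine_part[OF assms], of "x - y"] by (simp add: affine_map_diff[OF assms, of x y])

lemma qdist_affine_lipschitz:
  fixes As :: "('x \<Rightarrow> 'y::real_normed_vector) multiset"
  assumes "\<forall>A\<in>#As. affine_map A"
  obtains M where "M \<ge> 0" "\<And>x y. qdist {#A x. A \<in># As#} {#A y. A \<in># As#} \<le> M * norm (x - y)"
proof
  let ?M = "\<Sum>A\<in>#As. onorm (\<lambda>x. A x - A 0)"
  show "0 \<le> ?M"
    using assms by (induction As) (auto intro!: add_nonneg_nonneg onorm_pos_le bounded_linear_affine_part)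
  show "qdist {#A x. A \<in># As#} {#A y. A \<in># As#} \<le> ?M * norm (x - y)" for x y
  proof -
    have "qdist {#A x. A \<in># As#} {#A y. A \<in># As#} \<le> (\<Sum>A\<in>#As. norm (A x - A y))"
      by (rule qdist_image_le_sum)
    also have "\<dots> \<le> (\<Sum>A\<in>#As. onorm (\<lambda>x. A x - A 0) * norm (x - y))"
      using assms by (intro sum_mset_mono norm_affine_diff_le) auto
    also have "\<dots> = ?M * norm (x - y)" by (simp add: sum_mset_distrib_right)
    finally show ?thesis .
  qed
qed

lemma multi_differentiable_imp_approx_tangent:
  fixes f :: "'x \<Rightarrow> 'y::real_normed_vector multiset"
  assumes "multi_differentiable f a As" "size As = Q"
  shows "approx_tangent \<mu> Q f a As"
  unfolding approx_tangent_def
proof (intro conjI allI impI)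
  fix \<epsilon> :: real assume "\<epsilon> > 0"
  then have "\<forall>\<^sub>F x in nhds a. qdist (f x) {#A x. A \<in># As#} \<le> \<epsilon> * norm (x - a)"
    using assms(1) by (simp add: multi_differentiable_def)
  then obtain \<delta> where \<delta>: "\<delta> > 0" "\<And>x. dist x a < \<delta> \<Longrightarrow> qdist (f x) {#A x. A \<in># As#} \<le> \<epsilon> * norm (x - a)"
    unfolding eventually_nhds_metric by blast
  have "{x. qdist (f x) {#A x. A \<in># As#} > \<epsilon> * norm (x - a)} \<inter> cball a r = {}" if "r < \<delta>" for r
  proof -
    have "\<not> \<epsilon> * norm (x - a) < qdist (f x) {#A x. A \<in># As#}" if "x \<in> cball a r" for x
      using \<delta>(2)[of x] that \<open>r < \<delta>\<close> by (simp add: dist_commute not_less)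
    then show ?thesis by blast
  qed
  then have "\<forall>\<^sub>F r in at_right 0. measure \<mu> ({x. qdist (f x) {#A x. A \<in># As#} > \<epsilon> * norm (x - a)} \<inter> cball a r)
                     / measure \<mu> (cball a r) = 0"
    using \<delta>(1) by (intro eventually_at_rightI[of 0 \<delta>]) auto
  then show "((\<lambda>r. measure \<mu> ({x. qdist (f x) {#A x. A \<in># As#} > \<epsilon> * norm (x - a)} \<inter> cball a r)
                     / measure \<mu> (cball a r)) \<longlongrightarrow> 0) (at_right 0)"
    by (rule tendsto_eventually)
qed (use assms in \<open>auto simp: multi_differentiable_def\<close>)

text \<open>A Lipschitz function which is close to its tangent on a set of density one at \<open>a\<close> is close to it
  everywhere near \<open>a\<close>: by doubling, every small ball near \<open>a\<close> meets that set.\<close>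

lemma approx_tangent_imp_multi_differentiable:
  fixes f :: "'x \<Rightarrow> 'y::real_normed_vector multiset"
  assumes tan: "approx_tangent \<mu> Q f a As" and size: "\<And>x. size (f x) = Q"
    and lip: "\<And>x x'. qdist (f x) (f x') \<le> K * norm (x - x')" and K: "K \<ge> 0"
  shows "multi_differentiable f a As"
proof -
  have As: "size As = Q" "\<forall>A\<in>#As. affine_map A" using tan by (auto simp: approx_tangent_def)
  define h where "h x = qdist (f x) {#A x. A \<in># As#}" for x
  obtain M where M: "M \<ge> 0" "\<And>x y. qdist {#A x. A \<in># As#} {#A y. A \<in># As#} \<le> M * norm (x - y)"
    using qdist_affine_lipschitz[OF As(2)] by blast
  have h_le: "h x \<le> h y + (K + M) * norm (x - y)" for x y
  proof -
    have "h x \<le> qdist (f x) (f y) + (h y + qdist {#A y. A \<in># As#} {#A x. A \<in># As#})"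
      unfolding h_def using size As(1)
      by (intro order_trans[OF qdist_triangle[of "f x" "f y"]] add_left_mono qdist_triangle) auto
    also have "\<dots> \<le> K * norm (x - y) + (h y + M * norm (y - x))"
      by (intro add_mono lip M(2) order_refl)
    finally show ?thesis by (simp add: algebra_simps norm_minus_commute)
  qed
  have "(K + M)-lipschitz_on UNIV h"
  proof (rule lipschitz_onI)
    show "dist (h x) (h y) \<le> (K + M) * dist x y" for x y
      using h_le[of x y] h_le[of y x] by (auto simp: dist_norm abs_le_iff norm_minus_commute)
  qed (use K M in simp)
  then have cont: "continuous_on UNIV h" by (rule lipschitz_on_continuous_on)
  define E where "E \<epsilon> = {x. h x > \<epsilon> * norm (x - a)}" for \<epsilon>
  have "open (E \<epsilon>)" for \<epsilon>
    unfolding E_def by (intro open_Collect_less continuous_intros cont)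
  then have E: "E \<epsilon> \<inter> cball a r \<in> fmeasurable \<mu>" for \<epsilon> r
    by (intro fmeasurable_Int_fmeasurable[of "cball a r", THEN subst[of _ _ "\<lambda>S. S \<in> _", OF Int_commute]]) auto
  have small: "\<exists>r0>0. \<forall>r. 0 < r \<and> r < r0 \<longrightarrow> measure \<mu> (E \<epsilon> \<inter> cball a r) < measure \<mu> (cball a r) / N"
    if "\<epsilon> > 0" "N > 0" for \<epsilon> N
  proof -
    have "((\<lambda>r. measure \<mu> (E \<epsilon> \<inter> cball a r) / measure \<mu> (cball a r)) \<longlongrightarrow> 0) (at_right 0)"
      using tan that(1) by (simp add: approx_tangent_def E_def h_def)
    then have "\<forall>\<^sub>F r in at_right 0. measure \<mu> (E \<epsilon> \<inter> cball a r) / measure \<mu> (cball a r) < 1 / N"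
      using that(2) by (intro order_tendstoD(2)) auto
    then obtain r0 where r0: "r0 > 0" "\<And>r. 0 < r \<Longrightarrow> r < r0 \<Longrightarrow> measure \<mu> (E \<epsilon> \<inter> cball a r) / measure \<mu> (cball a r) < 1 / N"
      by (auto simp: eventually_at_right_field)
    have "measure \<mu> (E \<epsilon> \<inter> cball a r) < measure \<mu> (cball a r) / N" if r: "0 < r" "r < r0" for r
      using r0(2)[OF r] measure_cball_pos[OF r(1), of a] by (simp add: field_simps)
    with r0(1) show ?thesis by blast
  qed
  \<comment> \<open>No small ball around \<open>a\<close> is contained in \<open>E 1\<close>, so
    there are points arbitrarily near \<open>a\<close> at which \<open>h\<close> is at most the
    distance to \<open>a\<close>; continuity gives the value at \<open>a\<close>, which the argument
    with relative distances below does not reach.\<close>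
  have ha: "h a \<le> 0"
  proof (rule field_le_epsilon)
    fix e :: real assume "e > 0"
    obtain r0 where r0: "r0 > 0" "\<And>r. 0 < r \<Longrightarrow> r < r0 \<Longrightarrow> measure \<mu> (E 1 \<inter> cball a r) < measure \<mu> (cball a r) / 1"
      using small[of 1 1] by auto
    define r where "r = min (r0 / 2) (e / (1 + (K + M)))"
    have KM: "1 + (K + M) > 0" using K M by simp
    then have "0 < e / (1 + (K + M))" using \<open>e > 0\<close> by (intro divide_pos_pos)
    then have r: "0 < r" "r < r0" using r0(1) by (auto simp: r_def min_less_iff_disj)
    have "r \<le> e / (1 + (K + M))" by (simp add: r_def)
    then have re: "(1 + (K + M)) * r \<le> e" using KM by (simp add: field_simps)
    have "\<not> cball a r \<subseteq> E 1"
      using r0(2)[OF r(1,2)] by (auto simp: Int_absorb1)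
    then obtain x where "x \<in> cball a r" "x \<notin> E 1" by blast
    then have x: "norm (x - a) \<le> r" "h x \<le> 1 * norm (x - a)"
      by (simp_all add: E_def dist_norm norm_minus_commute not_less)
    have "h a \<le> h x + (K + M) * norm (a - x)" by (rule h_le)
    also have "\<dots> \<le> (1 + (K + M)) * norm (x - a)" using x(2) by (simp add: algebra_simps norm_minus_commute)
    also have "\<dots> \<le> (1 + (K + M)) * r" using x(1) KM by (intro mult_left_mono) auto
    finally show "h a \<le> 0 + e" using re by simp
  qed
  show ?thesis
    unfolding multi_differentiable_def
  proof (intro conjI As allI impI)
    fix \<epsilon> :: real assume "\<epsilon> > 0"
    \<comment> \<open>A good point \<open>z\<close> within \<open>\<eta> * \<rho>\<close> of
      \<open>x\<close> has \<open>h z \<le> \<eta> * (2 * \<rho>)\<close>, and returning to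
      \<open>x\<close> adds \<open>(K + M) * (\<eta> * \<rho>)\<close>. The bound
      \<open>\<eta> \<le> 1\<close> keeps the small ball inside
      \<open>cball a (2 * \<rho>)\<close>.\<close>
    define \<eta> where "\<eta> = min 1 (\<epsilon> / (2 + (K + M)))"
    have KM: "2 + (K + M) > 0" using K M by simp
    have \<eta>: "\<eta> > 0" "\<eta> \<le> 1" using \<open>\<epsilon> > 0\<close> KM by (auto simp: \<eta>_def)
    have "\<eta> \<le> \<epsilon> / (2 + (K + M))" by (simp add: \<eta>_def)
    then have \<eta>\<epsilon>: "(2 + (K + M)) * \<eta> \<le> \<epsilon>" using KM by (simp add: field_simps)
    obtain N where N: "N > 0" "\<And>a x \<rho>. \<rho> > 0 \<Longrightarrow> measure \<mu> (cball a (2 * \<rho>)) \<le> N * measure \<mu> (cball x (\<eta> * \<rho>))"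
      using measure_cball_doubling[OF \<eta>(1)] by blast
    obtain r0 where r0: "r0 > 0" "\<And>r. 0 < r \<Longrightarrow> r < r0 \<Longrightarrow> measure \<mu> (E \<eta> \<inter> cball a r) < measure \<mu> (cball a r) / N"
      using small[OF \<eta>(1) N(1)] by auto
    have "h x \<le> \<epsilon> * norm (x - a)" if x: "dist x a < r0 / 2" for x
    proof (cases "x = a")
      case True
      then show ?thesis using ha by simp
    next
      case False
      define \<rho> where "\<rho> = norm (x - a)"
      have \<rho>: "\<rho> > 0" "2 * \<rho> < r0" using False x by (auto simp: \<rho>_def dist_norm)
      have sub: "cball x (\<eta> * \<rho>) \<subseteq> cball a (2 * \<rho>)"
      proof
        fix z assume "z \<in> cball x (\<eta> * \<rho>)"
        moreover have "\<eta> * \<rho> \<le> 1 * \<rho>" using \<eta>(2) \<rho>(1) by (intro mult_right_mono) auto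
        moreover have "dist a z \<le> dist x a + dist x z" by (rule dist_triangle3)
        ultimately show "z \<in> cball a (2 * \<rho>)" by (simp add: \<rho>_def dist_norm)
      qed
      have "\<not> cball x (\<eta> * \<rho>) \<subseteq> E \<eta>"
      proof
        assume "cball x (\<eta> * \<rho>) \<subseteq> E \<eta>"
        then have "measure \<mu> (cball x (\<eta> * \<rho>)) \<le> measure \<mu> (E \<eta> \<inter> cball a (2 * \<rho>))"
          using sub by (intro measure_mono_fmeasurable E) auto
        also have "\<dots> < measure \<mu> (cball a (2 * \<rho>)) / N" using \<rho> by (intro r0(2)) auto
        also have "\<dots> \<le> measure \<mu> (cball x (\<eta> * \<rho>))"
          using N(2)[OF \<rho>(1), of a x] N(1) by (simp add: field_simps)
        finally show False by simp
      qed
      then obtain z where "z \<in> cball x (\<eta> * \<rho>)" "z \<notin> E \<eta>" by blast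
      then have z: "norm (x - z) \<le> \<eta> * \<rho>" "z \<in> cball a (2 * \<rho>)" "h z \<le> \<eta> * norm (z - a)"
        using sub by (auto simp: E_def dist_norm not_less)
      have "h x \<le> h z + (K + M) * norm (x - z)" by (rule h_le)
      also have "\<dots> \<le> \<eta> * (2 * \<rho>) + (K + M) * (\<eta> * \<rho>)"
      proof (intro add_mono mult_left_mono z(1))
        have "\<eta> * norm (z - a) \<le> \<eta> * (2 * \<rho>)"
          using z(2) \<eta>(1) by (intro mult_left_mono) (auto simp: dist_norm norm_minus_commute)
        with z(3) show "h z \<le> \<eta> * (2 * \<rho>)" by simp
      qed (use K M in simp)
      also have "\<dots> = ((2 + (K + M)) * \<eta>) * \<rho>" by (simp add: algebra_simps)
      also have "\<dots> \<le> \<epsilon> * \<rho>" using \<eta>\<epsilon> \<rho>(1) by (intro mult_right_mono) auto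
      finally show ?thesis by (simp add: \<rho>_def)
    qed
    then show "\<forall>\<^sub>F x in nhds a. qdist (f x) {#A x. A \<in># As#} \<le> \<epsilon> * norm (x - a)"
      unfolding eventually_nhds_metric h_def using r0(1) by (intro exI[of _ "r0 / 2"]) auto
  qed
qed

section \<open>Comparison of \<open>qlip\<close> with the norm of the derivative\<close>

lemma deriv_norm_eq: "deriv_norm (image_mset (\<lambda>A x. A x - A 0) As) = sqrt (\<Sum>A\<in>#As. (onorm (\<lambda>x. A x - A 0))\<^sup>2)"
  by (simp add: deriv_norm_def image_mset.compositionality o_def)

text \<open>Matching \<open>A x\<close> with \<open>A a\<close> for every branch is one admissible
  matching of the tangent at \<open>x\<close> with \<open>f a\<close>; its cost is controlled by the
  operator norms.\<close>

lemma qlip_le_deriv_norm: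
  fixes f :: "'x \<Rightarrow> 'y::real_normed_vector multiset"
  assumes diff: "multi_differentiable f a As" and size: "\<And>x. size (f x) = size As"
  shows "qlip f a \<le> ennreal (deriv_norm (image_mset (\<lambda>A x. A x - A 0) As))"
proof (rule ennreal_le_epsilon)
  fix \<epsilon> :: real assume "\<epsilon> > 0"
  let ?d = "deriv_norm (image_mset (\<lambda>A x. A x - A 0) As)"
  have aff: "\<forall>A\<in>#As. affine_map A" using diff by (simp add: multi_differentiable_def)
  have fa: "f a = {#A a. A \<in># As#}" by (rule multi_differentiable_at[OF diff size])
  have "\<forall>\<^sub>F x in nhds a. qdist (f x) {#A x. A \<in># As#} \<le> \<epsilon> * norm (x - a)"
    using diff \<open>\<epsilon> > 0\<close> by (simp add: multi_differentiable_def)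
  then obtain \<delta> where \<delta>: "\<delta> > 0" "\<And>x. dist x a < \<delta> \<Longrightarrow> qdist (f x) {#A x. A \<in># As#} \<le> \<epsilon> * norm (x - a)"
    unfolding eventually_nhds_metric by blast
  have "0 \<le> (\<Sum>A\<in>#S. (h A)\<^sup>2)" for S and h :: "('x \<Rightarrow> 'y) \<Rightarrow> real" by (induction S) auto
  then have d0: "?d \<ge> 0" unfolding deriv_norm_eq by (rule real_sqrt_ge_zero)
  have "qlip f a \<le> ennreal (?d + \<epsilon>)"
    unfolding qlip_def
  proof (rule Limsup_bounded, rule eventually_at_rightI[of 0 \<delta>])
    fix r assume r: "r \<in> {0<..<\<delta>}"
    show "(SUP x\<in>cball a r - {a}. ennreal (qdist (f x) (f a) / norm (x - a))) \<le> ennreal (?d + \<epsilon>)"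
    proof (rule SUP_least)
      fix x assume x: "x \<in> cball a r - {a}"
      have "qdist {#A x. A \<in># As#} (f a) \<le> sqrt (\<Sum>A\<in>#As. (norm (A x - A a))\<^sup>2)"
        unfolding fa by (rule qdist_image_le_sqrt)
      also have "\<dots> \<le> sqrt (\<Sum>A\<in>#As. (onorm (\<lambda>x. A x - A 0))\<^sup>2 * (norm (x - a))\<^sup>2)"
        using aff
        by (intro real_sqrt_le_mono sum_mset_mono)
           (auto simp: power_mult_distrib[symmetric] intro!: power_mono norm_affine_diff_le)
      also have "\<dots> = ?d * norm (x - a)"
        by (simp add: deriv_norm_eq sum_mset_distrib_right[symmetric] real_sqrt_mult)
      finally have 1: "qdist {#A x. A \<in># As#} (f a) \<le> ?d * norm (x - a)" .
      have 2: "qdist (f x) {#A x. A \<in># As#} \<le> \<epsilon> * norm (x - a)"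
        using x r by (intro \<delta>(2)) (auto simp: dist_commute)
      have "qdist (f x) (f a) \<le> qdist (f x) {#A x. A \<in># As#} + qdist {#A x. A \<in># As#} (f a)"
        by (rule qdist_triangle) (simp_all add: size)
      with 1 2 have "qdist (f x) (f a) \<le> (?d + \<epsilon>) * norm (x - a)" by (simp add: algebra_simps)
      then show "ennreal (qdist (f x) (f a) / norm (x - a)) \<le> ennreal (?d + \<epsilon>)"
        using x by (intro ennreal_leI) (simp add: divide_le_eq)
    qed
  qed (rule \<delta>(1))
  also have "\<dots> = ennreal ?d + ennreal \<epsilon>" using d0 \<open>\<epsilon> > 0\<close> by (simp add: ennreal_plus)
  finally show "qlip f a \<le> ennreal ?d + ennreal \<epsilon>" .
qed

end

text \<open>A point \<open>A x\<close> is matched either with \<open>A a\<close> or with some \<open>A' a\<close> at distance at least \<open>\<delta>\<close> from \<open>A a\<close>.\<close>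

lemma norm_diff_le_qdist:
  assumes "A \<in># As" and sep: "\<And>A'. A' \<in># As \<Longrightarrow> A' a \<noteq> A a \<Longrightarrow> \<delta> \<le> dist (A a) (A' a)"
    and "2 * norm (A x - A a) \<le> \<delta>"
  shows "norm (A x - A a) \<le> qdist {#A x. A \<in># As#} {#A a. A \<in># As#}"
proof -
  obtain Al where Al: "mset Al = As" using ex_mset by blast
  then obtain i where i: "i < length Al" "Al ! i = A"
    using assms(1) by (metis in_set_conv_nth set_mset_mset)
  obtain zs where zs: "mset zs = {#A a. A \<in># As#}"
    "qdist {#A x. A \<in># As#} {#A a. A \<in># As#} = L2_set (\<lambda>i. norm (map (\<lambda>A. A x) Al ! i - zs ! i)) {..<size {#A x. A \<in># As#}}"
    using qdist_attained_left[of "map (\<lambda>A. A x) Al" "{#A x. A \<in># As#}" "{#A a. A \<in># As#}"] Al by auto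
  have "length zs = size As" using zs(1) by (metis size_image_mset size_mset)
  with i Al have len: "i < length zs" "i < size As" by auto
  have "zs ! i \<in># {#A a. A \<in># As#}" using len(1) unfolding zs(1)[symmetric] by simp
  then obtain A' where A': "A' \<in># As" "zs ! i = A' a" by auto
  have "norm (A x - A a) \<le> norm (A x - zs ! i)"
  proof (cases "A' a = A a")
    case True
    then show ?thesis using A' by simp
  next
    case False
    have "dist (A a) (A' a) \<le> norm (A x - A a) + norm (A x - A' a)"
      by (metis dist_norm dist_triangle3)
    with sep[OF A'(1) False] assms(3) show ?thesis by (simp add: A'(2))
  qed
  also have "\<dots> \<le> qdist {#A x. A \<in># As#} {#A a. A \<in># As#}"
    unfolding zs(2) using member_le_L2_set[of "{..<size {#A x. A \<in># As#}}" i "\<lambda>i. norm (map (\<lambda>A. A x) Al ! i - zs ! i)"] i len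
    by simp
  finally show ?thesis .
qed

context finite_dim_haar
begin

text \<open>On a sufficiently short step from \<open>a\<close> along \<open>v\<close>, the branch
  \<open>A\<close> stays closer to its own value at \<open>a\<close> than to any other value, so no
  matching can avoid its displacement.\<close>

lemma directional_le_qlip:
  fixes f :: "'x \<Rightarrow> 'y::real_normed_vector multiset"
  assumes diff: "multi_differentiable f a As" and size: "\<And>x. size (f x) = size As"
    and A: "A \<in># As" and "v \<noteq> 0"
  shows "ennreal (norm (A v - A 0) / norm v) \<le> qlip f a"
proof (rule ennreal_le_epsilon)
  fix \<epsilon> :: real assume "\<epsilon> > 0"
  define q where "q = norm (A v - A 0) / norm v"
  have aff: "affine_map A" using diff A by (simp add: multi_differentiable_def)
  interpret L: bounded_linear "\<lambda>x. A x - A 0" by (rule bounded_linear_affine_part[OF aff])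
  have fa: "f a = {#A a. A \<in># As#}" by (rule multi_differentiable_at[OF diff size])
  have "\<forall>\<^sub>F x in nhds a. qdist (f x) {#A x. A \<in># As#} \<le> \<epsilon> * norm (x - a)"
    using diff \<open>\<epsilon> > 0\<close> by (simp add: multi_differentiable_def)
  then obtain \<delta> where \<delta>: "\<delta> > 0" "\<And>x. dist x a < \<delta> \<Longrightarrow> qdist (f x) {#A x. A \<in># As#} \<le> \<epsilon> * norm (x - a)"
    unfolding eventually_nhds_metric by blast
  obtain \<delta>' where \<delta>': "\<delta>' > 0" "\<And>y z. y \<in># f a \<Longrightarrow> z \<in># f a \<Longrightarrow> y \<noteq> z \<Longrightarrow> \<delta>' \<le> dist y z"
    using finite_separation[of "set_mset (f a)"] by auto
  have sep: "\<delta>' \<le> dist (A a) (A' a)" if "A' \<in># As" "A' a \<noteq> A a" for A'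
    using \<delta>'(2)[of "A a" "A' a"] that A by (auto simp: fa)
  have "ennreal (q - \<epsilon>) \<le> qlip f a"
    unfolding qlip_def
  proof (rule le_Limsup, simp, rule eventually_at_rightI[of 0 1])
    fix r :: real assume r: "r \<in> {0<..<1}"
    \<comment> \<open>The step stays in the ball of radius \<open>r\<close>, within the range
      \<delta> of the tangent estimate, and moves \<open>A\<close> by \<open>q * s\<close>, at most
      half the separation \<delta>' of the values of \<open>f a\<close>; \<open>q + 1\<close> avoids
      division by zero.\<close>
    define s where "s = min (min r (\<delta> / 2)) (\<delta>' / (2 * (q + 1)))"
    have q0: "q \<ge> 0" by (simp add: q_def)
    have "0 < \<delta>' / (2 * (q + 1))" using \<delta>'(1) q0 by (intro divide_pos_pos) auto
    then have s: "s > 0" "s \<le> r" "s < \<delta>" using r \<delta>(1) by (auto simp: s_def min_less_iff_disj)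
    have sq: "2 * (q * s) \<le> \<delta>'"
    proof -
      have "s \<le> \<delta>' / (2 * (q + 1))" by (simp add: s_def)
      then have "2 * (q * s) + 2 * s \<le> \<delta>'" using q0 by (simp add: field_simps)
      then show ?thesis using s(1) by simp
    qed
    define x where "x = a + (s / norm v) *\<^sub>R v"
    have xa: "norm (x - a) = s" "x \<noteq> a" using s(1) \<open>v \<noteq> 0\<close> by (auto simp: x_def)
    have "A x - A a = (s / norm v) *\<^sub>R (A v - A 0)"
      using affine_map_diff[OF aff, of x a] L.scaleR[of "s / norm v" v] by (simp add: x_def)
    then have Ax: "norm (A x - A a) = q * s" using s(1) by (simp add: q_def)
    have "q * s \<le> qdist {#A x. A \<in># As#} (f a)"
      unfolding fa Ax[symmetric] proof (rule norm_diff_le_qdist[OF A])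
      show "\<delta>' \<le> dist (A a) (A' a)" if "A' \<in># As" "A' a \<noteq> A a" for A' using that by (rule sep)
      show "2 * norm (A x - A a) \<le> \<delta>'" using sq Ax by simp
    qed
    also have "\<dots> \<le> qdist {#A x. A \<in># As#} (f x) + qdist (f x) (f a)"
      by (rule qdist_triangle) (simp_all add: size)
    also have "qdist {#A x. A \<in># As#} (f x) \<le> \<epsilon> * s"
      using \<delta>(2)[of x] xa(1) s(3) by (simp add: qdist_commute size dist_norm)
    finally have "(q - \<epsilon>) * s \<le> qdist (f x) (f a)" by (simp add: algebra_simps)
    then have "q - \<epsilon> \<le> qdist (f x) (f a) / norm (x - a)"
      using s(1) by (simp add: xa(1) le_divide_eq)
    then show "ennreal (q - \<epsilon>) \<le> (SUP x\<in>cball a r - {a}. ennreal (qdist (f x) (f a) / norm (x - a)))"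
      using xa s(2) by (intro SUP_upper2[of x] ennreal_leI) (auto simp: dist_norm norm_minus_commute)
  qed simp
  then have "ennreal (q - \<epsilon>) + ennreal \<epsilon> \<le> qlip f a + ennreal \<epsilon>" by (rule add_right_mono)
  \<comment> \<open>For \<open>q < \<epsilon>\<close> the first summand is 0, because
    \<open>ennreal\<close> truncates negative numbers.\<close>
  moreover have "ennreal q \<le> ennreal (q - \<epsilon>) + ennreal \<epsilon>"
  proof (cases "q \<ge> \<epsilon>")
    case True
    then show ?thesis using \<open>\<epsilon> > 0\<close> by (simp add: ennreal_plus[symmetric] del: ennreal_plus)
  next
    case False
    then have "ennreal q \<le> ennreal \<epsilon>" by (intro ennreal_leI) simp
    then show ?thesis by (simp add: add_increasing)
  qed
  ultimately show "ennreal (norm (A v - A 0) / norm v) \<le> qlip f a + ennreal \<epsilon>"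
    unfolding q_def by (rule order_trans[rotated])
qed

text \<open>The directional bound limits the operator norm of every single branch by
  \<open>qlip f a\<close>; adding up as many squares as there are branches produces the factor under
  the root.\<close>

lemma deriv_norm_le_qlip:
  fixes f :: "'x \<Rightarrow> 'y::real_normed_vector multiset"
  assumes diff: "multi_differentiable f a As" and size: "\<And>x. size (f x) = size As"
  shows "ennreal (deriv_norm (image_mset (\<lambda>A x. A x - A 0) As)) \<le> ennreal (sqrt (real (size As))) * qlip f a"
proof -
  \<comment> \<open>The opposite inequality provides finiteness, so that the rest can be computed in
    the real numbers.\<close>
  have "qlip f a < \<top>"
    using qlip_le_deriv_norm[OF diff size] by (rule le_less_trans) simp
  then obtain q where q: "q \<ge> 0" "qlip f a = ennreal q"
    by (cases "qlip f a") auto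
  have le: "(onorm (\<lambda>x. A x - A 0))\<^sup>2 \<le> q\<^sup>2" if "A \<in># As" for A
  proof (intro power_mono onorm_bound q(1))
    show "norm (A v - A 0) \<le> q * norm v" for v
    proof (cases "v = 0")
      case False
      then have "norm (A v - A 0) / norm v \<le> q"
        using directional_le_qlip[OF diff size that False] q by simp
      then show ?thesis using False by (simp add: divide_le_eq)
    qed simp
    show "0 \<le> onorm (\<lambda>x. A x - A 0)"
      using diff that by (intro onorm_pos_le bounded_linear_affine_part) (auto simp: multi_differentiable_def)
  qed
  have "deriv_norm (image_mset (\<lambda>A x. A x - A 0) As) \<le> sqrt (real (size As) * q\<^sup>2)"
    unfolding deriv_norm_eq by (intro real_sqrt_le_mono sum_mset_le_const le)
  also have "\<dots> = sqrt (real (size As)) * q" using q(1) by (simp add: real_sqrt_mult)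
  finally show ?thesis
    using q by (simp add: ennreal_mult[symmetric] ennreal_leI)
qed

end

lemma multiset_eq_replicate_zero:
  assumes "\<And>y::'y::zero. y = 0"
  shows "(S :: 'y multiset) = replicate_mset (size S) 0"
  by (induction S) (use assms in auto)

theorem proposition2p5p9:
  fixes \<mu> :: "'x::banach measure"
    and f :: "'x \<Rightarrow> 'y::{banach, second_countable_topology} multiset"
    and Q :: nat
  assumes "\<exists>B::'x set. finite B \<and> span B = UNIV"
    and "haar_measure \<mu>"
    and "radon_nikodym_property TYPE('y)"
    and "Q \<ge> 1"
    and "\<And>x. size (f x) = Q"
    and "qlipschitz f"
  shows "AE a in \<mu>. approx_differentiable \<mu> Q f a \<and>
           qlip f a \<le> ennreal (deriv_norm (approx_deriv \<mu> Q f a)) \<and>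
           ennreal (deriv_norm (approx_deriv \<mu> Q f a)) \<le> ennreal (sqrt (real Q)) * qlip f a"
proof -
  obtain B0 :: "'x set" where B0: "finite B0" "span B0 = UNIV" using assms(1) by blast
  obtain B where B: "B \<subseteq> B0" "independent B" "B0 \<subseteq> span B"
    using real_vector.maximal_independent_subset by blast
  interpret finite_dim_haar B \<mu>
  proof
    show "span B = UNIV" using span_mono[OF B(3)] B0(2) by (simp add: span_span top.extremum_unique)
  qed (use B B0 assms(2) finite_subset in auto)
  obtain K where K: "K \<ge> 0" "\<And>x x'. qdist (f x) (f x') \<le> K * norm (x - x')"
    using assms(6) unfolding qlipschitz_def by blast
  have "AE a in \<mu>. \<exists>As. size As = Q \<and> multi_differentiable f a As"
  proof (cases "\<exists>y::'y. y \<noteq> 0")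
    case True
    have "curves_ae_differentiable TYPE('y)" by (rule curves_ae_differentiable_rnp[OF assms(3)])
    then show ?thesis
      using curves_ae_differentiable_real[OF _ True] by (intro AE_multi_differentiable[OF _ _ assms(5) K(2,1)])
  next
    case False
    \<comment> \<open>The null space contains no copy of the real line, from which differentiability
      of distance functions could be drawn; but then \<open>f\<close> is constant and its tangent is
      explicit.\<close>
    let ?As = "replicate_mset Q (\<lambda>x::'x. 0::'y)"
    have "f x = {#A x. A \<in># ?As#}" for x
      using multiset_eq_replicate_zero[of "f x"] False assms(5) by simp
    then have "qdist (f x) {#A x. A \<in># ?As#} = 0" for x by (simp add: qdist_refl)
    then have "multi_differentiable f a ?As" for a
      by (auto simp: multi_differentiable_def affine_map_def linear_zero in_replicate_mset split: if_splits)
    then show ?thesis by (intro AE_I2 exI[of _ ?As]) simp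
  qed
  then show ?thesis
  proof eventually_elim
    case (elim a)
    then have ex: "\<exists>As. approx_tangent \<mu> Q f a As"
      using multi_differentiable_imp_approx_tangent by blast
    \<comment> \<open>This is the tuple inside \<open>approx_deriv\<close>. It may differ from the
      strong tangent in \<open>ex\<close>, but as an approximate tangent of a Lipschitz map it is a
      strong one itself.\<close>
    define As where "As = (SOME As. approx_tangent \<mu> Q f a As)"
    have tan: "approx_tangent \<mu> Q f a As"
      unfolding As_def by (rule someI_ex[OF ex])
    then have diff: "multi_differentiable f a As"
      by (rule approx_tangent_imp_multi_differentiable[OF _ assms(5) K(2,1)])
    have size: "size As = Q" using tan by (simp add: approx_tangent_def)
    have deriv: "approx_deriv \<mu> Q f a = image_mset (\<lambda>A x. A x - A 0) As"
      by (simp add: approx_deriv_def As_def)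
    show ?case
      unfolding deriv using ex qlip_le_deriv_norm[OF diff] deriv_norm_le_qlip[OF diff] assms(5) size
      by (simp add: approx_differentiable_def)
  qed
qed

end
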